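(* Let $U\in\mathcal C^2(\mathbb R^d)$ and $0<m\le L$ be such that for all $x,y\in\mathbb R^d$, $|\nabla U(x)-\nabla U(y)|\le L|x-y|$ and $(x-y)\cdot(\nabla U(x)-\nabla U(y))\ge m|x-y|^2$. Suppose moreover that $\gamma\ge 2\sqrt L$ and $0<\delta\le m/(33\gamma^3)$. Let $x_\star$ be the global minimiser of $U$, $z_\star=(x_\star,0)$, and let $P$ and $P_M$ be the transition operators of the OBABO and OM(BAB)O chains with parameters $\delta,\gamma$ and potential $U$. Then for all integers $n\ge1$ and all $\nu,\mu\in\mathcal P_2(\mathbb R^{2d})$, $$\|\nu P_M^n-\mu P_M^n\|_{TV}\ \le\ \|\nu P^n-\mu P^n\|_{TV}+\mathcal E(\nu,\delta,n,d)+\mathcal E(\mu,\delta,n,d),$$ where $\mathcal E$ is such that (with $K_9,K_{10}$ the explicit constants given in the context): 1. For all $\nu\in\mathcal P_2(\mathbb R^{2d})$, $\mathcal E(\nu,\delta,n,d)\le\delta K_9\left(M_{\nu,2}+\delta nd\right)$. 2. If there exist $\ell\ge2$ and $L_\ell>0$ such that for all $x,y\in\mathbb R^d$ $$|\nabla^2U(y)-\nabla^2U(x)|\le\frac{L_\ell}{4}|x-y|\left(2+|x-x_\star|^{\ell-2}+|y-x_\star|^{\ell-2}\right),$$ and if $\nu\in\mathcal P_{\ell+1}(\mathbb R^{2d})$, then $\mathcal E(\nu,\delta,n,d)\le\delta^2K_{10}\left(M_{\nu,\ell+1}+\delta n(d+\ell-1)^{(\ell+1)/2}\right)$. 3. If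 there exist an integer $\ell\ge2$, $L_\ell>0$, an orthogonal matrix $\mathcal Q\in\mathcal O(d)$ and $U_1,\dots,U_d\in\mathcal C^2(\mathbb R)$ such that $U(\mathcal Qx)=\sum_{i=1}^dU_i(x_i)$ for all $x\in\mathbb R^d$ and, $x_{\star,i}$ being the minimiser of $U_i$, for all $i$ and all $x,y\in\mathbb R$ $$|U_i''(y)-U_i''(x)|\le\frac{L_\ell}{4}|x-y|\left(2+|x-x_{\star,i}|^{\ell-2}+|y-x_{\star,i}|^{\ell-2}\right),$$ and if $\nu\in\mathcal P_{\ell+1}(\mathbb R^{2d})$, then, denoting for $i\in\{1,\dots,d\}$ by $\nu_i$ the law on $\mathbb R^2$ of $(Y_i,W_i)$ where $(Y,W)=(\mathcal Q^{-1}X,\mathcal Q^{-1}V)$ with $(X,V)\sim\nu$, $$\mathcal E(\nu,\delta,n,d)\le\delta^2K_{10}\left(\sum_{i=1}^dM_{\nu_i,\ell+1}+\delta nd\,\ell^{(\ell+1)/2}\right).$$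
   Context: Given $\delta,\gamma>0$, set $\eta=e^{-\delta\gamma/2}$ and $H(x,v)=U(x)+|v|^2/2$. The OBABO chain on $\mathbb R^d\times\mathbb R^d$ has transition $(x_0,v_0)\to(x_1,v_1)$: $$x_1=x_0+\delta\left(\eta v_0+\sqrt{1-\eta^2}\,G\right)-\frac{\delta^2}{2}\nabla U(x_0),\qquad v_1=\eta^2v_0-\frac{\delta\eta}{2}\left(\nabla U(x_0)+\nabla U(x_1)\right)+\sqrt{1-\eta^2}\left(\eta G+G'\right),$$ with $G,G'$ independent standard Gaussian vectors in $\mathbb R^d$. The Verlet map is $\Phi_V(x,v)=\left(x',v-\tfrac\delta2(\nabla U(x)+\nabla U(x'))\right)$ with $x'=x+\delta v-\tfrac{\delta^2}{2}\nabla U(x)$, and $\alpha(x,v)=\exp\left(-\left(H(\Phi_V(x,v))-H(x,v)\right)_+\right)$. The OM(BAB)O chain (Metropolis-adjusted OBABO) has transition $(x_0,v_0)\to(x_1,v_1)$: $v_0'=\eta v_0+\sqrt{1-\eta^2}\,G$; then $(x_1,v_1')=\Phi_V(x_0,v_0')$ if $W\le\alpha(x_0,v_0')$ and $(x_1,v_1')=(x_0,-v_0')$ otherwise; then $v_1=\eta v_1'+\sqrt{1-\eta^2}\,G'$, where $G,G'$ are standard Gaussian vectors, $W$ is uniform on $[0,1]$, all independent. $P$, $P_M$ are the corresponding transition operators; $\nu P$ is the law after one step from initial law $\nu$. The quantity $\mathcal E(\nu,\delta,n,d)\in[0,+\infty]$ is an error term depending on the initial law $\nu$, on $\delta$, $n$,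 $d$ (and on $U,\gamma$); the claim asserts the existence of such a term satisfying the displayed inequality and the bounds 1–3. $\mathcal P_p(\mathbb R^{2d})$ is the set of probability measures with finite $p$-th moment; $M_{\nu,p}=\mathbb E_\nu(|Z-z_\star|^p)$ for $Z\sim\nu$; for the one-dimensional marginals $\nu_i$, $M_{\nu_i,p}=\mathbb E(|(Y_i,W_i)-(x_{\star,i},0)|^p)$. $\|\nu-\mu\|_{TV}=\inf_{X\sim\nu,Y\sim\mu}2\,\mathbb P(X\ne Y)$; $|\cdot|$ of a matrix is the operator norm. Constants: $$K_1=\sqrt3\max\left(L^{1/2},L^{-1/2}\right),\quad\kappa=\frac{m}{3\gamma},\quad K_3=L\left[1+e^{L\delta^2}\left(\frac\delta6+\frac{\delta^2L}{24}\right)\right]\left(1+\frac{\delta L}{2\sqrt m}\right),$$ $$K_9=2L(K_1+3)^2\left(1+\frac1{\sqrt m}+\frac{2\delta K_1K_3}{\kappa}\right)^2\left(1+\frac1\kappa\right)\left[\frac{\delta L}{8}+\left(1+\frac\delta4+\frac{\delta^2L}{4}\right)\left(1+\delta^2\frac{L^2}{4}\right)\right],$$ $$K_{10}=\left[1+2^\ell(K_1+3)^{\ell+1}\left(1+\frac1{\sqrt m}+\frac{2\delta K_1K_3}{\kappa}\right)^{\ell+1}\left(\frac1\kappa+1\right)\right]\left[\frac{L+2L^2}{4}\left(1+\delta^2\frac{L^2}{4}\right)+2^{(\ell-3)/2}L_\ell\left(1+\frac{L\delta}{2}\right)^3\left(1+\delta+\frac{\delta^2L}{2}\right)^{\ell-2}\right].$$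 *)

theory Defs
  imports "HOL-Probability.Probability"
begin

definition grad :: "('a::real_inner \<Rightarrow> real) \<Rightarrow> 'a \<Rightarrow> 'a" where
  "grad U x = (THE D. GDERIV U x :> D)"

definition hessian :: "(real ^ 'n \<Rightarrow> real) \<Rightarrow> real ^ 'n \<Rightarrow> real ^ 'n ^ 'n" where
  "hessian U x = jacobian (grad U) (at x)"

definition C2 :: "(real ^ 'n \<Rightarrow> real) \<Rightarrow> bool" where
  "C2 U \<longleftrightarrow> (\<forall>x. U differentiable at x) \<and> (\<forall>x. grad U differentiable at x) \<and>
     continuous_on UNIV (hessian U)"

definition C2_real :: "(real \<Rightarrow> real) \<Rightarrow> bool" where
  "C2_real f \<longleftrightarrow> (\<forall>x. f differentiable at x) \<and> (\<forall>x. deriv f differentiable at x) \<and>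
     continuous_on UNIV (deriv (deriv f))"

definition op_norm :: "real ^ 'n ^ 'm \<Rightarrow> real" where
  "op_norm A = onorm (\<lambda>x. A *v x)"

text \<open>Real powers of nonnegative reals with the convention that the zeroth power of 0 is 1;
  the library has \<^term>\<open>0 powr 0 = (0::real)\<close>.\<close>

definition rpow :: "real \<Rightarrow> real \<Rightarrow> real" where
  "rpow x a = (if a = 0 then 1 else x powr a)"

definition moment :: "'a::real_normed_vector measure \<Rightarrow> 'a \<Rightarrow> real \<Rightarrow> ennreal" where
  "moment \<nu> a p = (\<integral>\<^sup>+ z. ennreal (norm (z - a) powr p) \<partial>\<nu>)"

definition prob_moment :: "real \<Rightarrow> 'a::real_normed_vector measure set" where
  "prob_moment p = {\<nu>. prob_space \<nu> \<and> sets \<nu> = sets borel \<and> moment \<nu> 0 p < \<infinity>}"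

definition couplings :: "'a measure \<Rightarrow> 'a measure \<Rightarrow> ('a \<times> 'a) measure set" where
  "couplings \<nu> \<mu> = {\<pi>. prob_space \<pi> \<and> sets \<pi> = sets (\<nu> \<Otimes>\<^sub>M \<mu>) \<and>
     distr \<pi> \<nu> fst = \<nu> \<and> distr \<pi> \<mu> snd = \<mu>}"

text \<open>The infimum of twice the probability that X and Y differ, over all joint laws of (X, Y) with
  the given marginals. Mutually singular probability measures are at distance 2.\<close>

definition tv_dist :: "'a measure \<Rightarrow> 'a measure \<Rightarrow> ennreal" where
  "tv_dist \<nu> \<mu> = (INF \<pi>\<in>couplings \<nu> \<mu>. 2 * emeasure \<pi> {z \<in> space \<pi>. fst z \<noteq> snd z})"

definition std_gaussian :: "(real ^ 'n) measure" where
  "std_gaussian = density lborel (\<lambda>x. ennreal (\<Prod>i\<in>UNIV. std_normal_density (x $ i)))"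

definition eta :: "real \<Rightarrow> real \<Rightarrow> real" where
  "eta \<gamma> \<delta> = exp (- \<delta> * \<gamma> / 2)"

type_synonym 'n phase = "(real ^ 'n) \<times> (real ^ 'n)"

definition hamiltonian :: "(real ^ 'n \<Rightarrow> real) \<Rightarrow> 'n phase \<Rightarrow> real" where
  "hamiltonian U = (\<lambda>(x, v). U x + (norm v)\<^sup>2 / 2)"

definition verlet :: "(real ^ 'n \<Rightarrow> real) \<Rightarrow> real \<Rightarrow> 'n phase \<Rightarrow> 'n phase" where
  "verlet U \<delta> = (\<lambda>(x, v).
     let x' = x + \<delta> *\<^sub>R v - (\<delta>\<^sup>2 / 2) *\<^sub>R grad U x
     in (x', v - (\<delta> / 2) *\<^sub>R (grad U x + grad U x')))"

definition accept_prob :: "(real ^ 'n \<Rightarrow> real) \<Rightarrow> real \<Rightarrow> 'n phase \<Rightarrow> real" where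
  "accept_prob U \<delta> z = exp (- max 0 (hamiltonian U (verlet U \<delta> z) - hamiltonian U z))"

definition obabo_step ::
  "(real ^ 'n \<Rightarrow> real) \<Rightarrow> real \<Rightarrow> real \<Rightarrow> 'n phase \<Rightarrow> (real ^ 'n) \<times> (real ^ 'n) \<Rightarrow> 'n phase" where
  "obabo_step U \<gamma> \<delta> = (\<lambda>(x\<^sub>0, v\<^sub>0) (G, G').
     let \<eta> = eta \<gamma> \<delta>;
         x\<^sub>1 = x\<^sub>0 + \<delta> *\<^sub>R (\<eta> *\<^sub>R v\<^sub>0 + sqrt (1 - \<eta>\<^sup>2) *\<^sub>R G) - (\<delta>\<^sup>2 / 2) *\<^sub>R grad U x\<^sub>0;
         v\<^sub>1 = \<eta>\<^sup>2 *\<^sub>R v\<^sub>0 - (\<delta> * \<eta> / 2) *\<^sub>R (grad U x\<^sub>0 + grad U x\<^sub>1)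
               + sqrt (1 - \<eta>\<^sup>2) *\<^sub>R (\<eta> *\<^sub>R G + G')
     in (x\<^sub>1, v\<^sub>1))"

definition obabo_kernel ::
  "(real ^ 'n \<Rightarrow> real) \<Rightarrow> real \<Rightarrow> real \<Rightarrow> 'n phase \<Rightarrow> 'n phase measure" where
  "obabo_kernel U \<gamma> \<delta> z = distr (std_gaussian \<Otimes>\<^sub>M std_gaussian) borel (obabo_step U \<gamma> \<delta> z)"

definition ombabo_step ::
  "(real ^ 'n \<Rightarrow> real) \<Rightarrow> real \<Rightarrow> real \<Rightarrow> 'n phase
     \<Rightarrow> (real ^ 'n) \<times> (real ^ 'n) \<times> real \<Rightarrow> 'n phase" where
  "ombabo_step U \<gamma> \<delta> = (\<lambda>(x\<^sub>0, v\<^sub>0) (G, G', W).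
     let \<eta> = eta \<gamma> \<delta>;
         v\<^sub>0' = \<eta> *\<^sub>R v\<^sub>0 + sqrt (1 - \<eta>\<^sup>2) *\<^sub>R G;
         (x\<^sub>1, v\<^sub>1') = (if W \<le> accept_prob U \<delta> (x\<^sub>0, v\<^sub>0')
                      then verlet U \<delta> (x\<^sub>0, v\<^sub>0') else (x\<^sub>0, - v\<^sub>0'))
     in (x\<^sub>1, \<eta> *\<^sub>R v\<^sub>1' + sqrt (1 - \<eta>\<^sup>2) *\<^sub>R G'))"

definition ombabo_kernel ::
  "(real ^ 'n \<Rightarrow> real) \<Rightarrow> real \<Rightarrow> real \<Rightarrow> 'n phase \<Rightarrow> 'n phase measure" where
  "ombabo_kernel U \<gamma> \<delta> z =
     distr (std_gaussian \<Otimes>\<^sub>M (std_gaussian \<Otimes>\<^sub>M uniform_measure lborel {0..1})) borel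
       (ombabo_step U \<gamma> \<delta> z)"

definition law_after :: "('a \<Rightarrow> 'a measure) \<Rightarrow> nat \<Rightarrow> 'a measure \<Rightarrow> 'a measure" where
  "law_after K n \<nu> = ((\<lambda>\<rho>. \<rho> \<bind> K) ^^ n) \<nu>"

definition marginal :: "real ^ 'n ^ 'n \<Rightarrow> 'n phase measure \<Rightarrow> 'n \<Rightarrow> (real \<times> real) measure" where
  "marginal Q \<nu> i = distr \<nu> borel (\<lambda>(x, v). ((matrix_inv Q *v x) $ i, (matrix_inv Q *v v) $ i))"

definition K1 :: "real \<Rightarrow> real" where
  "K1 L = sqrt 3 * max (L powr (1/2)) (L powr (-1/2))"

definition kappa :: "real \<Rightarrow> real \<Rightarrow> real" where
  "kappa m \<gamma> = m / (3 * \<gamma>)"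

definition K3 :: "real \<Rightarrow> real \<Rightarrow> real \<Rightarrow> real" where
  "K3 m L \<delta> = L * (1 + exp (L * \<delta>\<^sup>2) * (\<delta> / 6 + \<delta>\<^sup>2 * L / 24)) * (1 + \<delta> * L / (2 * sqrt m))"

definition K9 :: "real \<Rightarrow> real \<Rightarrow> real \<Rightarrow> real \<Rightarrow> real" where
  "K9 m L \<gamma> \<delta> =
     2 * L * (K1 L + 3)\<^sup>2 * (1 + 1 / sqrt m + 2 * \<delta> * K1 L * K3 m L \<delta> / kappa m \<gamma>)\<^sup>2
     * (1 + 1 / kappa m \<gamma>)
     * (\<delta> * L / 8 + (1 + \<delta> / 4 + \<delta>\<^sup>2 * L / 4) * (1 + \<delta>\<^sup>2 * (L\<^sup>2 / 4)))"

definition K10 :: "real \<Rightarrow> real \<Rightarrow> real \<Rightarrow> real \<Rightarrow> real \<Rightarrow> real \<Rightarrow> real" where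
  "K10 m L \<gamma> \<delta> l L\<^sub>l =
     (1 + 2 powr l * (K1 L + 3) powr (l + 1)
          * (1 + 1 / sqrt m + 2 * \<delta> * K1 L * K3 m L \<delta> / kappa m \<gamma>) powr (l + 1)
          * (1 / kappa m \<gamma> + 1))
     * ((L + 2 * L\<^sup>2) / 4 * (1 + \<delta>\<^sup>2 * (L\<^sup>2 / 4))
        + 2 powr ((l - 3) / 2) * L\<^sub>l * (1 + L * \<delta> / 2) ^ 3
          * (1 + \<delta> + \<delta>\<^sup>2 * L / 2) powr (l - 2))"

end

theory Submission
  imports Defs
begin

text \<open>
  One step of either chain is a velocity refreshment, a Verlet step (accepted or not), and a second
  refreshment, so the laws after one step from a common point differ by at most the probability of
  rejection. Summing these probabilities along the OBABO chain gives the error term. A rejection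
  probability is at most the positive part of the energy increment of the Verlet map, which is
  quadratic in the distance to the minimiser, of order \<open>\<delta>\<^sup>2\<close>, and of order \<open>\<delta>\<^sup>3\<close> under the Hessian
  bound, where the trapezoid rule gains one order.

  The moments along the OBABO chain are controlled by a Lyapunov function: for \<open>\<gamma> \<ge> 2 sqrt L\<close> and small
  \<open>\<delta>\<close> a twisted quadratic norm contracts along the deterministic part of the step, and
  Gaussian integration by parts bounds its \<open>q\<close>-th power under the refreshment with the
  dependence \<open>d + 2 q - 2\<close> on the dimension. In the separable case the same argument runs coordinatewise:
  it only uses a linear image \<open>(T x, T v)\<close> of the chain whose force \<open>T (grad U x)\<close> depends on \<open>T x\<close> alone.
\<close>

section \<open>Total variation and couplings\<close>

text \<open>Since \<open>tv_dist\<close> is an infimum over couplings, the chains are compared on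
  sets: \<open>emeasure_le_tv_dist\<close> turns a coupling into an inequality between measures of
  sets, and \<open>tv_dist_le\<close> rebuilds a coupling from such inequalities. The constants of
  the claim depend on \<gamma> only through \<kappa>, and this shapes the moment bounds. The twisted
  norm controls |x| without loss, but |v| only up to a factor of order \<gamma>. Hence |v|^2 gets a
  recursion of its own, with rate \<theta> and a source of order L times the twisted norm. Summing a
  recursion of rate \<kappa> \<delta> over time costs 1/(\<kappa> \<delta>) for the initial law and
  one unit per step for the noise. So one power of \<delta> is lost: energy errors of order
  \<delta>^2 and \<delta>^3 give bounds of order \<delta> and \<delta>^2. Powers are averaged by
  convexity, with weights fixed by the constants involved. The q-th moments then carry the factor
  \<open>R1 powr q\<close>, which fits the (l+1)-st powers in \<open>K10\<close>. The constants that
  come out are not \<open>K9\<close> and \<open>K10\<close> themselves; they are smaller and are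
  compared with them at the end.\<close>

lemma emeasure_le_tv_dist:
  fixes \<nu> \<mu> :: "'a::{second_countable_topology,t2_space} measure"
  assumes A: "A \<in> sets borel" and \<nu>: "sets \<nu> = sets borel" and \<mu>: "sets \<mu> = sets borel"
    and fin: "emeasure \<nu> A \<noteq> \<infinity>" "emeasure \<mu> A \<noteq> \<infinity>"
  shows "2 * emeasure \<nu> A \<le> 2 * emeasure \<mu> A + tv_dist \<nu> \<mu>"
proof (cases "couplings \<nu> \<mu> = {}")
  case True
  \<comment> \<open>With no coupling at all the infimum is \<infinity>.\<close>
  then show ?thesis by (simp add: tv_dist_def)
next
  case False
  have *: "2 * emeasure \<nu> A \<le> 2 * emeasure \<mu> A + 2 * emeasure \<pi> {z \<in> space \<pi>. fst z \<noteq> snd z}"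
    if \<pi>: "\<pi> \<in> couplings \<nu> \<mu>" for \<pi>
  proof -
    have sp: "sets \<pi> = sets (\<nu> \<Otimes>\<^sub>M \<mu>)" and d: "distr \<pi> \<nu> fst = \<nu>" "distr \<pi> \<mu> snd = \<mu>"
      using \<pi> by (auto simp: couplings_def)
    have "sets \<pi> = sets (borel \<Otimes>\<^sub>M borel)"
      using sp sets_pair_measure_cong[OF \<nu> \<mu>] by simp
    then have sp': "sets \<pi> = sets borel" by (metis borel_prod)
    then have [simp]: "space \<pi> = UNIV" using sets_eq_imp_space_eq by force
    have diag: "{z \<in> space \<pi>. fst z \<noteq> snd z} \<in> sets \<pi>"
      unfolding sp' by (auto intro!: borel_open open_Collect_neq continuous_intros)
    have f: "fst \<in> measurable \<pi> \<nu>" and s: "snd \<in> measurable \<pi> \<mu>"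
      by (simp_all add: measurable_cong_sets[OF sp refl])
    have "emeasure \<nu> A = emeasure \<pi> (fst -` A \<inter> space \<pi>)"
      using emeasure_distr[OF f, of A] A \<nu> by (simp add: d)
    \<comment> \<open>If the first coordinate lies in A, so does the second unless the two
      differ.\<close>
    also have "\<dots> \<le> emeasure \<pi> ((snd -` A \<inter> space \<pi>) \<union> {z \<in> space \<pi>. fst z \<noteq> snd z})"
      using measurable_sets[OF s, of A] A \<mu> diag by (intro emeasure_mono) auto
    also have "\<dots> \<le> emeasure \<pi> (snd -` A \<inter> space \<pi>) + emeasure \<pi> {z \<in> space \<pi>. fst z \<noteq> snd z}"
      using measurable_sets[OF s, of A] A \<mu> diag by (intro emeasure_subadditive) auto
    also have "emeasure \<pi> (snd -` A \<inter> space \<pi>) = emeasure \<mu> A"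
      using emeasure_distr[OF s, of A] A \<mu> by (simp add: d)
    finally show ?thesis by (metis distrib_left mult_left_mono zero_le)
  qed
  have "2 * emeasure \<nu> A - 2 * emeasure \<mu> A \<le> tv_dist \<nu> \<mu>"
    unfolding tv_dist_def
  proof (rule INF_greatest)
    fix \<pi> assume "\<pi> \<in> couplings \<nu> \<mu>"
    from *[OF this] show "2 * emeasure \<nu> A - 2 * emeasure \<mu> A \<le> 2 * emeasure \<pi> {z \<in> space \<pi>. fst z \<noteq> snd z}"
      using fin by (simp add: ennreal_minus_le_iff ennreal_mult_eq_top_iff)
  qed
  then show ?thesis
    using fin by (simp add: ennreal_minus_le_iff ennreal_mult_eq_top_iff)
qed

text \<open>Otherwise the integral of \<open>h\<close> over the set where it exceeds 1 would be
  strictly larger than the measure of that set. In \<open>tv_dist_le\<close> this makes a density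
  usable as an acceptance probability.\<close>

lemma density_AE_le_one:
  assumes "finite_measure M" and h[measurable]: "h \<in> borel_measurable M"
    and le: "\<And>A. A \<in> sets M \<Longrightarrow> emeasure (density M h) A \<le> emeasure M A"
  shows "AE x in M. h x \<le> (1::ennreal)"
proof (rule ccontr)
  interpret finite_measure M by fact
  let ?B = "{x \<in> space M. 1 < h x}"
  have B[measurable]: "?B \<in> sets M" by measurable
  assume *: "\<not> (AE x in M. h x \<le> 1)"
  have "(\<integral>\<^sup>+x. indicator ?B x \<partial>M) < (\<integral>\<^sup>+x. h x * indicator ?B x \<partial>M)"
  proof (rule nn_integral_less)
    show "\<not> (AE x in M. h x * indicator ?B x \<le> indicator ?B x)"
    proof
      assume "AE x in M. h x * indicator ?B x \<le> indicator ?B x"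
      then have "AE x in M. h x \<le> 1"
        using AE_space by eventually_elim (auto simp: indicator_def not_less[symmetric] split: if_splits)
      with * show False ..
    qed
    show "AE x in M. indicator ?B x \<le> h x * indicator ?B x"
      by (intro always_eventually allI) (auto simp: indicator_def)
  qed (auto simp: emeasure_eq_ennreal_measure)
  then show False
    using le[OF B] by (simp add: emeasure_density not_less[symmetric])
qed

lemma prob_space_uniform_01: "prob_space (uniform_measure lborel {0..1::real})"
  by (rule prob_space_uniform_measure) auto

text \<open>Integrates out the uniform acceptance variable, in the maximal coupling below as well as
  in the Metropolis step.\<close>

lemma nn_integral_uniform_01_if_le:
  assumes r: "0 \<le> r" "r \<le> (1::real)"
  shows "(\<integral>\<^sup>+w. (if w \<le> r then a else b) \<partial>uniform_measure lborel {0..1}) = ennreal r * a + ennreal (1 - r) * b"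
proof -
  have "(\<integral>\<^sup>+w. (if w \<le> r then a else b) \<partial>uniform_measure lborel {0..1})
      = (\<integral>\<^sup>+w. a * indicator {..r} w + b * indicator {r<..} w \<partial>uniform_measure lborel {0..1})"
    by (intro nn_integral_cong) auto
  also have "\<dots> = a * emeasure (uniform_measure lborel {0..1}) {..r} + b * emeasure (uniform_measure lborel {0..1}) {r<..}"
    by (subst nn_integral_add) (auto simp: nn_integral_cmult_indicator)
  also have "emeasure (uniform_measure lborel {0..1}) {..r} = ennreal r"
  proof -
    have "{0..1} \<inter> {..r} = {0..r}" using r by auto
    then show ?thesis using r by (simp add: emeasure_uniform_measure divide_ennreal_def)
  qed
  also have "emeasure (uniform_measure lborel {0..1}) {r<..} = ennreal (1 - r)"
  proof -
    have "{0..1} \<inter> {r<..} = {r<..1}" using r by auto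
    then show ?thesis using r by (simp add: emeasure_uniform_measure divide_ennreal_def)
  qed
  finally show ?thesis by (simp add: mult.commute)
qed

text \<open>A maximal coupling built by acceptance and rejection. Let Y be a Hahn set on which \<nu>
  dominates \<mu>. A point x drawn from \<nu> is kept for both marginals with probability
  \<open>r x\<close>, the density of \<mu> with respect to \<nu> on Y and 1 off Y. Otherwise the
  second marginal is redrawn from \<rho>, the normalised excess of \<mu> over \<nu> off Y. The
  coordinates differ only after a rejection, whose probability is \<open>c\<close> = \<nu>(Y) -
  \<mu>(Y), and \<open>le\<close> applied to Y gives c \<le> e.\<close>

lemma tv_dist_le:
  fixes \<nu> \<mu> :: "'a::{second_countable_topology,t2_space} measure" and e :: ennreal
  assumes prob: "prob_space \<nu>" "prob_space \<mu>"
    and \<nu>: "sets \<nu> = sets borel" and \<mu>: "sets \<mu> = sets borel"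
    and le: "\<And>A. A \<in> sets borel \<Longrightarrow> emeasure \<nu> A \<le> emeasure \<mu> A + e"
  shows "tv_dist \<nu> \<mu> \<le> 2 * e"
proof -
  interpret N: prob_space \<nu> by fact
  interpret M: prob_space \<mu> by fact
  note [measurable_cong] = \<nu> \<mu>
  have [simp]: "space \<nu> = UNIV" "space \<mu> = UNIV"
    using sets_eq_imp_space_eq[OF \<nu>] sets_eq_imp_space_eq[OF \<mu>] by simp_all
  have N1: "emeasure \<nu> UNIV = 1" using N.emeasure_space_1 by simp
  obtain Y where Y[measurable]: "Y \<in> sets borel"
    and Y1: "\<And>X. X \<in> sets borel \<Longrightarrow> X \<subseteq> Y \<Longrightarrow> emeasure \<mu> X \<le> emeasure \<nu> X"
    and Y2: "\<And>X. X \<in> sets borel \<Longrightarrow> X \<inter> Y = {} \<Longrightarrow> emeasure \<nu> X \<le> emeasure \<mu> X"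
    using unsigned_Hahn_decomposition[of \<mu> \<nu> UNIV] \<nu> \<mu> by auto
  define \<nu>Y where "\<nu>Y = density \<nu> (indicator Y)"
  define \<mu>Y where "\<mu>Y = density \<mu> (indicator Y)"
  have s\<nu>Y[measurable_cong]: "sets \<nu>Y = sets borel" and s\<mu>Y[measurable_cong]: "sets \<mu>Y = sets borel"
    by (simp_all add: \<nu>Y_def \<mu>Y_def \<nu> \<mu>)
  have e\<nu>Y: "emeasure \<nu>Y A = emeasure \<nu> (Y \<inter> A)" and e\<mu>Y: "emeasure \<mu>Y A = emeasure \<mu> (Y \<inter> A)"
    if "A \<in> sets borel" for A
    using that by (simp_all add: \<nu>Y_def \<mu>Y_def emeasure_restricted \<nu> \<mu>)
  interpret NY: finite_measure \<nu>Y
    by (rule finite_measureI) (simp add: \<nu>Y_def emeasure_restricted \<nu>)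
  interpret MY: finite_measure \<mu>Y
    by (rule finite_measureI) (simp add: \<mu>Y_def emeasure_restricted \<mu>)
  have sub: "emeasure \<mu>Y A \<le> emeasure \<nu>Y A" if "A \<in> sets borel" for A
    using that Y1[of "Y \<inter> A"] by (simp add: e\<mu>Y e\<nu>Y)
  have "absolutely_continuous \<nu>Y \<mu>Y"
    unfolding absolutely_continuous_def
  proof
    fix A assume "A \<in> null_sets \<nu>Y"
    then have A: "A \<in> sets borel" "emeasure \<nu>Y A = 0" by (simp_all add: null_sets_def s\<nu>Y)
    with sub[OF A(1)] show "A \<in> null_sets \<mu>Y" by (simp add: null_sets_def s\<mu>Y)
  qed
  then obtain h where h[measurable]: "h \<in> borel_measurable borel" and dh: "density \<nu>Y h = \<mu>Y"
    using NY.Radon_Nikodym_finite_measure[OF MY.finite_measure_axioms] measurable_cong_sets[OF s\<nu>Y refl]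
    by (simp add: s\<nu>Y s\<mu>Y) blast

  have h1: "AE x in \<nu>Y. h x \<le> 1"
  proof (rule density_AE_le_one)
    show "finite_measure \<nu>Y" "h \<in> borel_measurable \<nu>Y" by (fact NY.finite_measure_axioms, measurable)
    show "emeasure (density \<nu>Y h) A \<le> emeasure \<nu>Y A" if "A \<in> sets \<nu>Y" for A
      using that sub by (simp add: dh s\<nu>Y)
  qed
  note emeq = N.emeasure_eq_measure M.emeasure_eq_measure
  define c where "c = measure \<nu> Y - measure \<mu> Y"
  have c0: "0 \<le> c" using Y1[OF Y] by (simp add: c_def emeq)
  have c_le: "ennreal c \<le> e"
  proof -
    have "ennreal (measure \<nu> Y) - ennreal (measure \<mu> Y) \<le> e"
      using le[OF Y] by (simp add: emeq ennreal_minus_le_iff)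
    then show ?thesis by (simp add: c_def ennreal_minus)
  qed
  have compl: "measure \<mu> (-Y) = measure \<nu> (-Y) + c"
    using N.prob_compl[of Y] M.prob_compl[of Y] \<nu> \<mu> by (simp add: c_def Compl_eq_Diff_UNIV)
  have le\<nu>\<mu>: "measure \<nu> A \<le> measure \<mu> A" if "A \<in> sets borel" "A \<inter> Y = {}" for A
    using Y2[OF that] by (simp add: emeq)
  define \<nu>Z where "\<nu>Z = density \<nu> (indicator (- Y))"
  define \<mu>Z where "\<mu>Z = density \<mu> (indicator (- Y))"
  have e\<nu>Z: "emeasure \<nu>Z A = emeasure \<nu> (-Y \<inter> A)" and e\<mu>Z: "emeasure \<mu>Z A = emeasure \<mu> (-Y \<inter> A)"
    if "A \<in> sets borel" for A
    using that by (simp_all only: \<nu>Z_def \<mu>Z_def emeasure_restricted \<nu> \<mu> sets.compl_sets borel_comp Y)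
  \<comment> \<open>If c = 0 nothing is ever redrawn and any law can serve as \<rho>; \<nu> is
    taken.\<close>
  obtain \<rho> where \<rho>: "prob_space \<rho>" "sets \<rho> = sets borel"
    and c\<rho>: "\<And>A. A \<in> sets borel \<Longrightarrow> ennreal (measure \<mu> (-Y \<inter> A) - measure \<nu> (-Y \<inter> A)) = ennreal c * emeasure \<rho> A"
  proof (cases "c = 0")
    case True
    have "measure \<mu> (-Y \<inter> A) - measure \<nu> (-Y \<inter> A) = 0" if A: "A \<in> sets borel" for A
    proof -
      have eq: "-Y = (-Y \<inter> A) \<union> (-Y - A)" by blast
      have [measurable]: "-Y \<inter> A \<in> sets borel" "-Y - A \<in> sets borel" using A by auto
      have "measure \<mu> (-Y) = measure \<mu> (-Y \<inter> A) + measure \<mu> (-Y - A)"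
        by (subst eq, rule M.finite_measure_Union) (use \<mu> A in auto)
      moreover have "measure \<nu> (-Y) = measure \<nu> (-Y \<inter> A) + measure \<nu> (-Y - A)"
        by (subst eq, rule N.finite_measure_Union) (use \<nu> A in auto)
      moreover have "measure \<nu> (-Y \<inter> A) \<le> measure \<mu> (-Y \<inter> A)" "measure \<nu> (-Y - A) \<le> measure \<mu> (-Y - A)"
        using A by (intro le\<nu>\<mu>; auto)+
      ultimately show ?thesis using compl True by linarith
    qed
    then show ?thesis using that[of \<nu>] True \<nu> N.prob_space_axioms by auto
  next
    case False
    with c0 have c: "0 < c" by simp
    define \<rho> where "\<rho> = scale_measure (ennreal (1 / c)) (diff_measure \<mu>Z \<nu>Z)"
    have \<rho>A: "emeasure \<rho> A = ennreal ((measure \<mu> (-Y \<inter> A) - measure \<nu> (-Y \<inter> A)) / c)"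
      if A: "A \<in> sets borel" for A
    proof -
      have "emeasure (diff_measure \<mu>Z \<nu>Z) A = emeasure \<mu>Z A - emeasure \<nu>Z A"
      proof (rule emeasure_diff_measure)
        show "finite_measure \<mu>Z" "finite_measure \<nu>Z"
          by (rule finite_measureI, simp add: \<mu>Z_def \<nu>Z_def emeasure_restricted \<nu> \<mu>)+
        show "emeasure \<nu>Z B \<le> emeasure \<mu>Z B" if "B \<in> sets \<mu>Z" for B
        proof -
          have B: "B \<in> sets borel" using that by (simp add: \<mu>Z_def \<mu>)
          show ?thesis unfolding e\<mu>Z[OF B] e\<nu>Z[OF B] using B by (intro Y2) auto
        qed
      qed (use A in \<open>simp_all add: \<mu>Z_def \<nu>Z_def \<mu> \<nu>\<close>)
      then show ?thesis using A c le\<nu>\<mu>[of "-Y \<inter> A"]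
        by (simp add: \<rho>_def e\<mu>Z e\<nu>Z emeq ennreal_minus ennreal_mult[symmetric])
    qed
    have s\<rho>: "sets \<rho> = sets borel" by (simp add: \<rho>_def \<mu>Z_def \<mu>)
    have "emeasure \<rho> UNIV = 1"
      using \<rho>A[of UNIV] compl c by simp
    then have "prob_space \<rho>"
      using sets_eq_imp_space_eq[OF s\<rho>] by (intro prob_spaceI) simp
    moreover have "ennreal (measure \<mu> (-Y \<inter> A) - measure \<nu> (-Y \<inter> A)) = ennreal c * emeasure \<rho> A" if A: "A \<in> sets borel" for A
      using c le\<nu>\<mu>[of "-Y \<inter> A"] A by (simp add: \<rho>A ennreal_mult[symmetric])
    ultimately show ?thesis using that s\<rho> by blast
  qed
  interpret R: prob_space \<rho> by fact
  note [measurable_cong] = \<rho>(2)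
  \<comment> \<open>\<open>h\<close> is at most 1 only almost everywhere; the truncation makes
    \<open>r x\<close> a probability at every point.\<close>
  define r where "r x = (if x \<in> Y then enn2real (min 1 (h x)) else 1)" for x
  have r[measurable]: "r \<in> borel_measurable borel" unfolding r_def by measurable
  have r01: "0 \<le> r x" "r x \<le> 1" for x
    by (auto simp: r_def intro!: enn2real_leI)
  have rh: "AE x in \<nu>. x \<in> Y \<longrightarrow> ennreal (r x) = h x"
  proof -
    have "AE x in \<nu>. x \<in> Y \<longrightarrow> h x \<le> 1"
      using h1 unfolding \<nu>Y_def by (subst (asm) AE_density) (auto simp: indicator_def)
    then show ?thesis
      by eventually_elim (auto simp: r_def min_def ennreal_enn2real_if top_unique)
  qed
  interpret UN: prob_space "uniform_measure lborel {0..1::real}" by (rule prob_space_uniform_01)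
  interpret UR: pair_prob_space "uniform_measure lborel {0..1::real}" \<rho> ..
  interpret NUR: pair_prob_space \<nu> "uniform_measure lborel {0..1::real} \<Otimes>\<^sub>M \<rho>" ..
  define F where "F = (\<lambda>(x, w, y). (x, if w \<le> r x then x else y))"
  have F[measurable]: "F \<in> \<nu> \<Otimes>\<^sub>M (uniform_measure lborel {0..1::real} \<Otimes>\<^sub>M \<rho>) \<rightarrow>\<^sub>M borel \<Otimes>\<^sub>M borel"
    unfolding F_def by measurable
  define \<pi> where "\<pi> = distr (\<nu> \<Otimes>\<^sub>M (uniform_measure lborel {0..1::real} \<Otimes>\<^sub>M \<rho>)) (borel \<Otimes>\<^sub>M borel) F"
  have s\<pi>[measurable_cong]: "sets \<pi> = sets (borel \<Otimes>\<^sub>M borel)" by (simp add: \<pi>_def)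
  have p\<pi>: "prob_space \<pi>" unfolding \<pi>_def by (rule NUR.prob_space_distr) measurable
  have int: "(\<integral>\<^sup>+z. f z \<partial>\<pi>) = (\<integral>\<^sup>+x. ennreal (r x) * f (x, x) + ennreal (1 - r x) * (\<integral>\<^sup>+y. f (x, y) \<partial>\<rho>) \<partial>\<nu>)"
    if f[measurable]: "f \<in> borel_measurable (borel \<Otimes>\<^sub>M borel)" for f
  proof -
    have "(\<integral>\<^sup>+z. f z \<partial>\<pi>) = (\<integral>\<^sup>+z. f (F z) \<partial>(\<nu> \<Otimes>\<^sub>M (uniform_measure lborel {0..1::real} \<Otimes>\<^sub>M \<rho>)))"
      unfolding \<pi>_def by (rule nn_integral_distr) measurable
    also have "\<dots> = (\<integral>\<^sup>+x. \<integral>\<^sup>+wy. f (F (x, wy)) \<partial>(uniform_measure lborel {0..1::real} \<Otimes>\<^sub>M \<rho>) \<partial>\<nu>)"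
      by (rule sigma_finite_measure.nn_integral_fst[symmetric]) (unfold_locales, measurable)
    also have "\<dots> = (\<integral>\<^sup>+x. \<integral>\<^sup>+w. \<integral>\<^sup>+y. f (F (x, w, y)) \<partial>\<rho> \<partial>uniform_measure lborel {0..1::real} \<partial>\<nu>)"
      by (intro nn_integral_cong R.nn_integral_fst[symmetric]) measurable
    also have "\<dots> = (\<integral>\<^sup>+x. \<integral>\<^sup>+w. (if w \<le> r x then f (x, x) else (\<integral>\<^sup>+y. f (x, y) \<partial>\<rho>)) \<partial>uniform_measure lborel {0..1::real} \<partial>\<nu>)"
      by (intro nn_integral_cong) (simp add: F_def R.emeasure_space_1)
    also have "\<dots> = (\<integral>\<^sup>+x. ennreal (r x) * f (x, x) + ennreal (1 - r x) * (\<integral>\<^sup>+y. f (x, y) \<partial>\<rho>) \<partial>\<nu>)"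
      by (intro nn_integral_cong nn_integral_uniform_01_if_le r01)
    finally show ?thesis .
  qed
  \<comment> \<open>The accepted mass, carried by the diagonal, is the minimum of the two measures:
    \<nu> off Y and \<mu> on Y.\<close>
  have rY: "(\<integral>\<^sup>+x. ennreal (r x) * indicator A x \<partial>\<nu>) = emeasure \<nu> (-Y \<inter> A) + emeasure \<mu> (Y \<inter> A)"
    if A[measurable]: "A \<in> sets borel" for A
  proof -
    have "(\<integral>\<^sup>+x. ennreal (r x) * indicator A x \<partial>\<nu>)
        = (\<integral>\<^sup>+x. indicator (-Y \<inter> A) x + indicator Y x * (h x * indicator A x) \<partial>\<nu>)"
      by (intro nn_integral_cong_AE) (use rh in eventually_elim, auto simp: r_def indicator_def)
    also have "\<dots> = emeasure \<nu> (-Y \<inter> A) + emeasure (density \<nu>Y h) A"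
      unfolding \<nu>Y_def by (subst nn_integral_add) (auto simp: emeasure_density nn_integral_density \<nu>)
    finally show ?thesis using e\<mu>Y[OF A] by (simp add: dh)
  qed
  have r'Y: "(\<integral>\<^sup>+x. ennreal (1 - r x) \<partial>\<nu>) = ennreal c"
  proof -
    have "ennreal c + (\<integral>\<^sup>+x. ennreal (r x) \<partial>\<nu>) = 1"
      using rY[of UNIV] N.prob_compl[of Y] \<nu> c0
      by (simp add: emeq ennreal_plus[symmetric] c_def Compl_eq_Diff_UNIV del: ennreal_plus)
    moreover have "(\<integral>\<^sup>+x. ennreal (1 - r x) \<partial>\<nu>) + (\<integral>\<^sup>+x. ennreal (r x) \<partial>\<nu>) = 1"
    proof -
      have "(\<integral>\<^sup>+x. ennreal (1 - r x) \<partial>\<nu>) + (\<integral>\<^sup>+x. ennreal (r x) \<partial>\<nu>)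
          = (\<integral>\<^sup>+x. ennreal (1 - r x) + ennreal (r x) \<partial>\<nu>)"
        by (rule nn_integral_add[symmetric]) measurable
      also have "\<dots> = (\<integral>\<^sup>+x. 1 \<partial>\<nu>)"
        using r01 by (intro nn_integral_cong) (simp add: ennreal_plus[symmetric] del: ennreal_plus)
      finally show ?thesis by (simp add: N1)
    qed
    moreover have rfin: "(\<integral>\<^sup>+x. ennreal (r x) \<partial>\<nu>) \<noteq> \<infinity>"
    proof -
      have "(\<integral>\<^sup>+x. ennreal (r x) \<partial>\<nu>) \<le> (\<integral>\<^sup>+x. 1 \<partial>\<nu>)"
        using r01 by (intro nn_integral_mono) simp
      then show ?thesis by (auto simp: N1 top_unique)
    qed
    ultimately have "(\<integral>\<^sup>+x. ennreal (r x) \<partial>\<nu>) + (\<integral>\<^sup>+x. ennreal (1 - r x) \<partial>\<nu>) = (\<integral>\<^sup>+x. ennreal (r x) \<partial>\<nu>) + ennreal c"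
      by (simp add: add.commute)
    with rfin show ?thesis by (simp add: ennreal_add_left_cancel)
  qed
  have "\<pi> \<in> couplings \<nu> \<mu>"
    unfolding couplings_def
  proof (intro CollectI conjI)
    show "prob_space \<pi>" by fact
    show "sets \<pi> = sets (\<nu> \<Otimes>\<^sub>M \<mu>)" by (simp add: s\<pi> sets_pair_measure_cong[OF \<nu> \<mu>])
    show "distr \<pi> \<nu> fst = \<nu>"
    proof (rule measure_eqI)
      fix A assume "A \<in> sets (distr \<pi> \<nu> fst)"
      then have A[measurable]: "A \<in> sets borel" by (simp add: \<nu>)
      have "emeasure (distr \<pi> \<nu> fst) A = (\<integral>\<^sup>+z. indicator A (fst z) \<partial>\<pi>)"
        by (subst nn_integral_indicator[symmetric], simp add: \<nu>, subst nn_integral_distr) (auto simp: measurable_cong_sets[OF s\<pi> \<nu>])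
      also have "\<dots> = (\<integral>\<^sup>+x. (ennreal (r x) + ennreal (1 - r x)) * indicator A x \<partial>\<nu>)"
        by (subst int) (auto simp: R.emeasure_space_1 distrib_right)
      also have "\<dots> = emeasure \<nu> A"
        by (simp add: ennreal_plus[symmetric] r01 \<nu> del: ennreal_plus)
      finally show "emeasure (distr \<pi> \<nu> fst) A = emeasure \<nu> A" .
    qed simp
    show "distr \<pi> \<mu> snd = \<mu>"
    proof (rule measure_eqI)
      fix A assume "A \<in> sets (distr \<pi> \<mu> snd)"
      then have A[measurable]: "A \<in> sets borel" by (simp add: \<mu>)
      have "emeasure (distr \<pi> \<mu> snd) A = (\<integral>\<^sup>+z. indicator A (snd z) \<partial>\<pi>)"
        by (subst nn_integral_indicator[symmetric], simp add: \<mu>, subst nn_integral_distr) (auto simp: measurable_cong_sets[OF s\<pi> \<mu>])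
      also have "\<dots> = (\<integral>\<^sup>+x. ennreal (r x) * indicator A x \<partial>\<nu>) + ennreal c * emeasure \<rho> A"
        by (subst int) (auto simp: \<rho> nn_integral_add nn_integral_multc r'Y)
      also have "\<dots> = emeasure \<nu> (-Y \<inter> A) + emeasure \<mu> (Y \<inter> A) + ennreal (measure \<mu> (-Y \<inter> A) - measure \<nu> (-Y \<inter> A))"
        by (simp add: rY c\<rho>)
      also have "\<dots> = ennreal (measure \<mu> (Y \<inter> A) + measure \<mu> (-Y \<inter> A))"
        using le\<nu>\<mu>[of "-Y \<inter> A"] by (simp add: emeq ennreal_plus[symmetric] del: ennreal_plus)
      also have "measure \<mu> (Y \<inter> A) + measure \<mu> (-Y \<inter> A) = measure \<mu> A"
        by (subst M.finite_measure_Union[symmetric]) (auto simp: \<mu> intro!: arg_cong[where f="measure \<mu>"])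
      finally show "emeasure (distr \<pi> \<mu> snd) A = emeasure \<mu> A" by (simp add: emeq)
    qed simp
  qed
  then have "tv_dist \<nu> \<mu> \<le> 2 * emeasure \<pi> {z \<in> space \<pi>. fst z \<noteq> snd z}"
    unfolding tv_dist_def by (rule INF_lower)
  also have "emeasure \<pi> {z \<in> space \<pi>. fst z \<noteq> snd z} \<le> ennreal c"
  proof -
    have D: "{z::'a\<times>'a. fst z \<noteq> snd z} \<in> sets (borel \<Otimes>\<^sub>M borel)"
      unfolding borel_prod by (auto intro!: borel_open open_Collect_neq continuous_intros)
    have [simp]: "space \<pi> = UNIV" using sets_eq_imp_space_eq[OF s\<pi>] by (simp add: space_pair_measure)
    have "emeasure \<pi> {z \<in> space \<pi>. fst z \<noteq> snd z} = (\<integral>\<^sup>+z. indicator {z. fst z \<noteq> snd z} z \<partial>\<pi>)"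
      using D by (simp add: s\<pi>)
    also have "\<dots> \<le> (\<integral>\<^sup>+x. ennreal (1 - r x) \<partial>\<nu>)"
    proof (subst int, (use D in measurable)[1], rule nn_integral_mono)
      fix x
      have "(\<integral>\<^sup>+y. indicator {z. fst z \<noteq> snd z} (x, y) \<partial>\<rho>) \<le> (\<integral>\<^sup>+y. 1 \<partial>\<rho>)"
        by (intro nn_integral_mono) (auto simp: indicator_def)
      then have "(\<integral>\<^sup>+y. indicator {z. fst z \<noteq> snd z} (x, y) \<partial>\<rho>) \<le> 1" by (simp add: R.emeasure_space_1)
      then show "ennreal (r x) * indicator {z. fst z \<noteq> snd z} (x, x)
          + ennreal (1 - r x) * (\<integral>\<^sup>+y. indicator {z. fst z \<noteq> snd z} (x, y) \<partial>\<rho>) \<le> ennreal (1 - r x)"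
        using mult_left_mono[of _ 1 "ennreal (1 - r x)"] by simp
    qed
    finally show ?thesis by (simp add: r'Y)
  qed
  finally show ?thesis using c_le by (meson dual_order.trans mult_left_mono zero_le)
qed

section \<open>Gaussian integration by parts\<close>

text \<open>Dominated convergence for difference quotients: by the mean value inequality, the bound
  \<open>h\<close> on the derivative over the whole interval bounds them as well.\<close>

lemma has_real_derivative_integral:
  fixes F F' :: "real \<Rightarrow> 'a \<Rightarrow> real"
  assumes t0: "t0 \<in> {a<..<b}"
    and int: "\<And>t. t \<in> {a<..<b} \<Longrightarrow> integrable M (F t)"
    and deriv: "\<And>t x. t \<in> {a<..<b} \<Longrightarrow> ((\<lambda>t. F t x) has_real_derivative F' t x) (at t)"
    and bound: "\<And>t x. t \<in> {a<..<b} \<Longrightarrow> \<bar>F' t x\<bar> \<le> h x"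
    and h: "integrable M h" and meas: "F' t0 \<in> borel_measurable M"
  shows "((\<lambda>t. \<integral>x. F t x \<partial>M) has_real_derivative (\<integral>x. F' t0 x \<partial>M)) (at t0)"
  unfolding has_field_derivative_iff tendsto_at_iff_sequentially comp_def
proof (intro allI impI)
  fix X :: "nat \<Rightarrow> real" assume X: "\<forall>i. X i \<in> UNIV - {t0}" and lim: "X \<longlonglongrightarrow> t0"
  have "\<forall>\<^sub>F i in sequentially. X i \<in> {a<..<b}"
    using topological_tendstoD[OF lim open_greaterThanLessThan t0] .
  then obtain N where N: "\<And>i. i \<ge> N \<Longrightarrow> X i \<in> {a<..<b}" by (auto simp: eventually_sequentially)
  \<comment> \<open>Only a tail of the sequence is sure to stay inside the interval.\<close>
  define Y where "Y i = X (i + N)" for i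
  have Y: "Y i \<in> {a<..<b}" "Y i \<noteq> t0" for i using N[of "i + N"] X by (auto simp: Y_def)
  have Ylim: "Y \<longlonglongrightarrow> t0" unfolding Y_def by (rule LIMSEQ_ignore_initial_segment[OF lim])
  have "(\<lambda>i. \<integral>x. (F (Y i) x - F t0 x) / (Y i - t0) \<partial>M) \<longlonglongrightarrow> (\<integral>x. F' t0 x \<partial>M)"
  proof (rule integral_dominated_convergence[where w = h])
    show "(\<lambda>x. (F (Y i) x - F t0 x) / (Y i - t0)) \<in> borel_measurable M" for i
      using int[OF Y(1)[of i]] int[OF t0] by simp
    show "AE x in M. (\<lambda>i. (F (Y i) x - F t0 x) / (Y i - t0)) \<longlonglongrightarrow> F' t0 x"
    proof (rule AE_I2)
      fix x
      have "((\<lambda>y. (F y x - F t0 x) / (y - t0)) \<longlongrightarrow> F' t0 x) (at t0)"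
        using deriv[OF t0, of x] by (simp add: has_field_derivative_iff)
      then show "(\<lambda>i. (F (Y i) x - F t0 x) / (Y i - t0)) \<longlonglongrightarrow> F' t0 x"
        unfolding tendsto_at_iff_sequentially comp_def using Y Ylim by blast
    qed
    show "AE x in M. norm ((F (Y i) x - F t0 x) / (Y i - t0)) \<le> h x" for i
    proof (rule AE_I2)
      fix x
      have "norm (F (Y i) x - F t0 x) \<le> h x * norm (Y i - t0)"
      proof (rule field_differentiable_bound[where f' = "\<lambda>t. F' t x"])
        show "convex {a<..<b}" by simp
        fix z assume z: "z \<in> {a<..<b}"
        show "((\<lambda>y. F y x) has_field_derivative F' z x) (at z within {a<..<b})"
          using deriv[OF z] by (rule has_field_derivative_at_within)
        show "norm (F' z x) \<le> h x" using bound[OF z] by simp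
      qed (use Y t0 in auto)
      then show "norm ((F (Y i) x - F t0 x) / (Y i - t0)) \<le> h x"
        using Y(2)[of i] by (simp add: field_simps)
    qed
  qed (use h meas in auto)
  then have "(\<lambda>i. ((\<integral>x. F (Y i) x \<partial>M) - (\<integral>x. F t0 x \<partial>M)) / (Y i - t0)) \<longlonglongrightarrow> (\<integral>x. F' t0 x \<partial>M)"
    using int[OF Y(1)] int[OF t0] by simp
  then show "(\<lambda>i. ((\<integral>x. F (X i) x \<partial>M) - (\<integral>x. F t0 x \<partial>M)) / (X i - t0)) \<longlonglongrightarrow> (\<integral>x. F' t0 x \<partial>M)"
    unfolding Y_def by (rule LIMSEQ_offset)
qed

section \<open>The standard Gaussian density and its tails\<close>

definition gauss_dens :: "real ^ 'n \<Rightarrow> real" where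
  "gauss_dens x = (1 / sqrt (2 * pi)) ^ CARD('n) * exp (- (norm x)\<^sup>2 / 2)"

lemma prod_std_normal_density_Basis:
  "(\<Prod>b\<in>Basis. std_normal_density (x \<bullet> b)) = (1 / sqrt (2 * pi)) ^ DIM('a) * exp (- (norm (x::'a::euclidean_space))\<^sup>2 / 2)"
proof -
  have "(norm x)\<^sup>2 = (\<Sum>b\<in>Basis. (x \<bullet> b)\<^sup>2)"
    unfolding power2_norm_eq_inner by (simp add: euclidean_inner[of x x] power2_eq_square)
  then show ?thesis
    by (simp add: std_normal_density_def prod.distrib exp_sum[symmetric] sum_negf sum_divide_distrib[symmetric] power_one_over prod_dividef)
qed

lemma gauss_dens_eq_Basis: "gauss_dens x = (\<Prod>b\<in>Basis. std_normal_density (x \<bullet> b))"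
  by (simp add: gauss_dens_def prod_std_normal_density_Basis)

lemma std_gaussian_eq: "(std_gaussian :: (real ^ 'n) measure) = density lborel (\<lambda>x. ennreal (gauss_dens x))"
proof -
  have "(\<Prod>i\<in>UNIV. std_normal_density (x $ i)) = gauss_dens x" for x :: "real ^ 'n"
  proof -
    have "(norm x)\<^sup>2 = (\<Sum>i\<in>UNIV. (x $ i)\<^sup>2)"
      unfolding power2_norm_eq_inner by (simp add: inner_vec_def power2_eq_square)
    then show ?thesis
      by (simp add: gauss_dens_def std_normal_density_def prod.distrib exp_sum[symmetric] sum_negf sum_divide_distrib[symmetric] power_one_over prod_dividef)
  qed
  then show ?thesis by (simp only: std_gaussian_def)
qed

lemma gauss_dens_pos: "0 < gauss_dens x" by (simp add: gauss_dens_def)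

lemma borel_measurable_gauss_dens[measurable]: "gauss_dens \<in> borel_measurable borel"
  unfolding gauss_dens_def[abs_def] by measurable

lemma sets_std_gaussian[measurable_cong, simp]: "sets std_gaussian = sets borel"
  by (simp add: std_gaussian_def)

lemma space_std_gaussian[simp]: "space std_gaussian = UNIV"
  by (simp add: std_gaussian_def)

lemma prob_space_std_gaussian: "prob_space (std_gaussian :: (real ^ 'n) measure)"
proof
  have "emeasure (std_gaussian :: (real ^ 'n) measure) (space std_gaussian)
      = (\<integral>\<^sup>+x. (\<Prod>b\<in>Basis. ennreal (std_normal_density (x \<bullet> b))) \<partial>(lborel :: (real ^ 'n) measure))"
    by (simp add: std_gaussian_eq gauss_dens_eq_Basis emeasure_density prod_ennreal)
  also have "\<dots> = (\<Prod>b\<in>(Basis :: (real ^ 'n) set). \<integral>\<^sup>+t. ennreal (std_normal_density t) \<partial>lborel)"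
    by (rule nn_integral_lborel_prod) auto
  also have "(\<integral>\<^sup>+t. ennreal (std_normal_density t) \<partial>lborel) = 1"
    using prob_space.emeasure_space_1[OF prob_space_normal_density[of 1 0]]
    by (simp add: emeasure_density)
  finally show "emeasure (std_gaussian :: (real ^ 'n) measure) (space std_gaussian) = 1" by simp
qed

lemma integrable_exp_neg_norm_sq: "integrable lborel (\<lambda>x::'a::euclidean_space. exp (- (norm x)\<^sup>2 / 4))"
proof (rule integrableI_nonneg)
  have eq: "exp (- (norm x)\<^sup>2 / 4) = (\<Prod>b\<in>Basis. exp (- (x \<bullet> b)\<^sup>2 / 4))" for x :: 'a
  proof -
    have "(norm x)\<^sup>2 = (\<Sum>b\<in>Basis. (x \<bullet> b)\<^sup>2)"
      unfolding power2_norm_eq_inner by (simp add: euclidean_inner[of x x] power2_eq_square)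
    then show ?thesis by (simp add: exp_sum[symmetric] sum_negf sum_divide_distrib[symmetric])
  qed
  have 1: "(\<integral>\<^sup>+t. ennreal (exp (- t\<^sup>2 / 4)) \<partial>(lborel :: real measure)) < \<infinity>"
  proof -
    have "integrable lborel (\<lambda>t::real. (2 * sqrt pi) * normal_density 0 (sqrt 2) t)"
      by (intro integrable_mult_right integrable_normal_density) simp
    moreover have "(\<lambda>t::real. (2 * sqrt pi) * normal_density 0 (sqrt 2) t) = (\<lambda>t. exp (- t\<^sup>2 / 4))"
      by (simp add: fun_eq_iff normal_density_def real_sqrt_mult)
    ultimately have "integrable lborel (\<lambda>t::real. exp (- t\<^sup>2 / 4))" by simp
    then show ?thesis by (simp add: nn_integral_eq_integral)
  qed
  have "(\<integral>\<^sup>+x. ennreal (exp (- (norm x)\<^sup>2 / 4)) \<partial>(lborel::'a measure))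
     = (\<integral>\<^sup>+x. (\<Prod>b\<in>Basis. ennreal (exp (- (x \<bullet> b)\<^sup>2 / 4))) \<partial>(lborel::'a measure))"
    unfolding eq by (subst prod_ennreal) simp_all
  also have "\<dots> = (\<Prod>b\<in>(Basis :: 'a set). \<integral>\<^sup>+t. ennreal (exp (- t\<^sup>2 / 4)) \<partial>lborel)"
    by (rule nn_integral_lborel_prod) auto
  also have "\<dots> < \<infinity>" using 1 by (simp add: ennreal_prod_eq_top power_less_top_ennreal)
  finally show "(\<integral>\<^sup>+x. ennreal (exp (- (norm x)\<^sup>2 / 4)) \<partial>(lborel::'a measure)) < \<infinity>" .
qed auto

text \<open>Completing the square, (|x|/2 - K)^2 \<ge> 0, moves the factor exp (K |x|) into the
  slower Gaussian exp (- |x|^2 / 4) at the price of exp (K^2).\<close>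

lemma integrable_exp_norm_gauss:
  "integrable lborel (\<lambda>x::'a::euclidean_space. exp (K * norm x - (norm x)\<^sup>2 / 2))"
proof (rule Bochner_Integration.integrable_bound)
  show "integrable lborel (\<lambda>x::'a. exp (K\<^sup>2) * exp (- (norm x)\<^sup>2 / 4))"
    by (intro integrable_mult_right integrable_exp_neg_norm_sq)
  show "AE x::'a in lborel. norm (exp (K * norm x - (norm x)\<^sup>2 / 2)) \<le> norm (exp (K\<^sup>2) * exp (- (norm x)\<^sup>2 / 4))"
  proof (rule AE_I2)
    fix x :: 'a
    have "0 \<le> (norm x / 2 - K)\<^sup>2" by simp
    then show "norm (exp (K * norm x - (norm x)\<^sup>2 / 2)) \<le> norm (exp (K\<^sup>2) * exp (- (norm x)\<^sup>2 / 4))"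
      by (simp add: exp_add[symmetric] power2_eq_square algebra_simps)
  qed
qed measurable

lemma integrable_std_gaussian_iff:
  fixes f :: "real ^ 'n \<Rightarrow> real"
  assumes [measurable]: "f \<in> borel_measurable borel"
  shows "integrable std_gaussian f \<longleftrightarrow> integrable lborel (\<lambda>x. gauss_dens x * f x)"
  unfolding std_gaussian_eq by (subst integrable_density) (auto simp: less_imp_le gauss_dens_pos)

lemma integral_std_gaussian:
  fixes f :: "real ^ 'n \<Rightarrow> real"
  assumes [measurable]: "f \<in> borel_measurable borel"
  shows "(\<integral>x. f x \<partial>std_gaussian) = (\<integral>x. gauss_dens x * f x \<partial>lborel)"
  unfolding std_gaussian_eq by (subst integral_density) (auto simp: less_imp_le gauss_dens_pos)

text \<open>Exponential growth is the class of integrands used for the Gaussian: it is stable under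
  products, polynomial factors and translations.\<close>

lemma integrable_std_gaussian_exp_bound:
  fixes f :: "real ^ 'n \<Rightarrow> real"
  assumes [measurable]: "f \<in> borel_measurable borel" and b: "\<And>x. \<bar>f x\<bar> \<le> C * exp (K * norm x)"
  shows "integrable std_gaussian f"
  unfolding integrable_std_gaussian_iff[OF assms(1)]
proof (rule Bochner_Integration.integrable_bound)
  let ?c = "(1 / sqrt (2 * pi)) ^ CARD('n)"
  show "integrable lborel (\<lambda>x::real ^ 'n. ?c * (C * exp (K * norm x - (norm x)\<^sup>2 / 2)))"
    by (intro integrable_mult_right integrable_exp_norm_gauss)
  show "AE x in lborel. norm (gauss_dens x * f x) \<le> norm (?c * (C * exp (K * norm x - (norm x)\<^sup>2 / 2)))"
  proof (rule AE_I2)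
    fix x :: "real ^ 'n"
    have "gauss_dens x * \<bar>f x\<bar> \<le> gauss_dens x * (C * exp (K * norm x))"
      using b[of x] gauss_dens_pos[of x] by (intro mult_left_mono) auto
    also have "\<dots> = ?c * (C * exp (K * norm x - (norm x)\<^sup>2 / 2))"
    proof -
      have "exp (K * norm x - (norm x)\<^sup>2 / 2) = exp (- (norm x)\<^sup>2 / 2) * exp (K * norm x)"
        by (simp add: exp_add[symmetric])
      then show ?thesis by (simp add: gauss_dens_def)
    qed
    finally show "norm (gauss_dens x * f x) \<le> norm (?c * (C * exp (K * norm x - (norm x)\<^sup>2 / 2)))"
      using gauss_dens_pos[of x] order_trans[OF abs_ge_zero b[of 0]] by (simp add: abs_mult)
  qed
qed measurable

lemma power2_norm_add_scaleR:
  "(norm (x + t *\<^sub>R u))\<^sup>2 = (norm x)\<^sup>2 + 2 * t * (x \<bullet> u) + t\<^sup>2 * (norm u)\<^sup>2"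
  unfolding power2_norm_eq_inner by (simp add: inner_simps inner_commute algebra_simps power2_eq_square)

text \<open>A bound uniform in t, as domination requires: the square of the shift has the favourable
  sign, and Cauchy-Schwarz bounds the cross term.\<close>

lemma gauss_dens_shift_le:
  assumes "\<bar>t\<bar> \<le> 1"
  shows "gauss_dens (x + t *\<^sub>R u) \<le> gauss_dens x * exp (norm u * norm x)"
proof -
  have "(norm (x + t *\<^sub>R u))\<^sup>2 = (norm x)\<^sup>2 + 2 * t * (x \<bullet> u) + t\<^sup>2 * (norm u)\<^sup>2"
    by (simp add: power2_norm_add_scaleR inner_commute)
  moreover have "\<bar>t * (x \<bullet> u)\<bar> \<le> 1 * (norm x * norm u)"
    unfolding abs_mult by (intro mult_mono assms Cauchy_Schwarz_ineq2) auto
  then have "2 * t * (x \<bullet> u) \<ge> - 2 * (norm u * norm x)" by (auto simp: algebra_simps abs_le_iff)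
  moreover have "0 \<le> t\<^sup>2 * (norm u)\<^sup>2" by simp
  ultimately have "- (norm (x + t *\<^sub>R u))\<^sup>2 / 2 \<le> - (norm x)\<^sup>2 / 2 + norm u * norm x" by linarith
  then show ?thesis by (simp add: gauss_dens_def exp_add[symmetric])
qed

lemma integral_lborel_translate:
  fixes f :: "'a::euclidean_space \<Rightarrow> real"
  assumes [measurable]: "f \<in> borel_measurable borel"
  shows "(\<integral>x. f (x + c) \<partial>lborel) = (\<integral>x. f x \<partial>lborel)"
    and "integrable lborel f \<Longrightarrow> integrable lborel (\<lambda>x. f (x + c))"
proof -
  have *: "distr lborel borel (\<lambda>x. x + c) = lborel"
    
  proof -
    have "(\<lambda>x. x + c) = (+) c" by (auto simp: add.commute)
    then show ?thesis using lborel_distr_plus[of c] by simp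
  qed
  show "(\<integral>x. f (x + c) \<partial>lborel) = (\<integral>x. f x \<partial>lborel)"
    by (subst (2) *[symmetric], subst integral_distr) auto
  show "integrable lborel f \<Longrightarrow> integrable lborel (\<lambda>x. f (x + c))"
    by (subst (asm) *[symmetric], subst (asm) integrable_distr_eq) auto
qed

text \<open>Lebesgue measure is translation invariant, so the integral of the translated integrand
  \<open>F t\<close> does not depend on t. Differentiating under the integral at t = 0 shows that
  the integral of \<open>G\<close> vanishes, and this is the claim.\<close>

lemma gaussian_integration_by_parts:
  fixes f f' :: "real ^ 'n \<Rightarrow> real" and u :: "real ^ 'n"
  assumes f[measurable]: "f \<in> borel_measurable borel" and f'[measurable]: "f' \<in> borel_measurable borel"
    and d: "\<And>x. ((\<lambda>t. f (x + t *\<^sub>R u)) has_real_derivative f' x) (at 0)"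
    and b: "\<And>x. \<bar>f x\<bar> \<le> C * exp (K * norm x)" and b': "\<And>x. \<bar>f' x\<bar> \<le> C * exp (K * norm x)"
    and K: "0 \<le> K"
  shows "integrable std_gaussian f'" "integrable std_gaussian (\<lambda>x. (u \<bullet> x) * f x)"
    and "(\<integral>x. (u \<bullet> x) * f x \<partial>std_gaussian) = (\<integral>x. f' x \<partial>std_gaussian)"
proof -
  have C: "0 \<le> C" using order_trans[OF abs_ge_zero b[of 0]] by simp
  have bu: "\<bar>(u \<bullet> x) * f x\<bar> \<le> C * exp ((K + norm u) * norm x)" for x
  proof -
    have "\<bar>u \<bullet> x\<bar> \<le> norm u * norm x" by (rule Cauchy_Schwarz_ineq2)
    also have "\<dots> \<le> exp (norm u * norm x)" using exp_ge_add_one_self[of "norm u * norm x"] by linarith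
    finally have "\<bar>(u \<bullet> x) * f x\<bar> \<le> exp (norm u * norm x) * (C * exp (K * norm x))"
      unfolding abs_mult using b[of x] by (intro mult_mono) auto
    also have "\<dots> = C * exp ((K + norm u) * norm x)" by (simp add: exp_add algebra_simps)
    finally show ?thesis .
  qed
  show i': "integrable std_gaussian f'" by (rule integrable_std_gaussian_exp_bound[OF f' b'])
  show iu: "integrable std_gaussian (\<lambda>x. (u \<bullet> x) * f x)" by (rule integrable_std_gaussian_exp_bound[OF _ bu]) measurable
  have i: "integrable std_gaussian f" by (rule integrable_std_gaussian_exp_bound[OF f b])
  define F where "F t x = gauss_dens (x + t *\<^sub>R u) * f (x + t *\<^sub>R u)" for t and x :: "real ^ 'n"
  define G where "G x = gauss_dens x * (f' x - (u \<bullet> x) * f x)" for x :: "real ^ 'n"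
  have G[measurable]: "G \<in> borel_measurable borel" unfolding G_def[abs_def] by measurable
  have iF: "integrable lborel (F t)" for t
    using integral_lborel_translate(2)[of "\<lambda>x. gauss_dens x * f x" "t *\<^sub>R u"] i
    by (simp add: F_def[abs_def] integrable_std_gaussian_iff)
  have IF: "(\<integral>x. F t x \<partial>lborel) = (\<integral>x. F 0 x \<partial>lborel)" for t
    using integral_lborel_translate(1)[of "\<lambda>x. gauss_dens x * f x" "t *\<^sub>R u"] by (simp add: F_def)
  let ?K = "K + norm u"
  define h where "h x = gauss_dens x * (2 * C * exp (?K * norm u) * exp ((?K + norm u) * norm x))" for x :: "real ^ 'n"
  have "((\<lambda>t. \<integral>x. F t x \<partial>lborel) has_real_derivative (\<integral>x. G (x + 0 *\<^sub>R u) \<partial>lborel)) (at 0)"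
  proof (rule has_real_derivative_integral[where a = "-1" and b = 1 and h = h and F' = "\<lambda>t x. G (x + t *\<^sub>R u)"])
    fix t x assume t: "t \<in> {-1<..<1::real}"
    define y where "y = x + t *\<^sub>R u"
    have "((\<lambda>s. gauss_dens (y + s *\<^sub>R u)) has_real_derivative gauss_dens y * (- (u \<bullet> y))) (at 0)"
    proof -
      have eq: "(norm (y + s *\<^sub>R u))\<^sup>2 = (norm y)\<^sup>2 + 2 * s * (u \<bullet> y) + s\<^sup>2 * (norm u)\<^sup>2" for s
        by (simp add: power2_norm_add_scaleR inner_commute)
      show ?thesis unfolding gauss_dens_def eq
        by (auto intro!: derivative_eq_intros)
    qed
    from DERIV_mult[OF this d[of y]]
    have "((\<lambda>s. gauss_dens (y + s *\<^sub>R u) * f (y + s *\<^sub>R u)) has_real_derivative G y) (at 0)"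
      by (simp add: G_def algebra_simps)
    moreover have "(\<lambda>s. gauss_dens (y + s *\<^sub>R u) * f (y + s *\<^sub>R u)) = (\<lambda>s. F (s + t) x)"
      by (simp add: F_def y_def algebra_simps)
    ultimately show "((\<lambda>t. F t x) has_real_derivative G (x + t *\<^sub>R u)) (at t)"
      using DERIV_shift[of "\<lambda>t. F t x" "G y" 0 t] by (simp add: y_def)
    have ny: "norm y \<le> norm x + norm u"
    proof -
      have "\<bar>t\<bar> * norm u \<le> 1 * norm u" using t by (intro mult_right_mono) auto
      then show ?thesis using norm_triangle_ineq[of x "t *\<^sub>R u"] by (simp add: y_def)
    qed
    have "\<bar>f' y - (u \<bullet> y) * f y\<bar> \<le> 2 * C * exp (?K * norm y)"
    proof -
      have "C * exp (K * norm y) \<le> C * exp (?K * norm y)"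
        using C by (intro mult_left_mono) (auto simp: mult_right_mono)
      then show ?thesis using b'[of y] bu[of y] by linarith
    qed
    also have "\<dots> \<le> 2 * C * exp (?K * (norm x + norm u))"
      using C K ny by (intro mult_left_mono) (auto intro!: mult_left_mono)
    finally have 1: "\<bar>f' y - (u \<bullet> y) * f y\<bar> \<le> 2 * C * exp (?K * (norm x + norm u))" .
    have "\<bar>G y\<bar> = gauss_dens y * \<bar>f' y - (u \<bullet> y) * f y\<bar>"
      using gauss_dens_pos[of y] by (simp add: G_def abs_mult)
    also have "\<dots> \<le> (gauss_dens x * exp (norm u * norm x)) * (2 * C * exp (?K * (norm x + norm u)))"
      using t 1 gauss_dens_pos[of x] by (intro mult_mono) (auto simp: y_def intro!: gauss_dens_shift_le)
    also have "\<dots> = h x" by (simp add: h_def exp_add[symmetric] algebra_simps)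
    finally show "\<bar>G (x + t *\<^sub>R u)\<bar> \<le> h x" by (simp add: y_def)
  next
    have "integrable std_gaussian (\<lambda>x::real ^ 'n. 2 * C * exp (?K * norm u) * exp ((?K + norm u) * norm x))"
      by (rule integrable_std_gaussian_exp_bound[where C = "2 * C * exp (?K * norm u)" and K = "?K + norm u"])
        (use C in auto)
    then show "integrable lborel h" unfolding h_def[abs_def] by (subst (asm) integrable_std_gaussian_iff) auto
  qed (use iF in auto)
  moreover have "((\<lambda>t. \<integral>x. F t x \<partial>lborel) has_real_derivative 0) (at 0)"
  proof -
    have "(\<lambda>t. \<integral>x. F t x \<partial>lborel) = (\<lambda>t. \<integral>x. F 0 x \<partial>lborel)" by (intro ext IF)
    then show ?thesis by simp
  qed
  ultimately have "(\<integral>x. G x \<partial>lborel) = 0" by (auto dest: DERIV_unique)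
  also have "(\<integral>x. G x \<partial>lborel) = (\<integral>x. f' x - (u \<bullet> x) * f x \<partial>std_gaussian)"
    by (subst integral_std_gaussian) (auto simp: G_def[abs_def])
  also have "\<dots> = (\<integral>x. f' x \<partial>std_gaussian) - (\<integral>x. (u \<bullet> x) * f x \<partial>std_gaussian)"
    using i' iu by simp
  finally show "(\<integral>x. (u \<bullet> x) * f x \<partial>std_gaussian) = (\<integral>x. f' x \<partial>std_gaussian)" by simp
qed

text \<open>Interpolation from s = 0, where \<open>N s g\<close> is the constant on the right, to s
  = \<sigma>, where it is the integrand on the left. By \<open>adj\<close>, moving g along
  \<open>adjoint T j\<close> moves T g along j, so integration by parts turns the average of N^(q-1)
  X.Tg into s times the average of dim N^(q-1) + 2 (q-1) N^(q-2) |X|^2. As |X|^2 \<le> N, this is at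
  most s D times the average of N^(q-1) with D = dim + 2 (q-1), and the term (\<sigma>^2 - s^2) D in
  N compensates it. So the average of N^q decreases in s. The positivity of c keeps N away from 0,
  where the exponent q - 2 may be negative.\<close>

lemma gaussian_powr_mean_le_pos:
  fixes T :: "real ^ 'n \<Rightarrow> 'e::euclidean_space"
  assumes lin: "linear T" and adj: "\<And>y. T (adjoint T y) = y"
    and q: "1 \<le> q" and c: "0 < c" and \<sigma>: "0 < \<sigma>"
  defines "D \<equiv> real DIM('e) + 2 * q - 2"
  shows "(\<integral>g. (c + (norm (a + \<sigma> *\<^sub>R T g))\<^sup>2) powr q \<partial>std_gaussian) \<le> (c + (norm a)\<^sup>2 + \<sigma>\<^sup>2 * D) powr q"
    and "integrable std_gaussian (\<lambda>g. (c + (norm (a + \<sigma> *\<^sub>R T g))\<^sup>2) powr q)"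
proof -
  note [measurable] = borel_measurable_continuous_onI[OF linear_continuous_on[OF linear_conv_bounded_linear[THEN iffD1, OF lin]]]
  have "1 \<le> DIM('e)" by (simp add: Suc_leI)
  then have "1 \<le> real DIM('e)" by linarith
  then have D: "1 \<le> D" using q unfolding D_def by linarith
  obtain K where K: "0 < K" "\<And>g. norm (T g) \<le> norm g * K"
    using bounded_linear.pos_bounded[OF linear_conv_bounded_linear[THEN iffD1, OF lin]] by blast
  \<comment> \<open>The derivative is taken on an open interval around [0, \<sigma>], where s may
    exceed \<sigma>; with this margin the constant part of N stays above c / 2.\<close>
  define e where "e = min 1 (c / (2 * ((2 * \<sigma> + 1) * D)))"
  have P: "0 < (2 * \<sigma> + 1) * D" using \<sigma> D by simp
  have e: "0 < e" "e \<le> 1" using c P by (simp_all add: e_def)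
  have "(2 * \<sigma> + 1) * D * e \<le> (2 * \<sigma> + 1) * D * (c / (2 * ((2 * \<sigma> + 1) * D)))"
    using P by (intro mult_left_mono) (auto simp: e_def)
  also have "\<dots> = c / 2"
  proof -
    have "p * (c / (2 * p)) = c / 2" if "0 < p" for p :: real using that by simp
    from this[OF P] show ?thesis .
  qed
  finally have e2: "(2 * \<sigma> + 1) * D * e \<le> c / 2" .
  define I where "I = {-e<..<\<sigma> + e}"
  define X where "X s g = a + s *\<^sub>R T g" for s g
  define N where "N s g = c + (\<sigma>\<^sup>2 - s\<^sup>2) * D + (norm (X s g))\<^sup>2" for s g
  have cpos: "c / 2 \<le> c + (\<sigma>\<^sup>2 - s\<^sup>2) * D" if "s \<in> I" for s
  proof -
    have "\<bar>s\<bar> \<le> \<sigma> + e" using that \<sigma> by (auto simp: I_def)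
    then have "s\<^sup>2 \<le> (\<sigma> + e)\<^sup>2" by (metis abs_ge_zero power2_abs power_mono)
    also have "(\<sigma> + e)\<^sup>2 = \<sigma>\<^sup>2 + (2 * \<sigma> + e) * e" by (simp add: power2_eq_square algebra_simps)
    also have "\<dots> \<le> \<sigma>\<^sup>2 + (2 * \<sigma> + 1) * e" using e by (simp add: mult_right_mono)
    finally have "s\<^sup>2 * D \<le> (\<sigma>\<^sup>2 + (2 * \<sigma> + 1) * e) * D" using D by (intro mult_right_mono) auto
    then show ?thesis using e2 by (simp add: algebra_simps)
  qed
  have Npos: "0 < N s g" if "s \<in> I" for s g
    using cpos[OF that] c zero_le_power2[of "norm (X s g)"] unfolding N_def by linarith
  \<comment> \<open>One constant for all growth bounds: |T g| and |X| are at most B exp |g|, and N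
    is at most 2 B^2 exp (2 |g|).\<close>
  define B where "B = 1 + c + \<sigma>\<^sup>2 * D + norm a + (\<sigma> + 2) * K"
  have B_ge: "1 \<le> B" "norm a \<le> B" "(\<sigma> + 2) * K \<le> B" "c + \<sigma>\<^sup>2 * D \<le> B"
  proof -
    have "0 \<le> \<sigma>\<^sup>2 * D" "0 \<le> norm a" "0 \<le> (\<sigma> + 2) * K" using D K \<sigma> by simp_all
    then show "1 \<le> B" "norm a \<le> B" "(\<sigma> + 2) * K \<le> B" "c + \<sigma>\<^sup>2 * D \<le> B"
      using c unfolding B_def by linarith+
  qed
  note B1 = B_ge(1)
  have Tb: "norm (T g) \<le> B * exp (norm g)" for g
  proof -
    have "norm (T g) \<le> norm g * K" by (rule K)
    also have "\<dots> \<le> exp (norm g) * B"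
    proof (intro mult_mono)
      show "norm g \<le> exp (norm g)" using exp_ge_add_one_self[of "norm g"] by linarith
      have "1 * K \<le> (\<sigma> + 2) * K" using \<sigma> K by (intro mult_right_mono) auto
      then show "K \<le> B" using B_ge by linarith
    qed (use K in auto)
    finally show ?thesis by (simp add: mult.commute)
  qed
  have Xb: "norm (X s g) \<le> B * exp (norm g)" if "s \<in> I" for s g
  proof -
    have s: "\<bar>s\<bar> \<le> \<sigma> + 1" using that e \<sigma> by (auto simp: I_def)
    have "norm (X s g) \<le> norm a + \<bar>s\<bar> * norm (T g)" unfolding X_def
      using norm_triangle_ineq[of a "s *\<^sub>R T g"] by simp
    also have "\<bar>s\<bar> * norm (T g) \<le> (\<sigma> + 1) * (norm g * K)" using s \<sigma> K by (intro mult_mono) auto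
    also have "\<dots> = ((\<sigma> + 1) * K) * norm g" by simp
    also have "\<dots> \<le> ((\<sigma> + 2) * K) * norm g" using K by (intro mult_right_mono) auto
    finally have "norm (X s g) \<le> norm a * 1 + ((\<sigma> + 2) * K) * norm g" by simp
    also have "\<dots> \<le> B * 1 + B * norm g"
      using B_ge by (intro add_mono mult_right_mono) auto
    also have "\<dots> \<le> B * exp (norm g)"
      using B1 exp_ge_add_one_self[of "norm g"] mult_left_mono[of "1 + norm g" "exp (norm g)" B] by (simp add: distrib_left)
    finally show ?thesis .
  qed
  have Nb: "N s g \<le> 2 * B\<^sup>2 * exp (2 * norm g)" if "s \<in> I" for s g
  proof -
    have "(norm (X s g))\<^sup>2 \<le> (B * exp (norm g))\<^sup>2" using Xb[OF that] by (intro power_mono) auto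
    also have "\<dots> = B\<^sup>2 * exp (2 * norm g)" by (simp add: power_mult_distrib exp_double[symmetric])
    finally have 1: "(norm (X s g))\<^sup>2 \<le> B\<^sup>2 * exp (2 * norm g)" .
    have "c + (\<sigma>\<^sup>2 - s\<^sup>2) * D \<le> c + \<sigma>\<^sup>2 * D" using D by (simp add: algebra_simps)
    also have "\<dots> \<le> B" by (rule B_ge)
    also have "\<dots> \<le> B\<^sup>2 * 1" using B1 by (simp add: power2_eq_square)
    also have "\<dots> \<le> B\<^sup>2 * exp (2 * norm g)" by (intro mult_left_mono) auto
    finally show ?thesis using 1 by (simp add: N_def)
  qed
  have Npb: "N s g powr r \<le> (2 * B\<^sup>2) powr r * exp ((2 * r) * norm g)" if "s \<in> I" "0 \<le> r" for s g r
  proof -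
    have "N s g powr r \<le> (2 * B\<^sup>2 * exp (2 * norm g)) powr r"
      using Nb[OF that(1)] Npos[OF that(1), of g] that(2) by (intro powr_mono2) auto
    also have "\<dots> = (2 * B\<^sup>2) powr r * exp ((2 * r) * norm g)"
      by (simp add: powr_mult exp_powr_real algebra_simps)
    finally show ?thesis .
  qed
  have NX: "(norm (X s g))\<^sup>2 \<le> N s g" if "s \<in> I" for s g
    using cpos[OF that] c by (simp add: N_def)
  have NX1: "N s g powr (q - 2) * (norm (X s g))\<^sup>2 \<le> N s g powr (q - 1)" if "s \<in> I" for s g
  proof -
    have "N s g powr (q - 2) * (norm (X s g))\<^sup>2 \<le> N s g powr (q - 2) * N s g powr 1"
      using NX[OF that, of g] Npos[OF that, of g] by (intro mult_left_mono) auto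
    also have "\<dots> = N s g powr (q - 1)" unfolding powr_add[symmetric] by simp
    finally show ?thesis .
  qed
  have N_meas[measurable]: "N s \<in> borel_measurable borel" "X s \<in> borel_measurable borel" for s
    unfolding N_def[abs_def] X_def[abs_def] by measurable
  have intN: "integrable std_gaussian (\<lambda>g. N s g powr q)" if "s \<in> I" for s
    by (rule integrable_std_gaussian_exp_bound[where C = "(2 * B\<^sup>2) powr q" and K = "2 * q"])
      (use Npb[OF that, of q] q in auto)
  define N' where "N' s g = q * N s g powr (q - 1) * (2 * (X s g \<bullet> T g) - 2 * s * D)" for s g
  have der: "((\<lambda>s. N s g powr q) has_real_derivative N' s g) (at s)" if s: "s \<in> I" for s g
  proof -
    have "((\<lambda>s. N s g) has_real_derivative (2 * (X s g \<bullet> T g) - 2 * s * D)) (at s)"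
      unfolding N_def X_def power2_norm_add_scaleR
      by (auto intro!: derivative_eq_intros simp: inner_simps power2_norm_eq_inner algebra_simps)
    from DERIV_chain2[OF has_real_derivative_powr[OF Npos[OF s]] this] show ?thesis
      by (simp add: N'_def)
  qed
  define C' where "C' = q * (2 * B\<^sup>2) powr (q - 1) * (2 * B\<^sup>2 + 2 * (\<sigma> + 1) * D)"
  have N'b: "\<bar>N' s g\<bar> \<le> C' * exp (2 * q * norm g)" if s: "s \<in> I" for s g
  proof -
    have s': "\<bar>s\<bar> \<le> \<sigma> + 1" using s e \<sigma> by (auto simp: I_def)
    have "\<bar>X s g \<bullet> T g\<bar> \<le> norm (X s g) * norm (T g)" by (rule Cauchy_Schwarz_ineq2)
    also have "\<dots> \<le> (B * exp (norm g)) * (B * exp (norm g))" using Xb[OF s] Tb B1 by (intro mult_mono) auto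
    also have "\<dots> = B\<^sup>2 * exp (2 * norm g)" by (simp add: power2_eq_square exp_add[symmetric])
    finally have 1: "\<bar>X s g \<bullet> T g\<bar> \<le> B\<^sup>2 * exp (2 * norm g)" .
    have "\<bar>s * D\<bar> \<le> (\<sigma> + 1) * D * 1" using s' D by (simp add: abs_mult mult_right_mono)
    also have "\<dots> \<le> (\<sigma> + 1) * D * exp (2 * norm g)" using D \<sigma> by (intro mult_left_mono) auto
    finally have "\<bar>2 * (X s g \<bullet> T g) - 2 * s * D\<bar> \<le> (2 * B\<^sup>2 + 2 * (\<sigma> + 1) * D) * exp (2 * norm g)"
      using 1 by (simp add: algebra_simps abs_le_iff)
    then have "\<bar>N' s g\<bar> \<le> q * ((2 * B\<^sup>2) powr (q - 1) * exp (2 * (q - 1) * norm g)) * ((2 * B\<^sup>2 + 2 * (\<sigma> + 1) * D) * exp (2 * norm g))"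
      unfolding N'_def abs_mult using q Npb[OF s, of "q - 1" g] by (intro mult_mono) auto
    also have "\<dots> = C' * (exp (2 * (q - 1) * norm g) * exp (2 * norm g))" by (simp add: C'_def)
    also have "exp (2 * (q - 1) * norm g) * exp (2 * norm g) = exp (2 * q * norm g)"
      unfolding exp_add[symmetric] by (simp add: algebra_simps)
    finally show ?thesis .
  qed
  have N'_meas[measurable]: "N' s \<in> borel_measurable borel" for s
    unfolding N'_def[abs_def] by measurable
  define h where "h g = C' * exp (2 * q * norm g)" for g :: "real ^ 'n"
  have h: "integrable std_gaussian h"
  proof (rule integrable_std_gaussian_exp_bound[where C = C' and K = "2 * q"])
    have "0 \<le> C'" using q D \<sigma> by (auto simp: C'_def)
    then show "\<bar>h x\<bar> \<le> C' * exp (2 * q * norm x)" for x by (simp add: h_def)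
  qed (unfold h_def[abs_def], measurable)
  have Der: "((\<lambda>s. \<integral>g. N s g powr q \<partial>std_gaussian) has_real_derivative (\<integral>g. N' s g \<partial>std_gaussian)) (at s)"
    if s: "s \<in> I" for s
    by (rule has_real_derivative_integral[where a = "-e" and b = "\<sigma> + e" and h = h])
      (use s intN der N'b h in \<open>auto simp: I_def h_def\<close>)
  have neg: "(\<integral>g. N' s g \<partial>std_gaussian) \<le> 0" if s0: "0 \<le> s" "s \<le> \<sigma>" for s
  proof -
    have s: "s \<in> I" using s0 e by (auto simp: I_def)
    define f where "f j g = (X s g \<bullet> j) * N s g powr (q - 1)" for j g
    define f' where "f' j g = s * N s g powr (q - 1) + 2 * s * (q - 1) * (X s g \<bullet> j)\<^sup>2 * N s g powr (q - 2)" for j g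
    define C where "C = (B + s + 2 * s * (q - 1)) * (2 * B\<^sup>2) powr (q - 1)"
    have sq: "0 \<le> 2 * s * (q - 1)" using s0 q by simp
    have C0: "0 \<le> C" unfolding C_def using sq s0 B1 by (intro mult_nonneg_nonneg) auto
    have N1b: "N s g powr (q - 1) \<le> (2 * B\<^sup>2) powr (q - 1) * exp (2 * (q - 1) * norm g)" for g
      using Npb[OF s, of "q - 1" g] q by simp
    have ibp: "integrable std_gaussian (f' j)" "integrable std_gaussian (\<lambda>g. (adjoint T j \<bullet> g) * f j g)"
      "(\<integral>g. (adjoint T j \<bullet> g) * f j g \<partial>std_gaussian) = (\<integral>g. f' j g \<partial>std_gaussian)"
      if j: "j \<in> Basis" for j
    proof -
      have jj: "j \<bullet> j = 1" using j by (simp add: inner_same_Basis)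
      have Xj: "\<bar>X s g \<bullet> j\<bar> \<le> norm (X s g)" for g using Basis_le_norm[OF j] by simp
      have f_b: "\<bar>f j g\<bar> \<le> C * exp ((2 * q) * norm g)" for g
      proof -
        have "\<bar>f j g\<bar> \<le> (B * exp (norm g)) * ((2 * B\<^sup>2) powr (q - 1) * exp (2 * (q - 1) * norm g))"
          unfolding f_def abs_mult using Xj[of g] Xb[OF s, of g] N1b[of g] by (intro mult_mono) auto
        also have "\<dots> = B * (2 * B\<^sup>2) powr (q - 1) * exp (norm g + 2 * (q - 1) * norm g)"
          by (simp add: exp_add)
        also have "\<dots> \<le> C * exp ((2 * q) * norm g)"
        proof (rule mult_mono)
          show "B * (2 * B\<^sup>2) powr (q - 1) \<le> C" unfolding C_def using sq s0 by (intro mult_right_mono) auto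
          show "exp (norm g + 2 * (q - 1) * norm g) \<le> exp (2 * q * norm g)" by (simp add: algebra_simps)
        qed (use C0 in auto)
        finally show ?thesis .
      qed
      have f'_b: "\<bar>f' j g\<bar> \<le> C * exp ((2 * q) * norm g)" for g
      proof -
        have "(X s g \<bullet> j)\<^sup>2 \<le> (norm (X s g))\<^sup>2" using Xj[of g] by (metis abs_ge_zero power2_abs power_mono)
        then have "N s g powr (q - 2) * (X s g \<bullet> j)\<^sup>2 \<le> N s g powr (q - 2) * (norm (X s g))\<^sup>2"
          by (intro mult_left_mono) auto
        with NX1[OF s, of g] have "N s g powr (q - 2) * (X s g \<bullet> j)\<^sup>2 \<le> N s g powr (q - 1)" by linarith
        then have "2 * s * (q - 1) * (N s g powr (q - 2) * (X s g \<bullet> j)\<^sup>2) \<le> 2 * s * (q - 1) * N s g powr (q - 1)"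
          using s0 q by (intro mult_left_mono) auto
        moreover have "0 \<le> f' j g" unfolding f'_def using s0 q by (intro add_nonneg_nonneg mult_nonneg_nonneg) auto
        ultimately have "\<bar>f' j g\<bar> \<le> (s + 2 * s * (q - 1)) * N s g powr (q - 1)"
          by (simp add: f'_def algebra_simps)
        also have "\<dots> \<le> (B + s + 2 * s * (q - 1)) * ((2 * B\<^sup>2) powr (q - 1) * exp (2 * (q - 1) * norm g))"
          using N1b[of g] s0 sq B1 by (intro mult_mono) auto
        also have "\<dots> = C * exp (2 * (q - 1) * norm g)" by (simp add: C_def)
        also have "\<dots> \<le> C * exp ((2 * q) * norm g)"
          using C0 by (intro mult_left_mono) (auto simp: algebra_simps)
        finally show ?thesis .
      qed
      have dd: "((\<lambda>t. f j (x + t *\<^sub>R adjoint T j)) has_real_derivative f' j x) (at 0)" for x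
      proof -
        have Xt: "X s (x + t *\<^sub>R adjoint T j) = X s x + (s * t) *\<^sub>R j" for t
          by (simp add: X_def linear_add[OF lin] linear_scale[OF lin] adj scaleR_add_right)
        have Nt: "N s (x + t *\<^sub>R adjoint T j) = N s x + 2 * (s * t) * (X s x \<bullet> j) + (s * t)\<^sup>2" for t
          using norm_Basis[OF j] by (simp add: N_def Xt power2_norm_add_scaleR)
        have "((\<lambda>t. N s x + 2 * (s * t) * (X s x \<bullet> j) + (s * t)\<^sup>2) has_real_derivative 2 * s * (X s x \<bullet> j)) (at 0)"
          by (auto intro!: derivative_eq_intros)
        then have "((\<lambda>t. (N s x + 2 * (s * t) * (X s x \<bullet> j) + (s * t)\<^sup>2) powr (q - 1)) has_real_derivative
            (q - 1) * N s x powr (q - 1 - 1) * (2 * s * (X s x \<bullet> j))) (at 0)"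
          by (intro DERIV_chain2[OF has_real_derivative_powr, THEN DERIV_cong]) (use Npos[OF s, of x] in auto)
        moreover have "((\<lambda>t. X s x \<bullet> j + s * t) has_real_derivative s) (at 0)"
          by (auto intro!: derivative_eq_intros)
        ultimately have "((\<lambda>t. (X s x \<bullet> j + s * t) * (N s x + 2 * (s * t) * (X s x \<bullet> j) + (s * t)\<^sup>2) powr (q - 1)) has_real_derivative
            s * (N s x) powr (q - 1) + (X s x \<bullet> j) * ((q - 1) * N s x powr (q - 1 - 1) * (2 * s * (X s x \<bullet> j)))) (at 0)"
          by (intro DERIV_mult[THEN DERIV_cong]) auto
        moreover have "(\<lambda>t. f j (x + t *\<^sub>R adjoint T j)) = (\<lambda>t. (X s x \<bullet> j + s * t) * (N s x + 2 * (s * t) * (X s x \<bullet> j) + (s * t)\<^sup>2) powr (q - 1))"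
          using jj by (simp add: f_def Nt Xt inner_add_left)
        moreover have "s * (N s x) powr (q - 1) + (X s x \<bullet> j) * ((q - 1) * N s x powr (q - 1 - 1) * (2 * s * (X s x \<bullet> j))) = f' j x"
          by (simp add: f'_def power2_eq_square)
        ultimately show ?thesis by simp
      qed
      note * = gaussian_integration_by_parts[where f = "f j" and f' = "f' j" and u = "adjoint T j" and C = C and K = "2 * q"]
      show "integrable std_gaussian (f' j)" "integrable std_gaussian (\<lambda>g. (adjoint T j \<bullet> g) * f j g)"
        "(\<integral>g. (adjoint T j \<bullet> g) * f j g \<partial>std_gaussian) = (\<integral>g. f' j g \<partial>std_gaussian)"
        by (rule *; (fact dd f_b f'_b)?; (use q in \<open>simp add: f_def[abs_def] f'_def[abs_def]\<close>)?)+
    qed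
    have intN1: "integrable std_gaussian (\<lambda>g. N s g powr (q - 1))"
      by (rule integrable_std_gaussian_exp_bound[where C = "(2 * B\<^sup>2) powr (q - 1)" and K = "2 * (q - 1)"])
        (use N1b in auto)
    have sumf: "N s g powr (q - 1) * (X s g \<bullet> T g) = (\<Sum>j\<in>Basis. (adjoint T j \<bullet> g) * f j g)" for g
    proof -
      have "X s g \<bullet> T g = (\<Sum>j\<in>Basis. (X s g \<bullet> j) * (T g \<bullet> j))" by (rule euclidean_inner)
      also have "\<dots> = (\<Sum>j\<in>Basis. (X s g \<bullet> j) * (adjoint T j \<bullet> g))"
        using adjoint_works[OF lin] by (simp add: inner_commute)
      finally show ?thesis by (simp add: f_def sum_distrib_left ac_simps)
    qed
    \<comment> \<open>Summing over the basis produces dim from the first term and, by |X|^2 \<le> N,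
      2 (q - 1) from the second; together they are \<open>D\<close>.\<close>
    have sumf': "(\<Sum>j\<in>Basis. f' j g) \<le> s * D * N s g powr (q - 1)" for g
    proof -
      have "(norm (X s g))\<^sup>2 = (\<Sum>j\<in>Basis. (X s g \<bullet> j)\<^sup>2)"
        unfolding power2_norm_eq_inner by (simp add: euclidean_inner[of "X s g" "X s g"] power2_eq_square)
      then have "(\<Sum>j\<in>Basis. f' j g) = real DIM('e) * (s * N s g powr (q - 1)) + 2 * s * (q - 1) * (N s g powr (q - 2) * (norm (X s g))\<^sup>2)"
        by (simp add: f'_def sum.distrib sum_distrib_left sum_distrib_right ac_simps)
      also have "2 * s * (q - 1) * (N s g powr (q - 2) * (norm (X s g))\<^sup>2) \<le> 2 * s * (q - 1) * N s g powr (q - 1)"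
        using NX1[OF s, of g] s0 q by (intro mult_left_mono) auto
      finally show ?thesis by (simp add: D_def algebra_simps)
    qed
    have "(\<integral>g. N s g powr (q - 1) * (X s g \<bullet> T g) \<partial>std_gaussian) = (\<Sum>j\<in>Basis. \<integral>g. f' j g \<partial>std_gaussian)"
      unfolding sumf by (subst Bochner_Integration.integral_sum) (auto simp: ibp)
    also have "\<dots> = (\<integral>g. (\<Sum>j\<in>Basis. f' j g) \<partial>std_gaussian)"
      by (subst Bochner_Integration.integral_sum) (auto simp: ibp)
    also have "\<dots> \<le> (\<integral>g. s * D * N s g powr (q - 1) \<partial>std_gaussian)"
      by (intro integral_mono) (auto intro!: Bochner_Integration.integrable_sum ibp intN1 sumf')
    finally have le: "(\<integral>g. N s g powr (q - 1) * (X s g \<bullet> T g) \<partial>std_gaussian) \<le> s * D * (\<integral>g. N s g powr (q - 1) \<partial>std_gaussian)"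
      by simp
    have "integrable std_gaussian (\<lambda>g. N s g powr (q - 1) * (X s g \<bullet> T g))"
      unfolding sumf by (auto intro!: Bochner_Integration.integrable_sum ibp)
    then have "(\<integral>g. N' s g \<partial>std_gaussian) = q * (2 * (\<integral>g. N s g powr (q - 1) * (X s g \<bullet> T g) \<partial>std_gaussian)
        - 2 * (s * D * (\<integral>g. N s g powr (q - 1) \<partial>std_gaussian)))"
      using intN1 unfolding N'_def
      by (subst integral_mult_right_zero[symmetric] integral_diff[symmetric]; simp add: algebra_simps)+
    also have "\<dots> \<le> 0" using le q by (simp add: mult_nonneg_nonpos)
    finally show ?thesis .
  qed
  have "(\<integral>g. N \<sigma> g powr q \<partial>std_gaussian) \<le> (\<integral>g. N 0 g powr q \<partial>std_gaussian)"
  proof (rule DERIV_nonpos_imp_nonincreasing[where f = "\<lambda>s. \<integral>g. N s g powr q \<partial>std_gaussian"])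
    fix s assume s: "0 \<le> s" "s \<le> \<sigma>"
    then have "s \<in> I" using e by (auto simp: I_def)
    from Der[OF this] neg[OF s]
    show "\<exists>y. ((\<lambda>s. \<integral>g. N s g powr q \<partial>std_gaussian) has_real_derivative y) (at s) \<and> y \<le> 0" by blast
  qed (use \<sigma> in simp)
  moreover have "N \<sigma> = (\<lambda>g. c + (norm (a + \<sigma> *\<^sub>R T g))\<^sup>2)" by (simp add: N_def X_def fun_eq_iff)
  moreover have "N 0 = (\<lambda>g. c + (norm a)\<^sup>2 + \<sigma>\<^sup>2 * D)" by (simp add: N_def X_def fun_eq_iff)
  moreover have "\<sigma> \<in> I" using \<sigma> e by (simp add: I_def)
  ultimately show "(\<integral>g. (c + (norm (a + \<sigma> *\<^sub>R T g))\<^sup>2) powr q \<partial>std_gaussian) \<le> (c + (norm a)\<^sup>2 + \<sigma>\<^sup>2 * D) powr q"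
    and "integrable std_gaussian (\<lambda>g. (c + (norm (a + \<sigma> *\<^sub>R T g))\<^sup>2) powr q)"
    using intN[of \<sigma>] prob_space.prob_space[OF prob_space_std_gaussian[where 'n='n]] by simp_all
qed

text \<open>The case c = 0 is a limit: the left side increases with c, the constants c + 1/(n+1) are
  positive, and the right side is continuous in c.\<close>

lemma gaussian_powr_mean_le:
  fixes T :: "real ^ 'n \<Rightarrow> 'e::euclidean_space"
  assumes lin: "linear T" and adj: "\<And>y. T (adjoint T y) = y"
    and q: "1 \<le> q" and c: "0 \<le> c" and \<sigma>: "0 < \<sigma>"
  shows "(\<integral>\<^sup>+g. ennreal ((c + (norm (a + \<sigma> *\<^sub>R T g))\<^sup>2) powr q) \<partial>std_gaussian)
      \<le> ennreal ((c + (norm a)\<^sup>2 + \<sigma>\<^sup>2 * (real DIM('e) + 2 * q - 2)) powr q)"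
proof -
  let ?r = "\<lambda>c. (c + (norm a)\<^sup>2 + \<sigma>\<^sup>2 * (real DIM('e) + 2 * q - 2)) powr q"
  define I where "I = (\<integral>\<^sup>+g. ennreal ((c + (norm (a + \<sigma> *\<^sub>R T g))\<^sup>2) powr q) \<partial>std_gaussian)"
  have le: "I \<le> ennreal (?r (c + e))" if e: "0 < e" for e
  proof -
    have "I \<le> (\<integral>\<^sup>+g. ennreal ((c + e + (norm (a + \<sigma> *\<^sub>R T g))\<^sup>2) powr q) \<partial>std_gaussian)"
      unfolding I_def using c e q by (intro nn_integral_mono ennreal_leI powr_mono2) auto
    also have "\<dots> = ennreal (\<integral>g. (c + e + (norm (a + \<sigma> *\<^sub>R T g))\<^sup>2) powr q \<partial>std_gaussian)"
      using c e by (intro nn_integral_eq_integral gaussian_powr_mean_le_pos(2)[OF lin adj q _ \<sigma>]) auto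
    also have "\<dots> \<le> ennreal (?r (c + e))"
      using c e by (intro ennreal_leI gaussian_powr_mean_le_pos(1)[OF lin adj q _ \<sigma>]) auto
    finally show ?thesis .
  qed
  have "(\<lambda>n. c + inverse (real (Suc n)) + (norm a)\<^sup>2 + \<sigma>\<^sup>2 * (real DIM('e) + 2 * q - 2))
      \<longlonglongrightarrow> c + 0 + (norm a)\<^sup>2 + \<sigma>\<^sup>2 * (real DIM('e) + 2 * q - 2)"
    by (intro tendsto_add tendsto_const LIMSEQ_inverse_real_of_nat)
  moreover have "0 \<le> real DIM('e) + 2 * q - 2" using q by simp
  then have "\<forall>\<^sub>F n in sequentially. 0 \<le> c + inverse (real (Suc n)) + (norm a)\<^sup>2 + \<sigma>\<^sup>2 * (real DIM('e) + 2 * q - 2)"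
    using c by (intro always_eventually allI add_nonneg_nonneg mult_nonneg_nonneg) simp_all
  ultimately have "(\<lambda>n. ennreal (?r (c + inverse (real (Suc n))))) \<longlonglongrightarrow> ennreal (?r (c + 0))"
    using q by (intro tendsto_ennrealI tendsto_powr' tendsto_const) auto
  then have "I \<le> ennreal (?r (c + 0))"
    by (rule LIMSEQ_le_const) (rule exI[of _ 0], intro allI impI le, simp)
  then show ?thesis by (simp add: I_def)
qed

section \<open>The transition kernels\<close>

lemma borel_measurable_fst_borel[measurable (raw)]:
  fixes f :: "'c \<Rightarrow> 'a::second_countable_topology \<times> 'b::second_countable_topology"
  assumes "f \<in> borel_measurable M"
  shows "(\<lambda>x. fst (f x)) \<in> borel_measurable M" "(\<lambda>x. snd (f x)) \<in> borel_measurable M"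
  using assms unfolding borel_prod[symmetric] by measurable

text \<open>The velocity refreshment as an operator on functions. Both kernels factor through it, so
  the Gaussian variables disappear from later statements.\<close>

definition refresh :: "real \<Rightarrow> real \<Rightarrow> ('n phase \<Rightarrow> ennreal) \<Rightarrow> ('n::finite) phase \<Rightarrow> ennreal" where
  "refresh \<gamma> \<delta> f z = (\<integral>\<^sup>+g. f (fst z, eta \<gamma> \<delta> *\<^sub>R snd z + sqrt (1 - (eta \<gamma> \<delta>)\<^sup>2) *\<^sub>R g) \<partial>std_gaussian)"

lemma borel_measurable_refresh[measurable (raw)]:
  fixes f :: "('n::finite) phase \<Rightarrow> ennreal"
  assumes [measurable]: "f \<in> borel_measurable borel"
  shows "refresh \<gamma> \<delta> f \<in> borel_measurable borel"
proof -
  interpret sigma_finite_measure "std_gaussian :: (real ^ 'n) measure"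
    using prob_space_std_gaussian by (intro prob_space_imp_sigma_finite)
  show ?thesis unfolding refresh_def[abs_def] by measurable
qed

lemma refresh_mono: "(\<And>v. f (fst z, v) \<le> g (fst z, v)) \<Longrightarrow> refresh \<gamma> \<delta> f z \<le> refresh \<gamma> \<delta> g z"
  unfolding refresh_def by (intro nn_integral_mono) simp

lemma refresh_const: "refresh \<gamma> \<delta> (\<lambda>_. c) (z :: ('n::finite) phase) = c"
  unfolding refresh_def using prob_space.emeasure_space_1[OF prob_space_std_gaussian[where 'n='n]] by simp

lemma refresh_add:
  assumes [measurable]: "f \<in> borel_measurable borel" "g \<in> borel_measurable borel"
  shows "refresh \<gamma> \<delta> (\<lambda>z. f z + g z) z = refresh \<gamma> \<delta> f z + refresh \<gamma> \<delta> g z"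
  unfolding refresh_def by (intro nn_integral_add) measurable

lemma refresh_cmult:
  assumes [measurable]: "f \<in> borel_measurable borel"
  shows "refresh \<gamma> \<delta> (\<lambda>z. c * f z) z = c * refresh \<gamma> \<delta> f z"
  unfolding refresh_def by (intro nn_integral_cmult) measurable

context
  fixes U :: "real ^ 'n::finite \<Rightarrow> real" and \<gamma> \<delta> :: real
  assumes grad_meas[measurable]: "grad U \<in> borel_measurable borel"
    and U_meas[measurable]: "U \<in> borel_measurable borel"
begin

lemma borel_measurable_verlet[measurable]: "verlet U \<delta> \<in> borel_measurable borel"
  unfolding verlet_def[abs_def] case_prod_beta Let_def by measurable

lemma borel_measurable_accept_prob[measurable]: "accept_prob U \<delta> \<in> borel_measurable borel"
proof -
  have [measurable]: "hamiltonian U \<in> borel_measurable borel"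
    unfolding hamiltonian_def[abs_def] case_prod_beta by measurable
  show ?thesis unfolding accept_prob_def[abs_def] by measurable
qed

lemma accept_prob_bounds: "0 \<le> accept_prob U \<delta> z" "accept_prob U \<delta> z \<le> 1"
  by (simp_all add: accept_prob_def)

text \<open>The explicit update formula is the palindrome refreshment, Verlet, refreshment: the
  Verlet map acts on the velocity after the first refreshment.\<close>

lemma obabo_step_eq:
  "obabo_step U \<gamma> \<delta> z (g, g') = (let (x, v) = verlet U \<delta> (fst z, eta \<gamma> \<delta> *\<^sub>R snd z + sqrt (1 - (eta \<gamma> \<delta>)\<^sup>2) *\<^sub>R g)
     in (x, eta \<gamma> \<delta> *\<^sub>R v + sqrt (1 - (eta \<gamma> \<delta>)\<^sup>2) *\<^sub>R g'))"
  by (simp add: obabo_step_def verlet_def Let_def case_prod_beta algebra_simps power2_eq_square)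

lemma measurable_obabo_step[measurable]:
  "(\<lambda>(z, gg). obabo_step U \<gamma> \<delta> z gg) \<in> borel_measurable (borel \<Otimes>\<^sub>M (std_gaussian \<Otimes>\<^sub>M std_gaussian))"
proof -
  have *: "(\<lambda>(z, gg). obabo_step U \<gamma> \<delta> z gg) = (\<lambda>p. let w = verlet U \<delta> (fst (fst p), eta \<gamma> \<delta> *\<^sub>R snd (fst p) + sqrt (1 - (eta \<gamma> \<delta>)\<^sup>2) *\<^sub>R fst (snd p))
     in (fst w, eta \<gamma> \<delta> *\<^sub>R snd w + sqrt (1 - (eta \<gamma> \<delta>)\<^sup>2) *\<^sub>R snd (snd p)))"
    by (auto simp: fun_eq_iff obabo_step_eq case_prod_beta Let_def)
  show ?thesis unfolding * Let_def by measurable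
qed

lemma measurable_ombabo_step[measurable]:
  "(\<lambda>(z, gg). ombabo_step U \<gamma> \<delta> z gg) \<in> borel_measurable (borel \<Otimes>\<^sub>M (std_gaussian \<Otimes>\<^sub>M (std_gaussian \<Otimes>\<^sub>M uniform_measure lborel {0..1::real})))"
proof -
  have *: "(\<lambda>(z, gg). ombabo_step U \<gamma> \<delta> z gg) = (\<lambda>p. let y = (fst (fst p), eta \<gamma> \<delta> *\<^sub>R snd (fst p) + sqrt (1 - (eta \<gamma> \<delta>)\<^sup>2) *\<^sub>R fst (snd p));
      w = (if snd (snd (snd p)) \<le> accept_prob U \<delta> y then verlet U \<delta> y else (fst y, - snd y))
     in (fst w, eta \<gamma> \<delta> *\<^sub>R snd w + sqrt (1 - (eta \<gamma> \<delta>)\<^sup>2) *\<^sub>R fst (snd (snd p))))"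
    by (auto simp: fun_eq_iff ombabo_step_def case_prod_beta Let_def)
  show ?thesis unfolding * Let_def by measurable
qed

lemma obabo_kernel:
  shows measurable_obabo_kernel: "obabo_kernel U \<gamma> \<delta> \<in> borel \<rightarrow>\<^sub>M subprob_algebra borel"
    and prob_space_obabo_kernel: "prob_space (obabo_kernel U \<gamma> \<delta> z)"
    and nn_integral_obabo_kernel: "f \<in> borel_measurable borel \<Longrightarrow>
      (\<integral>\<^sup>+y. f y \<partial>obabo_kernel U \<gamma> \<delta> z) = refresh \<gamma> \<delta> (\<lambda>z'. refresh \<gamma> \<delta> f (verlet U \<delta> z')) z"
proof -
  interpret G: prob_space "std_gaussian :: (real ^ 'n) measure" by (rule prob_space_std_gaussian)
  interpret GG: pair_prob_space "std_gaussian :: (real ^ 'n) measure" "std_gaussian :: (real ^ 'n) measure" ..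
  have P: "std_gaussian \<Otimes>\<^sub>M std_gaussian \<in> space (subprob_algebra ((std_gaussian :: (real ^ 'n) measure) \<Otimes>\<^sub>M (std_gaussian :: (real ^ 'n) measure)))"
    by (simp add: space_subprob_algebra GG.subprob_space_axioms)
  show "obabo_kernel U \<gamma> \<delta> \<in> borel \<rightarrow>\<^sub>M subprob_algebra borel"
    unfolding obabo_kernel_def[abs_def] by (rule measurable_distr2[OF measurable_obabo_step measurable_const[OF P]])
  have m[measurable]: "obabo_step U \<gamma> \<delta> z \<in> borel_measurable (std_gaussian \<Otimes>\<^sub>M std_gaussian)" for z
    using measurable_Pair2[OF measurable_obabo_step, of z] by simp
  show "prob_space (obabo_kernel U \<gamma> \<delta> z)" unfolding obabo_kernel_def by (rule GG.prob_space_distr[OF m])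
  assume f[measurable]: "f \<in> borel_measurable borel"
  have "(\<integral>\<^sup>+y. f y \<partial>obabo_kernel U \<gamma> \<delta> z) = (\<integral>\<^sup>+gg. f (obabo_step U \<gamma> \<delta> z gg) \<partial>(std_gaussian \<Otimes>\<^sub>M std_gaussian))"
    unfolding obabo_kernel_def by (rule nn_integral_distr) measurable
  also have "\<dots> = (\<integral>\<^sup>+g. \<integral>\<^sup>+g'. f (obabo_step U \<gamma> \<delta> z (g, g')) \<partial>std_gaussian \<partial>std_gaussian)"
    by (rule G.nn_integral_fst[symmetric]) measurable
  finally show "(\<integral>\<^sup>+y. f y \<partial>obabo_kernel U \<gamma> \<delta> z) = refresh \<gamma> \<delta> (\<lambda>z'. refresh \<gamma> \<delta> f (verlet U \<delta> z')) z"
    by (simp add: refresh_def obabo_step_eq case_prod_beta Let_def)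
qed

lemma ombabo_kernel:
  shows measurable_ombabo_kernel: "ombabo_kernel U \<gamma> \<delta> \<in> borel \<rightarrow>\<^sub>M subprob_algebra borel"
    and prob_space_ombabo_kernel: "prob_space (ombabo_kernel U \<gamma> \<delta> z)"
    and nn_integral_ombabo_kernel: "f \<in> borel_measurable borel \<Longrightarrow>
      (\<integral>\<^sup>+y. f y \<partial>ombabo_kernel U \<gamma> \<delta> z) = refresh \<gamma> \<delta> (\<lambda>y. ennreal (accept_prob U \<delta> y) * refresh \<gamma> \<delta> f (verlet U \<delta> y)
          + ennreal (1 - accept_prob U \<delta> y) * refresh \<gamma> \<delta> f (fst y, - snd y)) z"
proof -
  interpret G: prob_space "std_gaussian :: (real ^ 'n) measure" by (rule prob_space_std_gaussian)
  interpret W: prob_space "uniform_measure lborel {0..1::real}" by (rule prob_space_uniform_01)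
  interpret GW: pair_prob_space "std_gaussian :: (real ^ 'n) measure" "uniform_measure lborel {0..1::real}" ..
  interpret GGW: pair_prob_space "std_gaussian :: (real ^ 'n) measure" "std_gaussian \<Otimes>\<^sub>M uniform_measure lborel {0..1::real} :: ((real ^ 'n) \<times> real) measure" ..
  have P: "std_gaussian \<Otimes>\<^sub>M (std_gaussian \<Otimes>\<^sub>M uniform_measure lborel {0..1::real}) \<in>
      space (subprob_algebra ((std_gaussian :: (real ^ 'n) measure) \<Otimes>\<^sub>M ((std_gaussian :: (real ^ 'n) measure) \<Otimes>\<^sub>M uniform_measure lborel {0..1::real})))"
    using prob_space_imp_subprob_space[OF prob_space_pair[OF prob_space_std_gaussian prob_space_pair[OF prob_space_std_gaussian prob_space_uniform_01]]]
    by (simp add: space_subprob_algebra)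
  show "ombabo_kernel U \<gamma> \<delta> \<in> borel \<rightarrow>\<^sub>M subprob_algebra borel"
    unfolding ombabo_kernel_def[abs_def] by (rule measurable_distr2[OF measurable_ombabo_step measurable_const[OF P]])
  have m[measurable]: "ombabo_step U \<gamma> \<delta> z \<in> borel_measurable (std_gaussian \<Otimes>\<^sub>M (std_gaussian \<Otimes>\<^sub>M uniform_measure lborel {0..1::real}))" for z
    using measurable_Pair2[OF measurable_ombabo_step, of z] by simp
  show "prob_space (ombabo_kernel U \<gamma> \<delta> z)" unfolding ombabo_kernel_def by (rule GGW.prob_space_distr[OF m])
  assume f[measurable]: "f \<in> borel_measurable borel"
  have "(\<integral>\<^sup>+y. f y \<partial>ombabo_kernel U \<gamma> \<delta> z) = (\<integral>\<^sup>+gg. f (ombabo_step U \<gamma> \<delta> z gg) \<partial>(std_gaussian \<Otimes>\<^sub>M (std_gaussian \<Otimes>\<^sub>M uniform_measure lborel {0..1::real})))"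
    unfolding ombabo_kernel_def by (rule nn_integral_distr) measurable
  also have "\<dots> = (\<integral>\<^sup>+g. \<integral>\<^sup>+gw. f (ombabo_step U \<gamma> \<delta> z (g, gw)) \<partial>(std_gaussian \<Otimes>\<^sub>M uniform_measure lborel {0..1::real}) \<partial>std_gaussian)"
    by (rule sigma_finite_measure.nn_integral_fst[symmetric]) (unfold_locales, measurable)
  also have "\<dots> = (\<integral>\<^sup>+g. \<integral>\<^sup>+g'. \<integral>\<^sup>+w. f (ombabo_step U \<gamma> \<delta> z (g, g', w)) \<partial>uniform_measure lborel {0..1::real} \<partial>std_gaussian \<partial>std_gaussian)"
    by (intro nn_integral_cong W.nn_integral_fst[symmetric]) measurable
  also have "\<dots> = refresh \<gamma> \<delta> (\<lambda>y. ennreal (accept_prob U \<delta> y) * refresh \<gamma> \<delta> f (verlet U \<delta> y)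
          + ennreal (1 - accept_prob U \<delta> y) * refresh \<gamma> \<delta> f (fst y, - snd y)) z"
    unfolding refresh_def[of \<gamma> \<delta> _ z]
  proof (intro nn_integral_cong)
    fix g
    let ?y = "(fst z, eta \<gamma> \<delta> *\<^sub>R snd z + sqrt (1 - (eta \<gamma> \<delta>)\<^sup>2) *\<^sub>R g)"
    let ?F = "\<lambda>w g'. f (fst w, eta \<gamma> \<delta> *\<^sub>R snd w + sqrt (1 - (eta \<gamma> \<delta>)\<^sup>2) *\<^sub>R g')"
    have "(\<integral>\<^sup>+g'. \<integral>\<^sup>+w. f (ombabo_step U \<gamma> \<delta> z (g, g', w)) \<partial>uniform_measure lborel {0..1::real} \<partial>std_gaussian)
       = (\<integral>\<^sup>+g'. \<integral>\<^sup>+w. (if w \<le> accept_prob U \<delta> ?y then ?F (verlet U \<delta> ?y) g' else ?F (fst ?y, - snd ?y) g') \<partial>uniform_measure lborel {0..1::real} \<partial>std_gaussian)"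
      by (intro nn_integral_cong) (simp add: ombabo_step_def case_prod_beta Let_def)
    also have "\<dots> = (\<integral>\<^sup>+g'. ennreal (accept_prob U \<delta> ?y) * ?F (verlet U \<delta> ?y) g' + ennreal (1 - accept_prob U \<delta> ?y) * ?F (fst ?y, - snd ?y) g' \<partial>std_gaussian)"
      by (intro nn_integral_cong nn_integral_uniform_01_if_le accept_prob_bounds)
    also have "\<dots> = ennreal (accept_prob U \<delta> ?y) * refresh \<gamma> \<delta> f (verlet U \<delta> ?y) + ennreal (1 - accept_prob U \<delta> ?y) * refresh \<gamma> \<delta> f (fst ?y, - snd ?y)"
      unfolding refresh_def by (subst nn_integral_add; (subst nn_integral_cmult)?; (subst nn_integral_cmult)?; simp)
    finally show "(\<integral>\<^sup>+g'. \<integral>\<^sup>+w. f (ombabo_step U \<gamma> \<delta> z (g, g', w)) \<partial>uniform_measure lborel {0..1::real} \<partial>std_gaussian) = \<dots>" .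
  qed
  finally show "(\<integral>\<^sup>+y. f y \<partial>ombabo_kernel U \<gamma> \<delta> z) = refresh \<gamma> \<delta> (\<lambda>y. ennreal (accept_prob U \<delta> y) * refresh \<gamma> \<delta> f (verlet U \<delta> y)
          + ennreal (1 - accept_prob U \<delta> y) * refresh \<gamma> \<delta> f (fst y, - snd y)) z" .
qed

definition rejection :: "'n phase \<Rightarrow> ennreal" where
  "rejection = refresh \<gamma> \<delta> (\<lambda>y. ennreal (1 - accept_prob U \<delta> y))"

lemma borel_measurable_rejection[measurable]: "rejection \<in> borel_measurable borel"
  unfolding rejection_def by measurable

text \<open>Both kernels start with the same refreshment and, given its outcome, differ only if the
  proposal is rejected. The last refreshment keeps a function with values in [0, 1] in that range,
  so a rejection shifts its average by at most 1.\<close>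

lemma kernels_close:
  assumes f[measurable]: "f \<in> borel_measurable borel" and f1: "\<And>z. f z \<le> (1::ennreal)"
  shows "(\<integral>\<^sup>+y. f y \<partial>ombabo_kernel U \<gamma> \<delta> z) \<le> (\<integral>\<^sup>+y. f y \<partial>obabo_kernel U \<gamma> \<delta> z) + rejection z"
    and "(\<integral>\<^sup>+y. f y \<partial>obabo_kernel U \<gamma> \<delta> z) \<le> (\<integral>\<^sup>+y. f y \<partial>ombabo_kernel U \<gamma> \<delta> z) + rejection z"
proof -
  have [measurable]: "(\<lambda>y. refresh \<gamma> \<delta> f (verlet U \<delta> y)) \<in> borel_measurable borel"
    "(\<lambda>y. refresh \<gamma> \<delta> f (fst y, - snd y)) \<in> borel_measurable borel"
    by (rule measurable_compose[OF _ borel_measurable_refresh]; measurable)+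
  have le1: "refresh \<gamma> \<delta> f y \<le> 1" for y
    using refresh_mono[of f y "\<lambda>_. 1" \<gamma> \<delta>] f1 by (simp add: refresh_const)
  let ?a = "accept_prob U \<delta>"
  have "(\<integral>\<^sup>+y. f y \<partial>ombabo_kernel U \<gamma> \<delta> z) \<le> refresh \<gamma> \<delta> (\<lambda>y. refresh \<gamma> \<delta> f (verlet U \<delta> y) + ennreal (1 - ?a y)) z"
    unfolding nn_integral_ombabo_kernel[OF f]
  proof (rule refresh_mono)
    fix v :: "real ^ 'n"
    let ?y = "(fst z, v)"
    have "ennreal (?a ?y) * refresh \<gamma> \<delta> f (verlet U \<delta> ?y) \<le> 1 * refresh \<gamma> \<delta> f (verlet U \<delta> ?y)"
      using accept_prob_bounds[of ?y] by (intro mult_right_mono) auto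
    moreover have "ennreal (1 - ?a ?y) * refresh \<gamma> \<delta> f (fst ?y, - snd ?y) \<le> ennreal (1 - ?a ?y) * 1"
      using le1 by (intro mult_left_mono) auto
    ultimately show "ennreal (?a ?y) * refresh \<gamma> \<delta> f (verlet U \<delta> ?y) + ennreal (1 - ?a ?y) * refresh \<gamma> \<delta> f (fst ?y, - snd ?y)
       \<le> refresh \<gamma> \<delta> f (verlet U \<delta> ?y) + ennreal (1 - ?a ?y)" by (intro add_mono) simp_all
  qed
  then show "(\<integral>\<^sup>+y. f y \<partial>ombabo_kernel U \<gamma> \<delta> z) \<le> (\<integral>\<^sup>+y. f y \<partial>obabo_kernel U \<gamma> \<delta> z) + rejection z"
    by (simp add: refresh_add nn_integral_obabo_kernel[OF f] rejection_def)
  have "(\<integral>\<^sup>+y. f y \<partial>obabo_kernel U \<gamma> \<delta> z) \<le> refresh \<gamma> \<delta> (\<lambda>y. (ennreal (?a y) * refresh \<gamma> \<delta> f (verlet U \<delta> y)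
          + ennreal (1 - ?a y) * refresh \<gamma> \<delta> f (fst y, - snd y)) + ennreal (1 - ?a y)) z"
    unfolding nn_integral_obabo_kernel[OF f]
  proof (rule refresh_mono)
    fix v :: "real ^ 'n"
    let ?y = "(fst z, v)"
    have "refresh \<gamma> \<delta> f (verlet U \<delta> ?y) = ennreal (?a ?y + (1 - ?a ?y)) * refresh \<gamma> \<delta> f (verlet U \<delta> ?y)" by simp
    also have "\<dots> = ennreal (?a ?y) * refresh \<gamma> \<delta> f (verlet U \<delta> ?y) + ennreal (1 - ?a ?y) * refresh \<gamma> \<delta> f (verlet U \<delta> ?y)"
      using accept_prob_bounds[of ?y] by (subst ennreal_plus) (auto simp: distrib_right)
    also have "\<dots> \<le> ennreal (?a ?y) * refresh \<gamma> \<delta> f (verlet U \<delta> ?y) + ennreal (1 - ?a ?y) * 1"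
      using le1 by (intro add_left_mono mult_left_mono) auto
    also have "\<dots> \<le> (ennreal (?a ?y) * refresh \<gamma> \<delta> f (verlet U \<delta> ?y)
          + ennreal (1 - ?a ?y) * refresh \<gamma> \<delta> f (fst ?y, - snd ?y)) + ennreal (1 - ?a ?y)"
      by (simp add: add.assoc add_left_mono)
    finally show "refresh \<gamma> \<delta> f (verlet U \<delta> ?y) \<le> (ennreal (?a ?y) * refresh \<gamma> \<delta> f (verlet U \<delta> ?y)
          + ennreal (1 - ?a ?y) * refresh \<gamma> \<delta> f (fst ?y, - snd ?y)) + ennreal (1 - ?a ?y)" .
  qed
  then show "(\<integral>\<^sup>+y. f y \<partial>obabo_kernel U \<gamma> \<delta> z) \<le> (\<integral>\<^sup>+y. f y \<partial>ombabo_kernel U \<gamma> \<delta> z) + rejection z"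
    by (simp add: refresh_add nn_integral_ombabo_kernel[OF f] rejection_def)
qed

end

section \<open>Perturbation of iterated kernels\<close>

lemma law_after_Suc: "law_after K (Suc n) \<nu> = law_after K n \<nu> \<bind> K"
  by (simp add: law_after_def)

lemma law_after_prob:
  assumes K: "K \<in> borel \<rightarrow>\<^sub>M subprob_algebra borel" "\<And>z. prob_space (K z)"
    and \<nu>: "prob_space \<nu>" "sets \<nu> = sets (borel :: 'a::topological_space measure)"
  shows "prob_space (law_after K n \<nu>) \<and> sets (law_after K n \<nu>) = sets borel"
proof (induction n)
  case 0
  then show ?case using \<nu> by (simp add: law_after_def)
next
  case (Suc n)
  then have K': "K \<in> law_after K n \<nu> \<rightarrow>\<^sub>M subprob_algebra borel"
    using K(1) by (simp cong: measurable_cong_sets)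
  interpret prob_space "law_after K n \<nu>" using Suc by simp
  have "prob_space (law_after K n \<nu> \<bind> K)"
    by (rule prob_space_bind[OF _ K']) (simp add: K(2))
  moreover have "sets (law_after K n \<nu> \<bind> K) = sets borel"
    by (rule sets_bind[OF sets_kernel[OF K']]) (use not_empty in auto)
  ultimately show ?case by (simp add: law_after_Suc)
qed

lemma nn_integral_law_after_Suc:
  assumes K: "K \<in> borel \<rightarrow>\<^sub>M subprob_algebra borel" "\<And>z. prob_space (K z)"
    and \<nu>: "prob_space \<nu>" "sets \<nu> = sets (borel :: 'a::topological_space measure)"
    and f: "f \<in> borel_measurable borel"
  shows "(\<integral>\<^sup>+z. f z \<partial>law_after K (Suc n) \<nu>) = (\<integral>\<^sup>+z. \<integral>\<^sup>+y. f y \<partial>K z \<partial>law_after K n \<nu>)"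
proof -
  have "K \<in> law_after K n \<nu> \<rightarrow>\<^sub>M subprob_algebra borel"
    using K(1) law_after_prob[OF K \<nu>, of n] by (simp cong: measurable_cong_sets)
  then show ?thesis unfolding law_after_Suc by (rule nn_integral_bind[OF f])
qed

text \<open>Telescoping: the last step is exchanged under the law of \<open>K\<close>, and the n
  steps before it are exchanged by induction with the test function \<open>g'\<close>. In this order
  the defect \<open>r\<close> is averaged along \<open>K\<close> alone, the chain whose moments will
  be controlled, and this holds for both inequalities.\<close>

lemma law_after_close:
  fixes K K' :: "'a::topological_space \<Rightarrow> 'a measure" and r :: "'a \<Rightarrow> ennreal"
  assumes K: "K \<in> borel \<rightarrow>\<^sub>M subprob_algebra borel" "\<And>z. prob_space (K z)"
    and K': "K' \<in> borel \<rightarrow>\<^sub>M subprob_algebra borel" "\<And>z. prob_space (K' z)"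
    and \<nu>: "prob_space \<nu>" "sets \<nu> = sets borel"
    and r: "r \<in> borel_measurable borel"
    and close: "\<And>f z. f \<in> borel_measurable borel \<Longrightarrow> (\<And>z. f z \<le> 1) \<Longrightarrow> (\<integral>\<^sup>+y. f y \<partial>K' z) \<le> (\<integral>\<^sup>+y. f y \<partial>K z) + r z"
    and close': "\<And>f z. f \<in> borel_measurable borel \<Longrightarrow> (\<And>z. f z \<le> 1) \<Longrightarrow> (\<integral>\<^sup>+y. f y \<partial>K z) \<le> (\<integral>\<^sup>+y. f y \<partial>K' z) + r z"
    and f: "f \<in> borel_measurable borel" "\<And>z. f z \<le> 1"
  shows "(\<integral>\<^sup>+z. f z \<partial>law_after K' n \<nu>) \<le> (\<integral>\<^sup>+z. f z \<partial>law_after K n \<nu>) + (\<Sum>k<n. \<integral>\<^sup>+z. r z \<partial>law_after K k \<nu>)"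
    and "(\<integral>\<^sup>+z. f z \<partial>law_after K n \<nu>) \<le> (\<integral>\<^sup>+z. f z \<partial>law_after K' n \<nu>) + (\<Sum>k<n. \<integral>\<^sup>+z. r z \<partial>law_after K k \<nu>)"
proof -
  have "(\<integral>\<^sup>+z. f z \<partial>law_after K' n \<nu>) \<le> (\<integral>\<^sup>+z. f z \<partial>law_after K n \<nu>) + (\<Sum>k<n. \<integral>\<^sup>+z. r z \<partial>law_after K k \<nu>) \<and>
    (\<integral>\<^sup>+z. f z \<partial>law_after K n \<nu>) \<le> (\<integral>\<^sup>+z. f z \<partial>law_after K' n \<nu>) + (\<Sum>k<n. \<integral>\<^sup>+z. r z \<partial>law_after K k \<nu>)"
    using f
  proof (induction n arbitrary: f)
    case 0
    then show ?case by (simp add: law_after_def)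
  next
    case (Suc n)
    define g where "g z = (\<integral>\<^sup>+y. f y \<partial>K z)" for z
    define g' where "g' z = (\<integral>\<^sup>+y. f y \<partial>K' z)" for z
    have gm: "g \<in> borel_measurable borel" "g' \<in> borel_measurable borel"
      unfolding g_def[abs_def] g'_def[abs_def]
      by (rule nn_integral_measurable_subprob_algebra2[where N = borel]; use Suc.prems K K' in \<open>simp add: measurable_compose[OF measurable_snd]\<close>)+
    have g1: "g' z \<le> 1" for z
    proof -
      have "g' z \<le> (\<integral>\<^sup>+y. 1 \<partial>K' z)" unfolding g'_def by (intro nn_integral_mono Suc.prems)
      then show ?thesis using prob_space.emeasure_space_1[OF K'(2)[of z]] by simp
    qed
    have S: "sets (law_after K n \<nu>) = sets borel" using law_after_prob[OF K \<nu>] by blast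
    have m: "g \<in> borel_measurable (law_after K n \<nu>)" "g' \<in> borel_measurable (law_after K n \<nu>)" "r \<in> borel_measurable (law_after K n \<nu>)"
      using gm r measurable_cong_sets[OF S refl] by auto
    have I1: "(\<integral>\<^sup>+z. g' z \<partial>law_after K n \<nu>) \<le> (\<integral>\<^sup>+z. g z \<partial>law_after K n \<nu>) + (\<integral>\<^sup>+z. r z \<partial>law_after K n \<nu>)"
      using close[OF Suc.prems] by (subst nn_integral_add[OF m(1,3), symmetric]) (auto intro!: nn_integral_mono simp: g_def g'_def)
    have I2: "(\<integral>\<^sup>+z. g z \<partial>law_after K n \<nu>) \<le> (\<integral>\<^sup>+z. g' z \<partial>law_after K n \<nu>) + (\<integral>\<^sup>+z. r z \<partial>law_after K n \<nu>)"
      using close'[OF Suc.prems] by (subst nn_integral_add[OF m(2,3), symmetric]) (auto intro!: nn_integral_mono simp: g_def g'_def)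
    note IH = Suc.IH[OF gm(2) g1]
    let ?S = "\<Sum>k<n. \<integral>\<^sup>+z. r z \<partial>law_after K k \<nu>"
    let ?R = "\<integral>\<^sup>+z. r z \<partial>law_after K n \<nu>"
    have "(\<integral>\<^sup>+z. g' z \<partial>law_after K' n \<nu>) \<le> (\<integral>\<^sup>+z. g' z \<partial>law_after K n \<nu>) + ?S" using IH by blast
    also have "\<dots> \<le> ((\<integral>\<^sup>+z. g z \<partial>law_after K n \<nu>) + ?R) + ?S" by (intro add_right_mono I1)
    finally have A: "(\<integral>\<^sup>+z. g' z \<partial>law_after K' n \<nu>) \<le> (\<integral>\<^sup>+z. g z \<partial>law_after K n \<nu>) + (?S + ?R)" by (simp add: ac_simps)
    have "(\<integral>\<^sup>+z. g z \<partial>law_after K n \<nu>) \<le> (\<integral>\<^sup>+z. g' z \<partial>law_after K n \<nu>) + ?R" by (rule I2)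
    also have "\<dots> \<le> ((\<integral>\<^sup>+z. g' z \<partial>law_after K' n \<nu>) + ?S) + ?R" using IH by (intro add_right_mono) blast
    finally have B: "(\<integral>\<^sup>+z. g z \<partial>law_after K n \<nu>) \<le> (\<integral>\<^sup>+z. g' z \<partial>law_after K' n \<nu>) + (?S + ?R)" by (simp add: ac_simps)
    from A B show ?case
      by (simp add: nn_integral_law_after_Suc[OF K \<nu> Suc.prems(1)] nn_integral_law_after_Suc[OF K' \<nu> Suc.prems(1)] g_def g'_def)
  qed
  then show "(\<integral>\<^sup>+z. f z \<partial>law_after K' n \<nu>) \<le> (\<integral>\<^sup>+z. f z \<partial>law_after K n \<nu>) + (\<Sum>k<n. \<integral>\<^sup>+z. r z \<partial>law_after K k \<nu>)"
    and "(\<integral>\<^sup>+z. f z \<partial>law_after K n \<nu>) \<le> (\<integral>\<^sup>+z. f z \<partial>law_after K' n \<nu>) + (\<Sum>k<n. \<integral>\<^sup>+z. r z \<partial>law_after K k \<nu>)" by auto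
qed

section \<open>Contraction of the deterministic step\<close>

locale obabo_params =
  fixes m L \<gamma> \<delta> :: real
  assumes m_pos: "0 < m" and m_le_L: "m \<le> L" and \<gamma>_ge: "2 * sqrt L \<le> \<gamma>"
    and \<delta>_pos: "0 < \<delta>" and \<delta>_le: "\<delta> \<le> m / (33 * \<gamma> ^ 3)"
begin

text \<open>\<open>\<theta>\<close> is the variance added by one refreshment, and two refreshments
  damp the velocity by 1 - \<theta>. \<open>\<tau>\<close> is the corresponding friction per unit of
  time; it is at most \<gamma> and makes \<theta> = \<delta> \<tau> exact.\<close>

definition \<theta> :: real where "\<theta> = 1 - (eta \<gamma> \<delta>)\<^sup>2"
definition \<tau> :: real where "\<tau> = \<theta> / \<delta>"
definition \<kappa> :: real where "\<kappa> = kappa m \<gamma>"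

section \<open>Consequences of the step size restriction\<close>

lemma L_pos: "0 < L" using m_pos m_le_L by linarith

lemma \<gamma>_pos: "0 < \<gamma>" using \<gamma>_ge L_pos real_sqrt_gt_zero[of L] by linarith

lemma four_L_le: "4 * L \<le> \<gamma>\<^sup>2"
proof -
  have "(2 * sqrt L)\<^sup>2 \<le> \<gamma>\<^sup>2" using \<gamma>_ge L_pos by (intro power_mono) auto
  then show ?thesis using L_pos by (simp add: power_mult_distrib)
qed

text \<open>The restriction on \<delta> enters the estimates through these bounds; 4 m \<le> 4 L
  \<le> \<gamma>^2 turns the factor 33 into 132.\<close>

lemma \<delta>\<gamma>: "33 * (\<delta> * \<gamma>) * \<gamma>\<^sup>2 \<le> m" "\<delta> * \<gamma> \<le> 1 / 132" "0 < \<delta> * \<gamma>"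
proof -
  show 1: "33 * (\<delta> * \<gamma>) * \<gamma>\<^sup>2 \<le> m"
    using \<delta>_le \<gamma>_pos by (simp add: pos_le_divide_eq power3_eq_cube power2_eq_square mult_ac)
  have p: "0 < \<delta> * \<gamma>" using \<delta>_pos \<gamma>_pos by simp
  have "33 * (\<delta> * \<gamma>) * (4 * m) \<le> 33 * (\<delta> * \<gamma>) * \<gamma>\<^sup>2"
    using four_L_le m_le_L p by (intro mult_left_mono) auto
  with 1 have "(132 * (\<delta> * \<gamma>)) * m \<le> 1 * m" by simp
  then have "132 * (\<delta> * \<gamma>) \<le> 1" using m_pos by (simp only: mult_le_cancel_right_pos)
  then show "\<delta> * \<gamma> \<le> 1 / 132" "0 < \<delta> * \<gamma>" using p by auto
qed

lemma eta_sq: "(eta \<gamma> \<delta>)\<^sup>2 = exp (- (\<delta> * \<gamma>))"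
  by (simp add: eta_def power2_eq_square exp_add[symmetric])

lemma eta_pos: "0 < eta \<gamma> \<delta>" and eta_less_one: "eta \<gamma> \<delta> < 1"
  using \<delta>\<gamma>(3) by (simp_all add: eta_def)

lemma eta_sq_\<theta>: "(eta \<gamma> \<delta>)\<^sup>2 = 1 - \<theta>" by (simp add: \<theta>_def)

lemma \<theta>_bounds: "0 < \<theta>" "\<theta> \<le> \<delta> * \<gamma>" "132 * (\<delta> * \<gamma>) \<le> 133 * \<theta>" "\<theta> \<le> 1 / 132"
proof -
  let ?x = "\<delta> * \<gamma>"
  have \<theta>: "\<theta> = 1 - exp (- ?x)" by (simp add: \<theta>_def eta_sq)
  show "0 < \<theta>" using \<delta>\<gamma>(3) by (simp add: \<theta>)
  show le: "\<theta> \<le> ?x" using exp_ge_add_one_self[of "- ?x"] by (simp add: \<theta>)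
  then show "\<theta> \<le> 1 / 132" using \<delta>\<gamma>(2) by linarith
  have "(1 + ?x) * exp (- ?x) \<le> exp ?x * exp (- ?x)"
    using exp_ge_add_one_self[of ?x] by (intro mult_right_mono) auto
  also have "\<dots> = 1" by (simp add: exp_minus)
  finally have "?x \<le> (1 + ?x) * \<theta>" by (simp add: \<theta> algebra_simps)
  also have "\<dots> \<le> (133 / 132) * \<theta>" using \<delta>\<gamma>(2) \<open>0 < \<theta>\<close> by (intro mult_right_mono) auto
  finally show "132 * ?x \<le> 133 * \<theta>" by simp
qed

lemma \<tau>_bounds: "0 < \<tau>" "\<theta> = \<delta> * \<tau>" "\<tau> \<le> \<gamma>" "132 * \<gamma> \<le> 133 * \<tau>"
proof -
  show "0 < \<tau>" using \<theta>_bounds \<delta>_pos by (simp add: \<tau>_def)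
  show eq: "\<theta> = \<delta> * \<tau>" using \<delta>_pos by (simp add: \<tau>_def)
  show "\<tau> \<le> \<gamma>" "132 * \<gamma> \<le> 133 * \<tau>"
    using \<theta>_bounds(2,3) \<delta>_pos unfolding eq by (simp_all add: mult.left_commute[of _ \<delta>])
qed

text \<open>2539/10000 is (133/132)^2 / 4 rounded up.\<close>

lemma L_le_\<tau>: "L \<le> (2539 / 10000) * \<tau>\<^sup>2"
proof -
  have "(132 * \<gamma>)\<^sup>2 \<le> (133 * \<tau>)\<^sup>2" using \<tau>_bounds \<gamma>_pos by (intro power_mono) auto
  then have "17424 * \<gamma>\<^sup>2 \<le> 17689 * \<tau>\<^sup>2" by (simp add: power_mult_distrib)
  then show ?thesis using four_L_le zero_le_power2[of \<tau>] by linarith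
qed

lemma \<delta>_sq_L: "\<delta>\<^sup>2 * L \<le> (2539 / 10000) * \<theta>\<^sup>2" "\<delta>\<^sup>2 * L \<le> 1 / 60000" "0 \<le> \<delta>\<^sup>2 * L"
proof -
  have "\<delta>\<^sup>2 * L \<le> \<delta>\<^sup>2 * ((2539 / 10000) * \<tau>\<^sup>2)" using L_le_\<tau> by (intro mult_left_mono) auto
  then show 1: "\<delta>\<^sup>2 * L \<le> (2539 / 10000) * \<theta>\<^sup>2" by (simp add: \<tau>_bounds(2) power_mult_distrib mult_ac)
  have "\<theta>\<^sup>2 \<le> (1 / 132)\<^sup>2" using \<theta>_bounds by (intro power_mono) auto
  with 1 show "\<delta>\<^sup>2 * L \<le> 1 / 60000" by (simp add: power2_eq_square)
  show "0 \<le> \<delta>\<^sup>2 * L" using L_pos by simp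
qed

text \<open>From m \<le> \<gamma>^2 / 4 follows \<kappa> \<le> \<gamma> / 12, and the factor 133/132
  passes from \<gamma> to \<tau>. The third bound keeps m, because m |x|^2 is what strong convexity
  dissipates.\<close>

lemma \<kappa>_bounds: "0 < \<kappa>" "\<kappa> * \<delta> \<le> (21 / 250) * \<theta>" "\<kappa> * \<delta> * \<tau>\<^sup>2 \<le> m * \<theta> / 3" "\<kappa> * \<delta> \<le> 1 / 1500" "11 * \<kappa> \<le> \<tau>"
proof -
  show 0: "0 < \<kappa>" using m_pos \<gamma>_pos by (simp add: \<kappa>_def kappa_def)
  have "m \<le> \<gamma>\<^sup>2 / 4" using four_L_le m_le_L by linarith
  then have "\<kappa> \<le> (\<gamma>\<^sup>2 / 4) / (3 * \<gamma>)" unfolding \<kappa>_def kappa_def using \<gamma>_pos by (intro divide_right_mono) auto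
  also have "\<dots> = \<gamma> / 12" using \<gamma>_pos by (simp add: power2_eq_square)
  finally have 1: "\<kappa> \<le> \<gamma> / 12" .
  then show "11 * \<kappa> \<le> \<tau>" using \<tau>_bounds by linarith
  have "\<kappa> * \<delta> \<le> (\<gamma> / 12) * \<delta>" using 1 \<delta>_pos by (intro mult_right_mono) auto
  then show 2: "\<kappa> * \<delta> \<le> (21 / 250) * \<theta>" using \<theta>_bounds(1,3) by (simp add: mult.commute)
  then show "\<kappa> * \<delta> \<le> 1 / 1500" using \<theta>_bounds by linarith
  have "\<kappa> * \<tau> \<le> \<kappa> * \<gamma>" using 0 \<tau>_bounds by (intro mult_left_mono) auto
  also have "\<dots> = m / 3" using \<gamma>_pos by (simp add: \<kappa>_def kappa_def)
  finally have "(\<kappa> * \<tau>) * (\<delta> * \<tau>) \<le> (m / 3) * (\<delta> * \<tau>)"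
    using \<delta>_pos \<tau>_bounds(1) by (intro mult_right_mono) auto
  then show "\<kappa> * \<delta> * \<tau>\<^sup>2 \<le> m * \<theta> / 3" by (simp add: \<tau>_bounds(2) power2_eq_square mult_ac)
qed

text \<open>Up to the factor 2 / \<tau>^2 this is |v|^2 + |v + \<tau> x|^2, see
  \<open>lyap_scaled\<close>. The combination v + \<tau> x does not feel the friction: in (1 -
  \<theta>) v + \<tau> (x + \<delta> v) the damping cancels the drift because \<theta> = \<delta>
  \<tau>. This is why the twist uses \<tau> instead of \<gamma>.\<close>

definition lyap :: "'e::real_inner \<Rightarrow> 'e \<Rightarrow> real" where
  "lyap x v = (norm x)\<^sup>2 + (norm (x + (2 / \<tau>) *\<^sub>R v))\<^sup>2"

lemma lyap_nonneg: "0 \<le> lyap x v" by (simp add: lyap_def)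

lemma norm_sq_le_lyap: "(norm x)\<^sup>2 \<le> lyap x v" by (simp add: lyap_def)

lemma lyap_scaled: "\<tau>\<^sup>2 * lyap x v = 2 * ((norm v)\<^sup>2 + (norm (v + \<tau> *\<^sub>R x))\<^sup>2)"
proof -
  have "\<tau>\<^sup>2 * (norm (x + (2 / \<tau>) *\<^sub>R v))\<^sup>2 = (norm (\<tau> *\<^sub>R (x + (2 / \<tau>) *\<^sub>R v)))\<^sup>2"
    using \<tau>_bounds(1) by (simp add: power_mult_distrib)
  also have "\<tau> *\<^sub>R (x + (2 / \<tau>) *\<^sub>R v) = \<tau> *\<^sub>R x + 2 *\<^sub>R v"
    using \<tau>_bounds(1) by (simp add: scaleR_add_right)
  finally have "\<tau>\<^sup>2 * lyap x v = (norm (\<tau> *\<^sub>R x))\<^sup>2 + (norm (\<tau> *\<^sub>R x + 2 *\<^sub>R v))\<^sup>2"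
    using \<tau>_bounds(1) by (simp add: lyap_def distrib_left power_mult_distrib)
  also have "\<dots> = 2 * ((norm v)\<^sup>2 + (norm (v + \<tau> *\<^sub>R x))\<^sup>2)"
    unfolding power2_norm_eq_inner by (simp add: inner_simps inner_commute algebra_simps)
  finally show ?thesis .
qed

section \<open>Contraction of the twisted norm and of the velocity\<close>

lemma young: "0 < s \<Longrightarrow> 2 * a * b \<le> s * a\<^sup>2 + b\<^sup>2 / s" for a b s :: real
proof -
  assume s: "0 < s"
  have "0 \<le> (s * a - b)\<^sup>2 / s" using s by simp
  also have "\<dots> = s * a\<^sup>2 + b\<^sup>2 / s - 2 * a * b" using s by (simp add: field_simps power2_eq_square)
  finally show ?thesis by simp
qed

lemma norm_add_sq_le:
  assumes "0 < s"
  shows "(norm (a + b))\<^sup>2 \<le> (1 + s) * (norm a)\<^sup>2 + (1 + 1 / s) * (norm (b::'e::real_inner))\<^sup>2"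
proof -
  have "(norm (a + b))\<^sup>2 = (norm a)\<^sup>2 + 2 * (a \<bullet> b) + (norm b)\<^sup>2"
    unfolding power2_norm_eq_inner by (simp add: inner_simps inner_commute)
  moreover have "a \<bullet> b \<le> norm a * norm b" by (rule norm_cauchy_schwarz)
  moreover have "2 * norm a * norm b \<le> s * (norm a)\<^sup>2 + (norm b)\<^sup>2 / s" by (rule young[OF assms])
  ultimately show ?thesis by (simp add: algebra_simps)
qed

text \<open>The polynomial identity behind \<open>lyap_contraction\<close>, freed from vectors. With
  E = 1 - \<theta>, the letters A, s, h, p, p1 stand for |v|^2, \<delta> v.g, \<delta> v.g1, x.g,
  x1.g1; b, g, b1 stand for the terms quadratic in the forces, \<delta>^2 / 4 times |g|^2, 2 g.g1
  and |g1|^2.\<close>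

lemma lyap_expansion:
  fixes E t :: real
  assumes "E = 1 - t"
  shows "E\<^sup>2 * (A - (s + h) + (b + g + b1)) + (Y - (s + E * h) - t * (p + E * (p1 - h + g)) + (b + E * g + E\<^sup>2 * b1))
    = A + Y - t * (2 - t) * A - (1 + E\<^sup>2) * s - 2 * E\<^sup>2 * h - t * p - t * E * p1
      + (b * (E\<^sup>2 + 1) + 2 * b1 * E\<^sup>2 + 2 * E\<^sup>2 * g)"
  unfolding assms by (simp add: algebra_simps power2_eq_square)

text \<open>The budget of the contraction. Friction supplies 2 - t units of t A and the two cross
  terms take 3/4 each. The force supplies one unit of t p, of which 3297/5000 = 1 - 1693/5000 -
  1/500 is left.\<close>

lemma lyap_expansion_le:
  fixes S1 S :: real
  assumes "S1 = S - t * (2 - t) * A - B - C - t * p - t * (1 - t) * p1 + F" "- B \<le> (3 / 4) * t * A + (1693 / 5000) * t * p"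
    "- C \<le> (3 / 4) * t * A + (1693 / 5000) * t * p1" "F \<le> (1 / 500) * t * (p + p1)"
  shows "S1 \<le> S - (1 / 2 - t) * (t * A) - (3297 / 5000) * (t * p) - (3297 / 5000 - t) * (t * p1)"
proof -
  have "S1 = (S - t * (2 - t) * A) + (- B) + (- C) - t * p - t * (1 - t) * p1 + F" using assms(1) by simp
  also have "\<dots> \<le> (S - t * (2 - t) * A) + ((3 / 4) * t * A + (1693 / 5000) * t * p) + ((3 / 4) * t * A + (1693 / 5000) * t * p1)
      - t * p - t * (1 - t) * p1 + (1 / 500) * t * (p + p1)"
    by (intro add_mono diff_mono assms order_refl)
  also have "\<dots> = S - (1 / 2 - t) * (t * A) - (3297 / 5000) * (t * p) - ((3297 / 5000) - t) * (t * p1)" by algebra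
  finally show ?thesis by simp
qed

text \<open>The forces g, g1 enter through three scalar inequalities only, so any linear image of
  the chain with such forces is covered. The work of the force on v + \<tau> x dissipates about
  \<theta> (x.g + x1.g1) and friction about 2 \<theta> |v|^2. Cocoercivity makes \<delta>^2 |g|^2 of
  order \<theta>^2 x.g, so the cross terms fit into these two gains.\<close>

lemma lyap_contraction:
  fixes x v g g1 :: "'e::real_inner"
  defines "x1 \<equiv> x + \<delta> *\<^sub>R v - (\<delta>\<^sup>2 / 2) *\<^sub>R g" and "v1 \<equiv> v - (\<delta> / 2) *\<^sub>R (g + g1)"
  assumes g: "(norm g)\<^sup>2 \<le> L * (x \<bullet> g)" "m * (norm x)\<^sup>2 \<le> x \<bullet> g" and g1: "(norm g1)\<^sup>2 \<le> L * (x1 \<bullet> g1)"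
  shows "lyap x1 ((1 - \<theta>) *\<^sub>R v1) \<le> (1 - \<kappa> * \<delta>) * lyap x v"
proof -
  define a where "a = norm v"
  define p where "p = x \<bullet> g"
  define p1 where "p1 = x1 \<bullet> g1"
  define b where "b = \<delta> * norm g"
  define b1 where "b1 = \<delta> * norm g1"
  let ?e = "1 - \<theta>"
  have e: "0 \<le> ?e" "?e \<le> 1" "?e\<^sup>2 \<le> ?e" using \<theta>_bounds by (auto simp: power2_eq_square mult_left_le)
  have p0: "0 \<le> p" using g(2) m_pos by (smt (verit) p_def mult_nonneg_nonneg zero_le_power2)
  have p10: "0 \<le> p1" using g1 L_pos by (smt (verit) p1_def zero_le_mult_iff zero_le_power2)
  have bb: "b\<^sup>2 \<le> (2539 / 10000) * \<theta>\<^sup>2 * p" "b1\<^sup>2 \<le> (2539 / 10000) * \<theta>\<^sup>2 * p1"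
  proof -
    have "b\<^sup>2 \<le> \<delta>\<^sup>2 * (L * p)" using g(1) by (simp add: b_def p_def power_mult_distrib mult_left_mono)
    also have "\<dots> \<le> ((2539 / 10000) * \<theta>\<^sup>2) * p" using mult_right_mono[OF \<delta>_sq_L(1) p0] by (simp add: mult_ac)
    finally show "b\<^sup>2 \<le> (2539 / 10000) * \<theta>\<^sup>2 * p" .
    have "b1\<^sup>2 \<le> \<delta>\<^sup>2 * (L * p1)" using g1 by (simp add: b1_def p1_def power_mult_distrib mult_left_mono)
    also have "\<dots> \<le> ((2539 / 10000) * \<theta>\<^sup>2) * p1" using mult_right_mono[OF \<delta>_sq_L(1) p10] by (simp add: mult_ac)
    finally show "b1\<^sup>2 \<le> (2539 / 10000) * \<theta>\<^sup>2 * p1" .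
  qed
  define vg where "vg = \<delta> * (v \<bullet> g)"
  define vh where "vh = \<delta> * (v \<bullet> g1)"
  define gh where "gh = \<delta>\<^sup>2 * (g \<bullet> g1)"
  have cs: "- vg \<le> a * b" "- vh \<le> a * b1" "gh \<le> b * b1"
  proof -
    have "- (v \<bullet> g) \<le> norm v * norm g" "- (v \<bullet> g1) \<le> norm v * norm g1" "g \<bullet> g1 \<le> norm g * norm g1"
      using Cauchy_Schwarz_ineq2[of v g] Cauchy_Schwarz_ineq2[of v g1] norm_cauchy_schwarz[of g g1] by linarith+
    from mult_left_mono[OF this(1), of \<delta>] mult_left_mono[OF this(2), of \<delta>] mult_left_mono[OF this(3), of "\<delta>\<^sup>2"]
    show "- vg \<le> a * b" "- vh \<le> a * b1" "gh \<le> b * b1"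
      using \<delta>_pos by (simp_all add: vg_def vh_def gh_def a_def b_def b1_def power2_eq_square mult_ac)
  qed
  have y1: "?e *\<^sub>R v1 + \<tau> *\<^sub>R x1 = (v + \<tau> *\<^sub>R x) - (\<delta> / 2) *\<^sub>R (g + ?e *\<^sub>R g1)"
  proof -
    have "\<tau> *\<^sub>R x1 = \<tau> *\<^sub>R x + \<theta> *\<^sub>R v - (\<theta> * \<delta> / 2) *\<^sub>R g"
      by (simp add: x1_def \<tau>_bounds(2) algebra_simps power2_eq_square)
    then show ?thesis
      by (simp add: v1_def algebra_simps diff_divide_distrib)
  qed
  \<comment> \<open>Cocoercivity of g1 is available at x1, so x.g1 is rewritten through
    x1.g1.\<close>
  have xg1: "x \<bullet> g1 = p1 - vh + gh / 2"
    by (simp add: p1_def x1_def vh_def gh_def inner_simps algebra_simps)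
  have n1: "(norm (?e *\<^sub>R v1))\<^sup>2 = ?e\<^sup>2 * (a\<^sup>2 - (vg + vh) + (b\<^sup>2 / 4 + gh / 2 + b1\<^sup>2 / 4))"
  proof -
    have "(norm v1)\<^sup>2 = a\<^sup>2 - (vg + vh) + (b\<^sup>2 / 4 + gh / 2 + b1\<^sup>2 / 4)"
      unfolding v1_def vg_def vh_def gh_def b_def b1_def a_def power_mult_distrib power2_norm_eq_inner
      by (simp add: inner_simps inner_commute algebra_simps power2_eq_square)
    then show ?thesis by (simp add: power_mult_distrib)
  qed
  have n2: "(norm (?e *\<^sub>R v1 + \<tau> *\<^sub>R x1))\<^sup>2 = (norm (v + \<tau> *\<^sub>R x))\<^sup>2 - (vg + ?e * vh) - \<theta> * (p + ?e * (p1 - vh + gh / 2))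
      + (b\<^sup>2 / 4 + ?e * (gh / 2) + ?e\<^sup>2 * (b1\<^sup>2 / 4))"
  proof -
    have *: "(norm ((v + \<tau> *\<^sub>R x) - (\<delta> / 2) *\<^sub>R (g + E *\<^sub>R g1)))\<^sup>2 = (norm (v + \<tau> *\<^sub>R x))\<^sup>2 - (vg + E * vh)
        - (\<delta> * \<tau>) * (p + E * (x \<bullet> g1)) + (b\<^sup>2 / 4 + E * (gh / 2) + E\<^sup>2 * (b1\<^sup>2 / 4))" for E
      unfolding vg_def vh_def gh_def b_def b1_def p_def power_mult_distrib power2_norm_eq_inner
      by (simp add: inner_simps inner_commute algebra_simps power2_eq_square)
    show ?thesis unfolding y1 * \<tau>_bounds(2)[symmetric] xg1 ..
  qed
  \<comment> \<open>Young's inequality with weight 3/4 \<theta>; (2539/10000) / (3/4) is rounded up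
    to 1693/5000.\<close>
  have t1: "(1 + ?e\<^sup>2) * (a * b) \<le> (3 / 4) * \<theta> * a\<^sup>2 + (1693 / 5000) * \<theta> * p"
  proof -
    have "(1 + ?e\<^sup>2) * (a * b) \<le> 2 * (a * b)"
      using e \<delta>_pos by (intro mult_right_mono) (auto simp: a_def b_def)
    also have "\<dots> \<le> ((3 / 4) * \<theta>) * a\<^sup>2 + b\<^sup>2 / ((3 / 4) * \<theta>)" using young[of "(3 / 4) * \<theta>" a b] \<theta>_bounds by simp
    also have "b\<^sup>2 / ((3 / 4) * \<theta>) \<le> ((2539 / 10000) * \<theta>\<^sup>2 * p) / ((3 / 4) * \<theta>)" using bb \<theta>_bounds by (intro divide_right_mono) auto
    also have "\<dots> = ((2539 / 10000) / (3 / 4)) * (\<theta> * p)" using \<theta>_bounds by (simp add: power2_eq_square)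
    also have "\<dots> \<le> (1693 / 5000) * (\<theta> * p)" using \<theta>_bounds p0 by (intro mult_right_mono) auto
    finally show ?thesis by simp
  qed
  have t2: "2 * ?e\<^sup>2 * (a * b1) \<le> (3 / 4) * \<theta> * a\<^sup>2 + (1693 / 5000) * \<theta> * p1"
  proof -
    have "2 * ?e\<^sup>2 * (a * b1) \<le> 2 * (a * b1)"
      using e \<delta>_pos by (intro mult_right_mono) (auto simp: a_def b1_def)
    also have "\<dots> \<le> ((3 / 4) * \<theta>) * a\<^sup>2 + b1\<^sup>2 / ((3 / 4) * \<theta>)" using young[of "(3 / 4) * \<theta>" a b1] \<theta>_bounds by simp
    also have "b1\<^sup>2 / ((3 / 4) * \<theta>) \<le> ((2539 / 10000) * \<theta>\<^sup>2 * p1) / ((3 / 4) * \<theta>)" using bb \<theta>_bounds by (intro divide_right_mono) auto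
    also have "\<dots> = ((2539 / 10000) / (3 / 4)) * (\<theta> * p1)" using \<theta>_bounds by (simp add: power2_eq_square)
    also have "\<dots> \<le> (1693 / 5000) * (\<theta> * p1)" using \<theta>_bounds p10 by (intro mult_right_mono) auto
    finally show ?thesis by simp
  qed
  have t3: "b\<^sup>2 / 4 * (?e\<^sup>2 + 1) + 2 * (b1\<^sup>2 / 4) * ?e\<^sup>2 + 2 * ?e\<^sup>2 * (gh / 2) \<le> (1 / 500) * \<theta> * (p + p1)"
  proof -
    have *: "b\<^sup>2 * (E + 1) / 4 + b1\<^sup>2 * E / 2 + E * gh \<le> b\<^sup>2 + b1\<^sup>2" if E: "0 \<le> E" "E \<le> 1" for E
    proof -
      have "E * gh \<le> E * ((b\<^sup>2 + b1\<^sup>2) / 2)"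
        using cs(3) sum_squares_bound[of b b1] E by (intro mult_left_mono) auto
      also have "\<dots> \<le> 1 * ((b\<^sup>2 + b1\<^sup>2) / 2)" using E by (intro mult_right_mono) auto
      finally have 1: "E * gh \<le> (b\<^sup>2 + b1\<^sup>2) / 2" by simp
      have "b\<^sup>2 * (E + 1) / 4 + b1\<^sup>2 * E / 2 + E * gh \<le> b\<^sup>2 * 2 / 4 + b1\<^sup>2 * 1 / 2 + (b\<^sup>2 + b1\<^sup>2) / 2"
        using E by (intro add_mono 1 divide_right_mono mult_left_mono) auto
      also have "\<dots> = b\<^sup>2 + b1\<^sup>2" by (simp add: add_divide_distrib)
      finally show ?thesis .
    qed
    have "b\<^sup>2 / 4 * (?e\<^sup>2 + 1) + 2 * (b1\<^sup>2 / 4) * ?e\<^sup>2 + 2 * ?e\<^sup>2 * (gh / 2) \<le> b\<^sup>2 + b1\<^sup>2"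
      using *[of "?e\<^sup>2"] e by simp
    also have "\<dots> \<le> ((2539 / 10000) * \<theta>) * (\<theta> * (p + p1))" using bb by (simp add: power2_eq_square algebra_simps)
    also have "\<dots> \<le> (1 / 500) * (\<theta> * (p + p1))" using \<theta>_bounds p0 p10 by (intro mult_right_mono) auto
    finally show ?thesis by simp
  qed
  let ?S1 = "(norm (?e *\<^sub>R v1))\<^sup>2 + (norm (?e *\<^sub>R v1 + \<tau> *\<^sub>R x1))\<^sup>2"
  let ?S = "a\<^sup>2 + (norm (v + \<tau> *\<^sub>R x))\<^sup>2"
  have "?S1 = ?S - \<theta> * (2 - \<theta>) * a\<^sup>2 - (1 + ?e\<^sup>2) * vg - 2 * ?e\<^sup>2 * vh - \<theta> * p - \<theta> * ?e * p1
     + (b\<^sup>2 / 4 * (?e\<^sup>2 + 1) + 2 * (b1\<^sup>2 / 4) * ?e\<^sup>2 + 2 * ?e\<^sup>2 * (gh / 2))"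
    unfolding n1 n2 by (rule lyap_expansion[OF refl])
  then have "?S1 \<le> ?S - (1 / 2 - \<theta>) * (\<theta> * a\<^sup>2) - (3297 / 5000) * (\<theta> * p) - (3297 / 5000 - \<theta>) * (\<theta> * p1)"
  proof (rule lyap_expansion_le)
    show "- ((1 + ?e\<^sup>2) * vg) \<le> (3 / 4) * \<theta> * a\<^sup>2 + (1693 / 5000) * \<theta> * p"
    proof -
      have "- ((1 + ?e\<^sup>2) * vg) = (1 + ?e\<^sup>2) * (- vg)" by (rule mult_minus_right[symmetric])
      also have "\<dots> \<le> (1 + ?e\<^sup>2) * (a * b)" by (intro mult_left_mono cs) simp
      also note t1
      finally show ?thesis .
    qed
    show "- (2 * ?e\<^sup>2 * vh) \<le> (3 / 4) * \<theta> * a\<^sup>2 + (1693 / 5000) * \<theta> * p1"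
    proof -
      have "- ((2 * ?e\<^sup>2) * vh) = (2 * ?e\<^sup>2) * (- vh)" by (rule mult_minus_right[symmetric])
      also have "\<dots> \<le> (2 * ?e\<^sup>2) * (a * b1)" by (intro mult_left_mono cs) simp
      also note t2
      finally show ?thesis .
    qed
  qed (rule t3)
  also have "\<dots> \<le> ?S - (49 / 100) * (\<theta> * a\<^sup>2) - (3297 / 5000) * (\<theta> * (m * (norm x)\<^sup>2))"
  proof -
    have "(49 / 100) * (\<theta> * a\<^sup>2) \<le> ((1 / 2) - \<theta>) * (\<theta> * a\<^sup>2)" "0 \<le> ((3297 / 5000) - \<theta>) * (\<theta> * p1)"
      using \<theta>_bounds p10 by (intro mult_right_mono mult_nonneg_nonneg; simp)+
    moreover have "\<theta> * (m * (norm x)\<^sup>2) \<le> \<theta> * p" using g(2) \<theta>_bounds by (intro mult_left_mono) (auto simp: p_def)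
    ultimately show ?thesis by linarith
  qed
  finally have S1: "?S1 \<le> ?S - (49 / 100) * (\<theta> * a\<^sup>2) - (3297 / 5000) * (\<theta> * (m * (norm x)\<^sup>2))" .
  \<comment> \<open>The weight 9/10 lets both losses fit: (21/250) (2 + 10/9) \<le> 49/100 for
    |v|^2, and 19/30 \<le> 3297/5000 for m |x|^2.\<close>
  have "\<kappa> * \<delta> * ?S \<le> \<kappa> * \<delta> * (a\<^sup>2 + ((1 + 1 / (9 / 10)) * a\<^sup>2 + (1 + (9 / 10)) * (norm (\<tau> *\<^sub>R x))\<^sup>2))"
    using norm_add_sq_le[of "(9 / 10)" "\<tau> *\<^sub>R x" v] \<kappa>_bounds(1) \<delta>_pos
    by (intro mult_left_mono add_left_mono) (auto simp: a_def add.commute)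
  also have "\<dots> = (\<kappa> * \<delta>) * ((2 + 1 / (9 / 10)) * a\<^sup>2) + (19 / 10) * ((\<kappa> * \<delta> * \<tau>\<^sup>2) * (norm x)\<^sup>2)"
    using \<tau>_bounds(1) by (simp add: power_mult_distrib algebra_simps)
  also have "\<dots> \<le> ((21 / 250) * \<theta>) * ((2 + 1 / (9 / 10)) * a\<^sup>2) + (19 / 10) * ((m * \<theta> / 3) * (norm x)\<^sup>2)"
    using \<kappa>_bounds by (intro add_mono mult_left_mono mult_right_mono) auto
  also have "\<dots> = ((21 / 250) * (2 + 1 / (9 / 10))) * (\<theta> * a\<^sup>2) + ((19 / 10) / 3) * (\<theta> * (m * (norm x)\<^sup>2))"
    by simp
  also have "\<dots> \<le> (49 / 100) * (\<theta> * a\<^sup>2) + (3297 / 5000) * (\<theta> * (m * (norm x)\<^sup>2))"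
    using \<theta>_bounds m_pos by (intro add_mono mult_right_mono) auto
  finally have "?S1 \<le> (1 - \<kappa> * \<delta>) * ?S" using S1 by (simp only: left_diff_distrib mult_1_left)
  then have "\<tau>\<^sup>2 * lyap x1 (?e *\<^sub>R v1) \<le> \<tau>\<^sup>2 * ((1 - \<kappa> * \<delta>) * lyap x v)"
    unfolding lyap_scaled mult.left_commute[of "\<tau>\<^sup>2"] by (simp add: a_def algebra_simps)
  then show ?thesis using \<tau>_bounds(1) by simp
qed

text \<open>With h the mean force, v1 = v - \<delta> h, and Young's inequality with weight \<theta>
  is applied. As \<delta> / \<theta> = 1 / \<tau>, the force contributes \<theta> |h|^2 / \<tau>^2;
  the bound |h|^2 \<le> (101/100) L^2 lyap and L \<le> (2539/10000) \<tau>^2 leave (13/50) L lyap,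
  without a factor \<gamma>. The factor 1 + \<theta> is absorbed by one of the two factors 1 -
  \<theta>.\<close>

lemma velocity_contraction:
  fixes x v g g1 :: "'e::real_inner"
  defines "x1 \<equiv> x + \<delta> *\<^sub>R v - (\<delta>\<^sup>2 / 2) *\<^sub>R g" and "v1 \<equiv> v - (\<delta> / 2) *\<^sub>R (g + g1)"
  assumes g: "norm g \<le> L * norm x" "norm g1 \<le> L * norm x1"
  shows "(norm ((1 - \<theta>) *\<^sub>R v1))\<^sup>2 \<le> (1 - \<theta>) * (norm v)\<^sup>2 + \<theta> * ((13 / 50) * L * lyap x v)"
proof -
  define h where "h = (1 / 2) *\<^sub>R (g + g1)"
  have "norm x1 \<le> norm x + \<delta> * norm v + (\<delta>\<^sup>2 / 2) * norm g"
    unfolding x1_def using norm_triangle_ineq4[of "x + \<delta> *\<^sub>R v" "(\<delta>\<^sup>2 / 2) *\<^sub>R g"] norm_triangle_ineq[of x "\<delta> *\<^sub>R v"] \<delta>_pos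
    by simp
  also have "(\<delta>\<^sup>2 / 2) * norm g \<le> (\<delta>\<^sup>2 / 2) * (L * norm x)" using g(1) by (intro mult_left_mono) auto
  also have "\<dots> = (\<delta>\<^sup>2 * L / 2) * norm x" by simp
  also have "\<dots> \<le> (1 / 10000) * norm x"
  proof (rule mult_right_mono)
    show "\<delta>\<^sup>2 * L / 2 \<le> (1 / 10000)" using \<delta>_sq_L(2) by linarith
  qed simp
  finally have nx1: "norm x1 \<le> (10001 / 10000) * norm x + \<delta> * norm v" by simp
  have "norm h \<le> (norm g + norm g1) / 2" using norm_triangle_ineq[of g g1] by (simp add: h_def)
  also have "\<dots> \<le> (L * norm x + L * ((10001 / 10000) * norm x + \<delta> * norm v)) / 2"
    using g(1) order_trans[OF g(2) mult_left_mono[OF nx1, of L]] L_pos by (intro divide_right_mono add_mono) auto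
  also have "\<dots> = L * ((20001 / 20000) * norm x + (\<delta> / 2) * norm v)" by (simp add: algebra_simps)
  also have "\<dots> \<le> L * ((10001 / 10000) * norm x + (\<delta> / 2) * norm v)"
    using L_pos by (intro mult_left_mono add_right_mono mult_right_mono) auto
  finally have nh: "norm h \<le> L * ((10001 / 10000) * norm x + (\<delta> / 2) * norm v)" .
  have "\<tau> * norm h \<le> \<tau> * (L * ((10001 / 10000) * norm x + (\<delta> / 2) * norm v))"
    using nh \<tau>_bounds(1) by (intro mult_left_mono) auto
  also have "\<dots> = L * ((10001 / 10000) * norm (\<tau> *\<^sub>R x) + (\<theta> / 2) * norm v)"
    using \<tau>_bounds(1) by (simp add: \<tau>_bounds(2) algebra_simps)
  finally have "(\<tau> * norm h)\<^sup>2 \<le> (L * ((10001 / 10000) * norm (\<tau> *\<^sub>R x) + (\<theta> / 2) * norm v))\<^sup>2"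
    using \<tau>_bounds(1) by (intro power_mono) auto
  also have "\<dots> = L\<^sup>2 * ((10001 / 10000) * norm (\<tau> *\<^sub>R x) + (\<theta> / 2) * norm v)\<^sup>2" by (simp add: power_mult_distrib)
  also have "((10001 / 10000) * norm (\<tau> *\<^sub>R x) + (\<theta> / 2) * norm v)\<^sup>2 \<le> (201 / 200) * (norm (\<tau> *\<^sub>R x))\<^sup>2 + (1 / 100) * (norm v)\<^sup>2"
  proof -
    define A where "A = norm (\<tau> *\<^sub>R x)"
    define B where "B = norm v"
    have th: "\<theta>\<^sup>2 \<le> (1 / 132)\<^sup>2" using \<theta>_bounds by (intro power_mono) auto
    have "((10001 / 10000) * A + (\<theta> / 2) * B)\<^sup>2 = (10001 / 10000)\<^sup>2 * A\<^sup>2 + 2 * ((10001 / 10000) * A) * ((\<theta> / 2) * B) + (\<theta>\<^sup>2 / 4) * B\<^sup>2"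
      by (simp add: power2_eq_square algebra_simps)
    also have "2 * ((10001 / 10000) * A) * ((\<theta> / 2) * B) \<le> (1 / 250) * ((10001 / 10000) * A)\<^sup>2 + ((\<theta> / 2) * B)\<^sup>2 / (1 / 250)"
      by (rule young) simp
    also have "((\<theta> / 2) * B)\<^sup>2 / (1 / 250) = (\<theta>\<^sup>2 * (125 / 2)) * B\<^sup>2" by (simp add: power_mult_distrib power_divide)
    also have "\<dots> \<le> ((1 / 132)\<^sup>2 * (125 / 2)) * B\<^sup>2" using th by (intro mult_right_mono) auto
    also have "(\<theta>\<^sup>2 / 4) * B\<^sup>2 \<le> ((1 / 132)\<^sup>2 / 4) * B\<^sup>2" using th by (intro mult_right_mono) auto
    finally have "((10001 / 10000) * A + (\<theta> / 2) * B)\<^sup>2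
        \<le> (25105020251 / 25000000000) * A\<^sup>2 + (251 / 69696) * B\<^sup>2"
      by (simp add: power_mult_distrib power_divide)
    then show ?thesis using zero_le_power2[of A] zero_le_power2[of B] unfolding A_def[symmetric] B_def[symmetric] by linarith
  qed
  \<comment> \<open>\<open>lyap_scaled\<close> bounds |v|^2 by half of \<tau>^2 lyap, and 201/200 +
    (1/100) / 2 = 101/100.\<close>
  also have "\<dots> \<le> (101 / 100) * (\<tau>\<^sup>2 * lyap x v)"
  proof -
    have "(norm (\<tau> *\<^sub>R x))\<^sup>2 \<le> \<tau>\<^sup>2 * lyap x v"
      using norm_sq_le_lyap[of x v] \<tau>_bounds(1) by (simp add: power_mult_distrib mult_left_mono)
    moreover have "(norm v)\<^sup>2 \<le> \<tau>\<^sup>2 * lyap x v / 2" unfolding lyap_scaled by simp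
    ultimately show ?thesis using zero_le_power2[of "norm v"] by linarith
  qed
  finally have "(\<tau> * norm h)\<^sup>2 \<le> L\<^sup>2 * ((101 / 100) * (\<tau>\<^sup>2 * lyap x v))" using mult_left_mono[of _ _ "L\<^sup>2"] by simp
  then have "\<tau>\<^sup>2 * (norm h)\<^sup>2 \<le> \<tau>\<^sup>2 * ((101 / 100) * L\<^sup>2 * lyap x v)" by (simp add: power_mult_distrib mult_ac)
  then have h: "(norm h)\<^sup>2 \<le> (101 / 100) * L\<^sup>2 * lyap x v" using \<tau>_bounds(1) by simp
  have "(101 / 100) * (L * lyap x v) * L \<le> (101 / 100) * (L * lyap x v) * ((2539 / 10000) * \<tau>\<^sup>2)"
    using L_le_\<tau> L_pos lyap_nonneg[of x v] by (intro mult_left_mono) auto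
  also have "\<dots> = ((101 / 100) * (2539 / 10000)) * (L * lyap x v * \<tau>\<^sup>2)" by (simp only: mult_ac)
  also have "\<dots> \<le> (13 / 50) * (L * lyap x v * \<tau>\<^sup>2)"
    using L_pos lyap_nonneg[of x v] by (intro mult_right_mono) auto
  finally have "(norm h)\<^sup>2 \<le> (13 / 50) * L * lyap x v * \<tau>\<^sup>2"
    using h by (simp only: power2_eq_square[of L] mult_ac)
  then have h': "(norm h)\<^sup>2 / \<tau>\<^sup>2 \<le> (13 / 50) * L * lyap x v" using \<tau>_bounds(1) by (simp add: pos_divide_le_eq)
  have "v1 = v + (- \<delta>) *\<^sub>R h" by (simp add: v1_def h_def)
  then have "(norm v1)\<^sup>2 \<le> (1 + \<theta>) * (norm v)\<^sup>2 + (1 + 1 / \<theta>) * (norm ((- \<delta>) *\<^sub>R h))\<^sup>2"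
    using norm_add_sq_le[OF \<theta>_bounds(1), of v "(- \<delta>) *\<^sub>R h"] by simp
  also have "(norm ((- \<delta>) *\<^sub>R h))\<^sup>2 = \<theta>\<^sup>2 * ((norm h)\<^sup>2 / \<tau>\<^sup>2)"
    using \<tau>_bounds(1) by (simp add: \<tau>_bounds(2) power_mult_distrib)
  also have "(1 + 1 / \<theta>) * (\<theta>\<^sup>2 * ((norm h)\<^sup>2 / \<tau>\<^sup>2)) = (1 + \<theta>) * (\<theta> * ((norm h)\<^sup>2 / \<tau>\<^sup>2))"
  proof -
    have "(1 + 1 / \<theta>) * (\<theta>\<^sup>2 * X) = (1 + \<theta>) * (\<theta> * X)" for X
      using \<theta>_bounds(1) by (simp add: power2_eq_square field_simps)
    then show ?thesis .
  qed
  finally have "(norm v1)\<^sup>2 \<le> (1 + \<theta>) * ((norm v)\<^sup>2 + \<theta> * ((norm h)\<^sup>2 / \<tau>\<^sup>2))" by (simp add: distrib_left)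
  then have "(1 - \<theta>)\<^sup>2 * (norm v1)\<^sup>2 \<le> (1 - \<theta>)\<^sup>2 * ((1 + \<theta>) * ((norm v)\<^sup>2 + \<theta> * ((norm h)\<^sup>2 / \<tau>\<^sup>2)))"
    by (intro mult_left_mono) auto
  also have "\<dots> = ((1 - \<theta>) * (1 - \<theta>\<^sup>2)) * ((norm v)\<^sup>2 + \<theta> * ((norm h)\<^sup>2 / \<tau>\<^sup>2))"
  proof -
    have "(1 - \<theta>)\<^sup>2 * ((1 + \<theta>) * X) = ((1 - \<theta>) * (1 - \<theta>\<^sup>2)) * X" for X
      by (simp add: power2_eq_square algebra_simps)
    then show ?thesis .
  qed
  also have "\<dots> \<le> (1 - \<theta>) * ((norm v)\<^sup>2 + \<theta> * ((norm h)\<^sup>2 / \<tau>\<^sup>2))"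
    using \<theta>_bounds by (intro mult_right_mono) (auto simp: mult_left_le)
  also have "\<dots> \<le> (1 - \<theta>) * (norm v)\<^sup>2 + \<theta> * ((norm h)\<^sup>2 / \<tau>\<^sup>2)"
  proof -
    have *: "(1 - \<theta>) * (Y + \<theta> * X) \<le> (1 - \<theta>) * Y + \<theta> * X" if "0 \<le> X" for X Y
      using that \<theta>_bounds mult_left_le_one_le[of "\<theta> * X" "1 - \<theta>"] by (simp add: distrib_left)
    show ?thesis by (rule *) simp
  qed
  also have "\<dots> \<le> (1 - \<theta>) * (norm v)\<^sup>2 + \<theta> * ((13 / 50) * L * lyap x v)"
    using h' \<theta>_bounds by (intro add_left_mono mult_left_mono) auto
  finally show ?thesis by (simp add: power_mult_distrib)
qed

text \<open>Dividing by 1 - \<kappa> \<delta> makes the initial moment the value at a fictitious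
  time before the first refreshment, the form of \<open>A\<close> in
  \<open>sum_le_of_contraction\<close>.\<close>

lemma lyap_initial:
  "lyap x (eta \<gamma> \<delta> *\<^sub>R v) / (1 - \<kappa> * \<delta>) \<le> ((401 / 100) + (77 / 50) / L) * ((norm x)\<^sup>2 + (norm (v::'e::real_inner))\<^sup>2)"
proof -
  have "lyap x (eta \<gamma> \<delta> *\<^sub>R v) \<le> (norm x)\<^sup>2 + ((1 + 2) * (norm x)\<^sup>2 + (1 + 1 / 2) * (norm ((2 / \<tau>) *\<^sub>R eta \<gamma> \<delta> *\<^sub>R v))\<^sup>2)"
    unfolding lyap_def using norm_add_sq_le[of 2 x "(2 / \<tau>) *\<^sub>R eta \<gamma> \<delta> *\<^sub>R v"] by simp
  also have "(norm ((2 / \<tau>) *\<^sub>R eta \<gamma> \<delta> *\<^sub>R v))\<^sup>2 \<le> ((2539 / 2500) / L) * (norm v)\<^sup>2"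
  proof -
    have "(norm ((2 / \<tau>) *\<^sub>R eta \<gamma> \<delta> *\<^sub>R v))\<^sup>2 = (4 / \<tau>\<^sup>2) * ((1 - \<theta>) * (norm v)\<^sup>2)"
      by (simp add: power_mult_distrib eta_sq_\<theta> power_divide)
    also have "\<dots> \<le> (4 / \<tau>\<^sup>2) * (norm v)\<^sup>2"
      using \<theta>_bounds by (intro mult_left_mono) (auto simp: mult_left_le_one_le)
    also have "4 / \<tau>\<^sup>2 \<le> (2539 / 2500) / L" using L_le_\<tau> L_pos \<tau>_bounds(1) by (simp add: divide_simps)
    finally show ?thesis by (simp add: mult_right_mono)
  qed
  finally have 1: "lyap x (eta \<gamma> \<delta> *\<^sub>R v) \<le> 4 * (norm x)\<^sup>2 + ((7617 / 5000) / L) * (norm v)\<^sup>2" by simp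
  have k: "0 < 1 - \<kappa> * \<delta>" "1 / (1 - \<kappa> * \<delta>) \<le> (1001 / 1000)" using \<kappa>_bounds by (auto simp: divide_simps)
  have "lyap x (eta \<gamma> \<delta> *\<^sub>R v) / (1 - \<kappa> * \<delta>) = lyap x (eta \<gamma> \<delta> *\<^sub>R v) * (1 / (1 - \<kappa> * \<delta>))" by simp
  also have "\<dots> \<le> lyap x (eta \<gamma> \<delta> *\<^sub>R v) * (1001 / 1000)" using k lyap_nonneg by (intro mult_left_mono) auto
  also have "\<dots> \<le> (4 * (norm x)\<^sup>2 + ((7617 / 5000) / L) * (norm v)\<^sup>2) * (1001 / 1000)" using 1 by (intro mult_right_mono) auto
  also have "\<dots> = (1001 / 250) * (norm x)\<^sup>2 + ((7617 / 5000) * (1001 / 1000) / L) * (norm v)\<^sup>2" by (simp add: algebra_simps)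
  also have "\<dots> \<le> ((401 / 100) + (77 / 50) / L) * (norm x)\<^sup>2 + ((401 / 100) + (77 / 50) / L) * (norm v)\<^sup>2"
    using L_pos by (intro add_mono mult_right_mono) (auto simp: divide_simps)
  finally show ?thesis by (simp add: distrib_left)
qed

end

section \<open>Drift of a Lyapunov function\<close>

lemma powr_convex_comb:
  fixes a b t q :: real
  assumes "0 \<le> a" "0 \<le> b" "0 \<le> t" "t \<le> 1" "1 \<le> q"
  shows "((1 - t) * a + t * b) powr q \<le> (1 - t) * a powr q + t * b powr q"
proof -
  have s: "(s * y) powr q \<le> s * y powr q" if "0 \<le> s" "s \<le> 1" "0 \<le> y" for s y :: real
  proof (cases "s = 0")
    case False
    have "s powr q \<le> s powr 1" using that False assms(5) by (intro powr_mono') auto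
    then show ?thesis using that False by (simp add: powr_mult mult_right_mono)
  qed simp
  consider "a = 0" | "b = 0" | "0 < a" "0 < b" using assms by fastforce
  then show ?thesis
  proof cases
    case 1
    then show ?thesis using s[of t b] assms by simp
  next
    case 2
    then show ?thesis using s[of "1 - t" a] assms by simp
  next
    case 3
    then show ?thesis
      using convex_onD[OF powr_convex[OF assms(5)], of t a b] assms by simp
  qed
qed

text \<open>Jensen with weights proportional to \<alpha> and \<beta>, in the role of Minkowski's
  inequality: if the averages of f^q and g^q are at most \<alpha>^q T and \<beta>^q T, then that of
  (f + g)^q is at most (\<alpha> + \<beta>)^q T, and no roots are taken.\<close>

lemma powr_weighted_sum_le:
  fixes f g \<alpha> \<beta> q :: real
  assumes "0 \<le> f" "0 \<le> g" "0 < \<alpha>" "0 < \<beta>" "1 \<le> q"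
  shows "(f + g) powr q \<le> (\<alpha> + \<beta>) powr q * (\<alpha> / (\<alpha> + \<beta>) * (f powr q / \<alpha> powr q) + \<beta> / (\<alpha> + \<beta>) * (g powr q / \<beta> powr q))"
proof -
  let ?t = "\<beta> / (\<alpha> + \<beta>)"
  have t: "1 - ?t = \<alpha> / (\<alpha> + \<beta>)" "0 \<le> ?t" "?t \<le> 1" using assms by (auto simp: field_simps)
  have "f + g = (\<alpha> + \<beta>) * ((1 - ?t) * (f / \<alpha>) + ?t * (g / \<beta>))"
  proof -
    have ne: "\<alpha> + \<beta> \<noteq> 0" using assms by simp
    have "(\<alpha> + \<beta>) * (\<alpha> / (\<alpha> + \<beta>) * (f / \<alpha>)) = f" "(\<alpha> + \<beta>) * (\<beta> / (\<alpha> + \<beta>) * (g / \<beta>)) = g"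
      using ne assms by simp_all
    then show ?thesis unfolding t(1) distrib_left by simp
  qed
  then have "(f + g) powr q = (\<alpha> + \<beta>) powr q * ((1 - ?t) * (f / \<alpha>) + ?t * (g / \<beta>)) powr q"
    using assms t by (simp add: powr_mult del: t(1))
  also have "\<dots> \<le> (\<alpha> + \<beta>) powr q * ((1 - ?t) * (f / \<alpha>) powr q + ?t * (g / \<beta>) powr q)"
    using assms t(2,3) by (intro mult_left_mono powr_convex_comb) auto
  finally show ?thesis using assms unfolding t(1) by (simp add: powr_divide)
qed

text \<open>\<open>A\<close> acts as the value at index -1. The quantity s (a 0 + ... + a (n-1)) +
  (1 - s) a (n-1) grows by at most s C n from n to n + 1. Used as an invariant it avoids
  subtraction, so infinite values are allowed.\<close>

lemma sum_le_of_contraction: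
  fixes a C :: "nat \<Rightarrow> ennreal" and A :: ennreal
  assumes s: "0 < s" "s < 1"
    and init: "a 0 \<le> ennreal (1 - s) * A + ennreal s * C 0"
    and step: "\<And>k. a (Suc k) \<le> ennreal (1 - s) * a k + ennreal s * C (Suc k)"
  shows "(\<Sum>k<n. a k) \<le> ennreal (1 / s) * A + (\<Sum>k<n. C k)"
proof -
  define a' where "a' k = (case k of 0 \<Rightarrow> A | Suc j \<Rightarrow> a j)" for k
  have a': "a k \<le> ennreal (1 - s) * a' k + ennreal s * C k" for k
    using init step by (cases k) (auto simp: a'_def)
  have "ennreal s * (\<Sum>k<n. a k) + ennreal (1 - s) * a' n \<le> ennreal (1 - s) * A + ennreal s * (\<Sum>k<n. C k)"
  proof (induction n)
    case 0
    then show ?case by (simp add: a'_def)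
  next
    case (Suc n)
    have "ennreal s * (\<Sum>k<Suc n. a k) + ennreal (1 - s) * a' (Suc n)
        = ennreal s * (\<Sum>k<n. a k) + (ennreal s + ennreal (1 - s)) * a n"
      by (simp add: a'_def distrib_left distrib_right add.assoc)
    also have "ennreal s + ennreal (1 - s) = 1" using s by (simp add: ennreal_plus[symmetric] del: ennreal_plus)
    also have "ennreal s * (\<Sum>k<n. a k) + 1 * a n
        \<le> ennreal s * (\<Sum>k<n. a k) + (ennreal (1 - s) * a' n + ennreal s * C n)"
      using a' by (intro add_left_mono) simp
    also have "\<dots> = (ennreal s * (\<Sum>k<n. a k) + ennreal (1 - s) * a' n) + ennreal s * C n"
      by (simp add: add.assoc)
    also have "\<dots> \<le> (ennreal (1 - s) * A + ennreal s * (\<Sum>k<n. C k)) + ennreal s * C n"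
      by (intro add_right_mono Suc.IH)
    finally show ?case by (simp add: distrib_left add.assoc)
  qed
  then have "ennreal s * (\<Sum>k<n. a k) \<le> ennreal (1 - s) * A + ennreal s * (\<Sum>k<n. C k)"
    by (rule order_trans[rotated]) simp
  also have "\<dots> \<le> 1 * A + ennreal s * (\<Sum>k<n. C k)"
    using s by (intro add_right_mono mult_right_mono) auto
  finally have "ennreal (1 / s) * (ennreal s * (\<Sum>k<n. a k)) \<le> ennreal (1 / s) * (1 * A + ennreal s * (\<Sum>k<n. C k))"
    by (intro mult_left_mono) auto
  then show ?thesis
    using s by (simp add: distrib_left mult.assoc[symmetric] ennreal_mult[symmetric])
qed

text \<open>A linear image of the chain that evolves by itself: \<open>grad_T\<close> makes the
  force on T x a function of T x, and \<open>adj\<close> makes T g standard Gaussian on the image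
  space. The instances are the identity and a single coordinate in a rotated basis.
  \<open>dE\<close> names the dimension so that an instance can present it as a cardinality or as
  1.\<close>

locale obabo_projection = obabo_params m L \<gamma> \<delta> for m L \<gamma> \<delta> :: real +
  fixes U :: "real ^ 'n::finite \<Rightarrow> real" and T :: "real ^ 'n \<Rightarrow> 'e::euclidean_space"
    and u :: "'e \<Rightarrow> real" and gr :: "'e \<Rightarrow> 'e" and c :: 'e and dE :: real
  assumes lin: "linear T" and adj: "\<And>y. T (adjoint T y) = y"
    and grad_T: "\<And>x. T (grad U x) = gr (T x)"
    and grad_cont: "continuous_on UNIV (grad U)" and U_cont: "continuous_on UNIV U"
    and u_deriv: "\<And>x. (u has_derivative (\<lambda>h. gr x \<bullet> h)) (at x)"
    and lip: "\<And>x y. norm (gr x - gr y) \<le> L * norm (x - y)"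
    and mono: "\<And>x y. m * (norm (x - y))\<^sup>2 \<le> (x - y) \<bullet> (gr x - gr y)"
    and gr_c: "gr c = 0" and dE: "dE = real DIM('e)"
begin

section \<open>Convexity and smoothness of the image potential\<close>

lemma measurable_U[measurable]: "grad U \<in> borel_measurable borel" "U \<in> borel_measurable borel"
  using grad_cont U_cont by (auto intro: borel_measurable_continuous_onI)

lemma measurable_T[measurable]: "T \<in> borel_measurable borel"
  using lin by (auto intro!: borel_measurable_continuous_onI linear_continuous_on simp: linear_conv_bounded_linear[symmetric])

lemma u_line: "((\<lambda>t. u (x + t *\<^sub>R d)) has_real_derivative gr (x + t *\<^sub>R d) \<bullet> d) (at t)"
proof -
  have "((\<lambda>t. x + t *\<^sub>R d) has_derivative (\<lambda>s. s *\<^sub>R d)) (at t)"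
    by (auto intro!: derivative_eq_intros)
  from has_derivative_compose[OF this u_deriv]
  show ?thesis by (simp add: has_field_derivative_def mult_commute_abs)
qed

lemma gr_mono_line:
  assumes "0 \<le> t"
  shows "0 \<le> (gr (x + t *\<^sub>R d) - gr x) \<bullet> d"
proof (cases "t = 0")
  case False
  have "0 \<le> m * (norm (t *\<^sub>R d))\<^sup>2" using m_pos by simp
  also have "\<dots> \<le> (t *\<^sub>R d) \<bullet> (gr (x + t *\<^sub>R d) - gr x)" using mono[of "x + t *\<^sub>R d" x] by simp
  finally show ?thesis using False assms by (simp add: inner_commute zero_le_mult_iff)
qed simp

lemma u_convex: "u x + gr x \<bullet> d \<le> u (x + d)"
proof -
  have "(\<lambda>t. u (x + t *\<^sub>R d) - t * (gr x \<bullet> d)) 0 \<le> (\<lambda>t. u (x + t *\<^sub>R d) - t * (gr x \<bullet> d)) 1"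
  proof (rule DERIV_nonneg_imp_nondecreasing[where f = "\<lambda>t. u (x + t *\<^sub>R d) - t * (gr x \<bullet> d)"])
    fix t :: real assume "0 \<le> t"
    show "\<exists>y. ((\<lambda>t. u (x + t *\<^sub>R d) - t * (gr x \<bullet> d)) has_real_derivative y) (at t) \<and> 0 \<le> y"
      using gr_mono_line[OF \<open>0 \<le> t\<close>, of x d]
      by (intro exI[of _ "gr (x + t *\<^sub>R d) \<bullet> d - gr x \<bullet> d"])
        (auto intro!: derivative_eq_intros u_line simp: inner_diff_left)
  qed simp
  then show ?thesis by simp
qed

lemma u_descent: "u (x + d) \<le> u x + gr x \<bullet> d + L / 2 * (norm d)\<^sup>2"
proof -
  let ?f = "\<lambda>t. u (x + t *\<^sub>R d) - t * (gr x \<bullet> d) - L / 2 * t\<^sup>2 * (norm d)\<^sup>2"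
  have "?f 1 \<le> ?f 0"
  proof (rule DERIV_nonpos_imp_nonincreasing[where f = ?f])
    fix t :: real assume t: "0 \<le> t"
    have "(gr (x + t *\<^sub>R d) - gr x) \<bullet> d \<le> norm (gr (x + t *\<^sub>R d) - gr x) * norm d" by (rule norm_cauchy_schwarz)
    also have "\<dots> \<le> (L * norm (t *\<^sub>R d)) * norm d" using lip[of "x + t *\<^sub>R d" x] by (intro mult_right_mono) auto
    also have "\<dots> = L * t * (norm d)\<^sup>2" using t by (simp add: power2_eq_square)
    finally show "\<exists>y. (?f has_real_derivative y) (at t) \<and> y \<le> 0"
      by (intro exI[of _ "gr (x + t *\<^sub>R d) \<bullet> d - gr x \<bullet> d - L * t * (norm d)\<^sup>2"])
        (auto intro!: derivative_eq_intros u_line simp: inner_diff_left)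
  qed simp
  then show ?thesis by simp
qed

text \<open>Two steps of length |gr x| / L are compared: one away from c, bounded below by the
  tangent at x, and one down from x, bounded below by the minimum \<open>u c\<close>. In the sum of
  both inequalities the values of u cancel.\<close>

lemma gr_cocoercive: "(norm (gr x))\<^sup>2 \<le> L * ((x - c) \<bullet> gr x)"
proof -
  let ?G = "(norm (gr x))\<^sup>2"
  have n: "gr x \<bullet> gr x = ?G" by (simp add: power2_norm_eq_inner)
  have n2: "L / 2 * (norm ((1 / L) *\<^sub>R gr x))\<^sup>2 = ?G / (2 * L)"
    using L_pos by (simp add: power_mult_distrib power_divide power2_eq_square[of L])
  have "u x + gr x \<bullet> ((c - x) + (1 / L) *\<^sub>R gr x) \<le> u (c + (1 / L) *\<^sub>R gr x)"
    using u_convex[of x "(c - x) + (1 / L) *\<^sub>R gr x"] by simp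
  also have "\<dots> \<le> u c + ?G / (2 * L)"
    using u_descent[of c "(1 / L) *\<^sub>R gr x"] by (simp only: gr_c n2 inner_zero_left add_0_right)
  finally have 1: "u x - (x - c) \<bullet> gr x + ?G / L \<le> u c + ?G / (2 * L)"
    by (simp add: inner_simps n inner_commute)
  have "u c \<le> u (x + (- 1 / L) *\<^sub>R gr x)"
    using u_convex[of c "x - c + (- 1 / L) *\<^sub>R gr x"] by (simp add: gr_c)
  also have "\<dots> \<le> u x - ?G / L + ?G / (2 * L)"
    using u_descent[of x "(- 1 / L) *\<^sub>R gr x"] n n2 by (simp add: power_mult_distrib power_divide)
  finally have 2: "u c \<le> u x - ?G / L + ?G / (2 * L)" .
  define K where "K = ?G / (2 * L)"
  have "?G / L = 2 * K" by (simp add: K_def)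
  then have "?G / L \<le> (x - c) \<bullet> gr x" using 1 2 unfolding K_def[symmetric] by linarith
  then show ?thesis using L_pos by (simp add: pos_divide_le_eq mult.commute)
qed

lemma gr_norm_le: "norm (gr x) \<le> L * norm (x - c)"
  using lip[of x c] by (simp add: gr_c)

lemma gr_strong: "m * (norm (x - c))\<^sup>2 \<le> (x - c) \<bullet> gr x"
  using mono[of x c] by (simp add: gr_c)

section \<open>One-step drift of the image chain\<close>

definition pos :: "'n phase \<Rightarrow> 'e" where "pos z = T (fst z) - c"
definition vel :: "'n phase \<Rightarrow> 'e" where "vel z = T (snd z)"

lemma measurable_pos_vel[measurable]: "pos \<in> borel_measurable borel" "vel \<in> borel_measurable borel"
  unfolding pos_def[abs_def] vel_def[abs_def] by measurable

lemma pos_verlet: "pos (verlet U \<delta> z) = pos z + \<delta> *\<^sub>R vel z - (\<delta>\<^sup>2 / 2) *\<^sub>R gr (T (fst z))"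
  and vel_verlet: "vel (verlet U \<delta> z) = vel z - (\<delta> / 2) *\<^sub>R (gr (T (fst z)) + gr (T (fst (verlet U \<delta> z))))"
  by (simp_all add: pos_def vel_def verlet_def case_prod_beta Let_def linear_add[OF lin] linear_diff[OF lin] linear_scale[OF lin] grad_T)

definition lyap_z :: "'n phase \<Rightarrow> real" where "lyap_z z = lyap (pos z) (vel z)"

lemma measurable_lyap_z[measurable]: "lyap_z \<in> borel_measurable borel"
  unfolding lyap_z_def[abs_def] lyap_def by measurable

lemma lyap_verlet:
  "lyap (pos (verlet U \<delta> z)) ((1 - \<theta>) *\<^sub>R vel (verlet U \<delta> z)) \<le> (1 - \<kappa> * \<delta>) * lyap_z z"
  unfolding lyap_z_def vel_verlet unfolding pos_verlet
proof (rule lyap_contraction)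
  let ?g = "gr (T (fst z))" and ?g1 = "gr (T (fst (verlet U \<delta> z)))"
  show "(norm ?g)\<^sup>2 \<le> L * (pos z \<bullet> ?g)" using gr_cocoercive[of "T (fst z)"] by (simp add: pos_def)
  show "m * (norm (pos z))\<^sup>2 \<le> pos z \<bullet> ?g" using gr_strong[of "T (fst z)"] by (simp add: pos_def)
  show "(norm ?g1)\<^sup>2 \<le> L * ((pos z + \<delta> *\<^sub>R vel z - (\<delta>\<^sup>2 / 2) *\<^sub>R ?g) \<bullet> ?g1)"
    unfolding pos_verlet[symmetric] unfolding pos_def by (rule gr_cocoercive)
qed

lemma vel_sq_verlet:
  "(norm ((1 - \<theta>) *\<^sub>R vel (verlet U \<delta> z)))\<^sup>2 \<le> (1 - \<theta>) * (norm (vel z))\<^sup>2 + \<theta> * ((13 / 50) * L * lyap_z z)"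
  unfolding lyap_z_def vel_verlet
proof (rule velocity_contraction)
  let ?g = "gr (T (fst z))" and ?g1 = "gr (T (fst (verlet U \<delta> z)))"
  show "norm ?g \<le> L * norm (pos z)" using gr_norm_le[of "T (fst z)"] by (simp add: pos_def)
  show "norm ?g1 \<le> L * norm (pos z + \<delta> *\<^sub>R vel z - (\<delta>\<^sup>2 / 2) *\<^sub>R ?g)"
    unfolding pos_verlet[symmetric] unfolding pos_def by (rule gr_norm_le)
qed

text \<open>The effective dimension of \<open>gaussian_powr_mean_le\<close>: dE at q = 1, and dE + l
  - 1 at q = (l + 1) / 2.\<close>

definition dimq :: "real \<Rightarrow> real" where "dimq q = dE + 2 * q - 2"

lemma dimq_ge: "1 \<le> q \<Longrightarrow> 1 \<le> dimq q"
proof -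
  assume q: "1 \<le> q"
  have "1 \<le> DIM('e)" by (simp add: Suc_leI)
  then have "1 \<le> real DIM('e)" by linarith
  then show "1 \<le> dimq q" using q dE unfolding dimq_def by linarith
qed

text \<open>The parameters cover the twisted norm (e = f = 1, r = 2 / \<tau>) and the speed (e = f =
  0, r = 1) at once; \<open>c0\<close> carries the noise left by one refreshment into
  another.\<close>

lemma refresh_powr_le:
  assumes q: "1 \<le> q" and c0: "0 \<le> c0" "0 \<le> e" and r: "0 < r"
  shows "refresh \<gamma> \<delta> (\<lambda>z. ennreal ((c0 + e * (norm (pos z))\<^sup>2 + (norm (f *\<^sub>R pos z + r *\<^sub>R vel z))\<^sup>2) powr q)) z
    \<le> ennreal ((c0 + e * (norm (pos z))\<^sup>2 + (norm (f *\<^sub>R pos z + (r * eta \<gamma> \<delta>) *\<^sub>R vel z))\<^sup>2 + r\<^sup>2 * \<theta> * dimq q) powr q)"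
proof -
  let ?s = "r * sqrt \<theta>"
  have p: "pos (fst z, v) = pos z" for v by (simp add: pos_def)
  have v: "vel (fst z, eta \<gamma> \<delta> *\<^sub>R snd z + sqrt (1 - (eta \<gamma> \<delta>)\<^sup>2) *\<^sub>R g) = eta \<gamma> \<delta> *\<^sub>R vel z + sqrt \<theta> *\<^sub>R T g" for g
    by (simp add: vel_def linear_add[OF lin] linear_scale[OF lin] \<theta>_def)
  have "refresh \<gamma> \<delta> (\<lambda>z. ennreal ((c0 + e * (norm (pos z))\<^sup>2 + (norm (f *\<^sub>R pos z + r *\<^sub>R vel z))\<^sup>2) powr q)) z
    = (\<integral>\<^sup>+g. ennreal ((c0 + e * (norm (pos z))\<^sup>2 + (norm ((f *\<^sub>R pos z + (r * eta \<gamma> \<delta>) *\<^sub>R vel z) + ?s *\<^sub>R T g))\<^sup>2) powr q) \<partial>std_gaussian)"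
    unfolding refresh_def p v by (simp add: scaleR_add_right add.assoc)
  also have "(\<integral>\<^sup>+g. ennreal ((c0 + e * (norm (pos z))\<^sup>2 + (norm ((f *\<^sub>R pos z + (r * eta \<gamma> \<delta>) *\<^sub>R vel z) + ?s *\<^sub>R T g))\<^sup>2) powr q) \<partial>std_gaussian)
    \<le> ennreal ((c0 + e * (norm (pos z))\<^sup>2 + (norm (f *\<^sub>R pos z + (r * eta \<gamma> \<delta>) *\<^sub>R vel z))\<^sup>2 + ?s\<^sup>2 * (real DIM('e) + 2 * q - 2)) powr q)"
    using \<theta>_bounds(1) c0 r by (intro gaussian_powr_mean_le lin adj q) auto
  also have "?s\<^sup>2 * (real DIM('e) + 2 * q - 2) = r\<^sup>2 * \<theta> * dimq q"
    using \<theta>_bounds(1) by (simp add: dimq_def dE[symmetric] power_mult_distrib)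
  finally show ?thesis .
qed

lemma refresh_lyap:
  assumes "1 \<le> q"
  shows "refresh \<gamma> \<delta> (\<lambda>z. ennreal (lyap_z z powr q)) z
    \<le> ennreal ((lyap (pos z) (eta \<gamma> \<delta> *\<^sub>R vel z) + (4 / \<tau>\<^sup>2) * \<theta> * dimq q) powr q)"
  using refresh_powr_le[of q 0 1 "2 / \<tau>" 1 z] assms \<tau>_bounds(1)
  by (simp add: lyap_z_def lyap_def power_divide)

lemma refresh_speed:
  assumes "1 \<le> q"
  shows "refresh \<gamma> \<delta> (\<lambda>z. ennreal (((norm (vel z))\<^sup>2) powr q)) z
    \<le> ennreal (((1 - \<theta>) * (norm (vel z))\<^sup>2 + \<theta> * dimq q) powr q)"
  using refresh_powr_le[of q 0 0 1 0 z] assms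
  by (simp add: power_mult_distrib eta_sq_\<theta>)

lemma refresh_refresh_lyap:
  assumes q: "1 \<le> q"
  shows "refresh \<gamma> \<delta> (refresh \<gamma> \<delta> (\<lambda>z. ennreal (lyap_z z powr q))) z
    \<le> ennreal ((lyap (pos z) ((1 - \<theta>) *\<^sub>R vel z) + (8 / \<tau>\<^sup>2) * \<theta> * dimq q) powr q)"
proof -
  let ?c = "(4 / \<tau>\<^sup>2) * \<theta> * dimq q"
  have c0: "0 \<le> ?c" using \<theta>_bounds dimq_ge[OF q] by simp
  have "refresh \<gamma> \<delta> (refresh \<gamma> \<delta> (\<lambda>z. ennreal (lyap_z z powr q))) z
    \<le> refresh \<gamma> \<delta> (\<lambda>z. ennreal ((?c + 1 * (norm (pos z))\<^sup>2 + (norm (1 *\<^sub>R pos z + (2 / \<tau> * eta \<gamma> \<delta>) *\<^sub>R vel z))\<^sup>2) powr q)) z"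
    using refresh_lyap[OF q] by (intro refresh_mono) (simp add: lyap_def algebra_simps)
  also have "\<dots> \<le> ennreal ((?c + 1 * (norm (pos z))\<^sup>2 + (norm (1 *\<^sub>R pos z + (2 / \<tau> * eta \<gamma> \<delta> * eta \<gamma> \<delta>) *\<^sub>R vel z))\<^sup>2 + (2 / \<tau> * eta \<gamma> \<delta>)\<^sup>2 * \<theta> * dimq q) powr q)"
    using eta_pos \<tau>_bounds(1) by (intro refresh_powr_le q c0) auto
  also have "\<dots> \<le> ennreal ((lyap (pos z) ((1 - \<theta>) *\<^sub>R vel z) + (8 / \<tau>\<^sup>2) * \<theta> * dimq q) powr q)"
  proof (intro ennreal_leI powr_mono2)
    have 1: "(2 / \<tau> * eta \<gamma> \<delta>)\<^sup>2 * \<theta> * dimq q \<le> ?c"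
      using \<theta>_bounds dimq_ge[OF q] by (intro mult_right_mono) (auto simp: power_mult_distrib power_divide eta_sq_\<theta> divide_simps)
    have 2: "2 / \<tau> * eta \<gamma> \<delta> * eta \<gamma> \<delta> = (2 / \<tau>) * (1 - \<theta>)" by (simp add: eta_sq_\<theta>[symmetric] power2_eq_square)
    have 3: "(8 / \<tau>\<^sup>2) * \<theta> * dimq q = ?c + ?c" by simp
    show "?c + 1 * (norm (pos z))\<^sup>2 + (norm (1 *\<^sub>R pos z + (2 / \<tau> * eta \<gamma> \<delta> * eta \<gamma> \<delta>) *\<^sub>R vel z))\<^sup>2 + (2 / \<tau> * eta \<gamma> \<delta>)\<^sup>2 * \<theta> * dimq q
      \<le> lyap (pos z) ((1 - \<theta>) *\<^sub>R vel z) + (8 / \<tau>\<^sup>2) * \<theta> * dimq q"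
      unfolding 2 3 lyap_def scaleR_scaleR scaleR_one using 1 by linarith
  qed (use q c0 \<theta>_bounds dimq_ge[OF q] in auto)
  finally show ?thesis .
qed

lemma refresh_refresh_speed:
  assumes q: "1 \<le> q"
  shows "refresh \<gamma> \<delta> (refresh \<gamma> \<delta> (\<lambda>z. ennreal (((norm (vel z))\<^sup>2) powr q))) z
    \<le> ennreal (((norm ((1 - \<theta>) *\<^sub>R vel z))\<^sup>2 + 2 * \<theta> * dimq q) powr q)"
proof -
  have c0: "0 \<le> \<theta> * dimq q" using \<theta>_bounds dimq_ge[OF q] by simp
  have "refresh \<gamma> \<delta> (refresh \<gamma> \<delta> (\<lambda>z. ennreal (((norm (vel z))\<^sup>2) powr q))) z
    \<le> refresh \<gamma> \<delta> (\<lambda>z. ennreal ((\<theta> * dimq q + 0 * (norm (pos z))\<^sup>2 + (norm (0 *\<^sub>R pos z + eta \<gamma> \<delta> *\<^sub>R vel z))\<^sup>2) powr q)) z"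
    using refresh_speed[OF q] by (intro refresh_mono) (simp add: power_mult_distrib eta_sq_\<theta> algebra_simps)
  also have "\<dots> \<le> ennreal ((\<theta> * dimq q + 0 * (norm (pos z))\<^sup>2 + (norm (0 *\<^sub>R pos z + (eta \<gamma> \<delta> * eta \<gamma> \<delta>) *\<^sub>R vel z))\<^sup>2 + (eta \<gamma> \<delta>)\<^sup>2 * \<theta> * dimq q) powr q)"
    using eta_pos by (intro refresh_powr_le q c0) auto
  also have "\<dots> \<le> ennreal (((norm ((1 - \<theta>) *\<^sub>R vel z))\<^sup>2 + 2 * \<theta> * dimq q) powr q)"
  proof (intro ennreal_leI powr_mono2)
    have "(eta \<gamma> \<delta>)\<^sup>2 * (\<theta> * dimq q) \<le> 1 * (\<theta> * dimq q)"
      using c0 \<theta>_bounds by (intro mult_right_mono) (auto simp: eta_sq_\<theta>)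
    moreover have "eta \<gamma> \<delta> * eta \<gamma> \<delta> = 1 - \<theta>" by (simp add: eta_sq_\<theta>[symmetric] power2_eq_square)
    ultimately show "\<theta> * dimq q + 0 * (norm (pos z))\<^sup>2 + (norm (0 *\<^sub>R pos z + (eta \<gamma> \<delta> * eta \<gamma> \<delta>) *\<^sub>R vel z))\<^sup>2 + (eta \<gamma> \<delta>)\<^sup>2 * \<theta> * dimq q
      \<le> (norm ((1 - \<theta>) *\<^sub>R vel z))\<^sup>2 + 2 * \<theta> * dimq q"
      by (simp add: mult.assoc)
  qed (use q c0 \<theta>_bounds in \<open>auto simp: mult.assoc\<close>)
  finally show ?thesis .
qed

text \<open>8 * 133/132 is rounded up to 121/15, and 1 / \<gamma> = 3 \<kappa> / m.\<close>

lemma noise_le: "(8 / \<tau>\<^sup>2) * \<theta> \<le> (\<kappa> * \<delta>) * (121 / (5 * m))"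
proof -
  have "(8 / \<tau>\<^sup>2) * \<theta> = \<delta> * (8 / \<tau>)" using \<tau>_bounds(1) by (simp add: \<tau>_bounds(2) power2_eq_square)
  also have "\<dots> \<le> \<delta> * ((121 / 15) / \<gamma>)"
    using \<tau>_bounds \<gamma>_pos \<delta>_pos by (intro mult_left_mono) (auto simp: divide_simps)
  also have "\<dots> = (\<kappa> * \<delta>) * (121 / (5 * m))" using m_pos \<gamma>_pos by (simp add: \<kappa>_def kappa_def)
  finally show ?thesis .
qed

text \<open>The Gaussian bound keeps the power outside, so convexity of the power applies to the
  contraction inequality itself. Hence the rate \<kappa> \<delta> is the same for every q, and the
  dimension appears only through \<open>dimq q\<close> inside the power.\<close>

lemma drift_lyap:
  assumes q: "1 \<le> q"
  shows "refresh \<gamma> \<delta> (refresh \<gamma> \<delta> (\<lambda>z. ennreal (lyap_z z powr q))) (verlet U \<delta> z)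
    \<le> ennreal (1 - \<kappa> * \<delta>) * ennreal (lyap_z z powr q) + ennreal (\<kappa> * \<delta>) * ennreal ((121 / (5 * m) * dimq q) powr q)"
proof -
  let ?l = "\<kappa> * \<delta>"
  have l: "0 \<le> ?l" "?l \<le> 1" using \<kappa>_bounds \<delta>_pos by auto
  have "refresh \<gamma> \<delta> (refresh \<gamma> \<delta> (\<lambda>z. ennreal (lyap_z z powr q))) (verlet U \<delta> z)
    \<le> ennreal ((lyap (pos (verlet U \<delta> z)) ((1 - \<theta>) *\<^sub>R vel (verlet U \<delta> z)) + (8 / \<tau>\<^sup>2) * \<theta> * dimq q) powr q)"
    by (rule refresh_refresh_lyap[OF q])
  also have "\<dots> \<le> ennreal (((1 - ?l) * lyap_z z + ?l * (121 / (5 * m) * dimq q)) powr q)"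
  proof (intro ennreal_leI powr_mono2 add_mono lyap_verlet)
    show "8 / \<tau>\<^sup>2 * \<theta> * dimq q \<le> ?l * (121 / (5 * m) * dimq q)"
      using mult_right_mono[OF noise_le, of "dimq q"] dimq_ge[OF q] by (simp add: mult.assoc)
    show "0 \<le> lyap (pos (verlet U \<delta> z)) ((1 - \<theta>) *\<^sub>R vel (verlet U \<delta> z)) + 8 / \<tau>\<^sup>2 * \<theta> * dimq q"
      using lyap_nonneg \<theta>_bounds dimq_ge[OF q] by (intro add_nonneg_nonneg mult_nonneg_nonneg) auto
  qed (use q in auto)
  also have "\<dots> \<le> ennreal ((1 - ?l) * lyap_z z powr q + ?l * (121 / (5 * m) * dimq q) powr q)"
    using l q m_pos dimq_ge[OF q] lyap_nonneg by (intro ennreal_leI powr_convex_comb) (auto simp: lyap_z_def)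
  also have "\<dots> = ennreal (1 - ?l) * ennreal (lyap_z z powr q) + ennreal ?l * ennreal ((121 / (5 * m) * dimq q) powr q)"
    using l by (simp add: ennreal_plus ennreal_mult)
  finally show ?thesis .
qed

lemma init_lyap:
  assumes q: "1 \<le> q"
  shows "refresh \<gamma> \<delta> (\<lambda>z. ennreal (lyap_z z powr q)) z
    \<le> ennreal (1 - \<kappa> * \<delta>) * (ennreal ((401 / 100 + 77 / (50 * L)) powr q) * ennreal (((norm (pos z))\<^sup>2 + (norm (vel z))\<^sup>2) powr q))
      + ennreal (\<kappa> * \<delta>) * ennreal ((121 / (5 * m) * dimq q) powr q)"
proof -
  let ?l = "\<kappa> * \<delta>" and ?y = "lyap (pos z) (eta \<gamma> \<delta> *\<^sub>R vel z)"
  have l: "0 \<le> ?l" "?l < 1" using \<kappa>_bounds \<delta>_pos by auto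
  have "refresh \<gamma> \<delta> (\<lambda>z. ennreal (lyap_z z powr q)) z \<le> ennreal ((?y + (4 / \<tau>\<^sup>2) * \<theta> * dimq q) powr q)"
    by (rule refresh_lyap[OF q])
  also have "\<dots> \<le> ennreal (((1 - ?l) * (?y / (1 - ?l)) + ?l * (121 / (5 * m) * dimq q)) powr q)"
  proof (intro ennreal_leI powr_mono2 add_mono)
    have "4 / \<tau>\<^sup>2 * \<theta> * dimq q \<le> 8 / \<tau>\<^sup>2 * \<theta> * dimq q"
      using \<theta>_bounds dimq_ge[OF q] by (intro mult_right_mono) (auto simp: divide_right_mono)
    also have "\<dots> \<le> ?l * (121 / (5 * m) * dimq q)"
      using mult_right_mono[OF noise_le, of "dimq q"] dimq_ge[OF q] by (simp add: mult.assoc)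
    finally show "4 / \<tau>\<^sup>2 * \<theta> * dimq q \<le> ?l * (121 / (5 * m) * dimq q)" .
    show "0 \<le> ?y + 4 / \<tau>\<^sup>2 * \<theta> * dimq q"
      using lyap_nonneg \<theta>_bounds dimq_ge[OF q] by (intro add_nonneg_nonneg mult_nonneg_nonneg) auto
  qed (use q l in auto)
  also have "\<dots> \<le> ennreal ((1 - ?l) * (?y / (1 - ?l)) powr q + ?l * (121 / (5 * m) * dimq q) powr q)"
    using l q m_pos dimq_ge[OF q] lyap_nonneg by (intro ennreal_leI powr_convex_comb divide_nonneg_nonneg) auto
  also have "\<dots> \<le> ennreal ((1 - ?l) * ((401 / 100 + 77 / (50 * L)) * ((norm (pos z))\<^sup>2 + (norm (vel z))\<^sup>2)) powr q + ?l * (121 / (5 * m) * dimq q) powr q)"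
    using lyap_initial[of "pos z" "vel z"] l q lyap_nonneg[of "pos z" "eta \<gamma> \<delta> *\<^sub>R vel z"]
    by (intro ennreal_leI add_right_mono mult_left_mono powr_mono2) auto
  also have "\<dots> = ennreal (1 - ?l) * (ennreal ((401 / 100 + 77 / (50 * L)) powr q) * ennreal (((norm (pos z))\<^sup>2 + (norm (vel z))\<^sup>2) powr q))
      + ennreal ?l * ennreal ((121 / (5 * m) * dimq q) powr q)"
    using l L_pos by (simp add: ennreal_plus ennreal_mult powr_mult)
  finally show ?thesis .
qed

lemma drift_speed:
  assumes q: "1 \<le> q"
  shows "refresh \<gamma> \<delta> (refresh \<gamma> \<delta> (\<lambda>z. ennreal (((norm (vel z))\<^sup>2) powr q))) (verlet U \<delta> z)
    \<le> ennreal (1 - \<theta>) * ennreal (((norm (vel z))\<^sup>2) powr q) + ennreal \<theta> * ennreal ((13 / 50 * L * lyap_z z + 2 * dimq q) powr q)"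
proof -
  have "refresh \<gamma> \<delta> (refresh \<gamma> \<delta> (\<lambda>z. ennreal (((norm (vel z))\<^sup>2) powr q))) (verlet U \<delta> z)
    \<le> ennreal (((norm ((1 - \<theta>) *\<^sub>R vel (verlet U \<delta> z)))\<^sup>2 + 2 * \<theta> * dimq q) powr q)"
    by (rule refresh_refresh_speed[OF q])
  also have "\<dots> \<le> ennreal (((1 - \<theta>) * (norm (vel z))\<^sup>2 + \<theta> * (13 / 50 * L * lyap_z z + 2 * dimq q)) powr q)"
    using q vel_sq_verlet[of z] \<theta>_bounds dimq_ge[OF q]
    by (intro ennreal_leI powr_mono2) (auto simp: distrib_left intro!: add_nonneg_nonneg mult_nonneg_nonneg)
  also have "\<dots> \<le> ennreal ((1 - \<theta>) * ((norm (vel z))\<^sup>2) powr q + \<theta> * (13 / 50 * L * lyap_z z + 2 * dimq q) powr q)"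
    using \<theta>_bounds q L_pos dimq_ge[OF q] lyap_nonneg[of "pos z" "vel z"]
    by (intro ennreal_leI powr_convex_comb) (auto simp: lyap_z_def)
  also have "\<dots> = ennreal (1 - \<theta>) * ennreal (((norm (vel z))\<^sup>2) powr q) + ennreal \<theta> * ennreal ((13 / 50 * L * lyap_z z + 2 * dimq q) powr q)"
    using \<theta>_bounds by (simp add: ennreal_plus ennreal_mult)
  finally show ?thesis .
qed

lemma init_speed:
  assumes q: "1 \<le> q"
  shows "refresh \<gamma> \<delta> (\<lambda>z. ennreal (((norm (vel z))\<^sup>2) powr q)) z
    \<le> ennreal (1 - \<theta>) * ennreal (((norm (pos z))\<^sup>2 + (norm (vel z))\<^sup>2) powr q) + ennreal \<theta> * ennreal (dimq q powr q)"
proof -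
  have "refresh \<gamma> \<delta> (\<lambda>z. ennreal (((norm (vel z))\<^sup>2) powr q)) z \<le> ennreal (((1 - \<theta>) * (norm (vel z))\<^sup>2 + \<theta> * dimq q) powr q)"
    by (rule refresh_speed[OF q])
  also have "\<dots> \<le> ennreal ((1 - \<theta>) * ((norm (vel z))\<^sup>2) powr q + \<theta> * dimq q powr q)"
    using \<theta>_bounds q dimq_ge[OF q] by (intro ennreal_leI powr_convex_comb) auto
  also have "\<dots> \<le> ennreal ((1 - \<theta>) * ((norm (pos z))\<^sup>2 + (norm (vel z))\<^sup>2) powr q + \<theta> * dimq q powr q)"
    using \<theta>_bounds q by (intro ennreal_leI add_right_mono mult_left_mono powr_mono2) auto
  also have "\<dots> = ennreal (1 - \<theta>) * ennreal (((norm (pos z))\<^sup>2 + (norm (vel z))\<^sup>2) powr q) + ennreal \<theta> * ennreal (dimq q powr q)"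
    using \<theta>_bounds by (simp add: ennreal_plus ennreal_mult)
  finally show ?thesis .
qed

end

section \<open>Moments along the chain\<close>

text \<open>The average after k full steps and one further refreshment, the point where the next
  Verlet step is proposed and accepted or rejected. From one such point to the next the chain
  performs a Verlet step and then two refreshments, see \<open>mean_at_Suc\<close>.\<close>

definition mean_at :: "(real ^ 'n \<Rightarrow> real) \<Rightarrow> real \<Rightarrow> real \<Rightarrow> ('n::finite) phase measure \<Rightarrow> nat \<Rightarrow> ('n phase \<Rightarrow> ennreal) \<Rightarrow> ennreal" where
  "mean_at U \<gamma> \<delta> \<nu> k f = (\<integral>\<^sup>+z. refresh \<gamma> \<delta> f z \<partial>law_after (obabo_kernel U \<gamma> \<delta>) k \<nu>)"

lemma mean_at_0: "mean_at U \<gamma> \<delta> \<nu> 0 f = (\<integral>\<^sup>+z. refresh \<gamma> \<delta> f z \<partial>\<nu>)"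
  by (simp add: mean_at_def law_after_def)

lemma ennreal_lin:
  "0 \<le> a \<Longrightarrow> 0 \<le> b \<Longrightarrow> 0 \<le> x \<Longrightarrow> 0 \<le> y \<Longrightarrow> ennreal (a * x + b * y) = ennreal a * ennreal x + ennreal b * ennreal y"
  by (simp add: ennreal_plus ennreal_mult)

lemma ennreal_divide_mult_cancel: "0 \<le> a \<Longrightarrow> 0 < b \<Longrightarrow> ennreal (a / b) * (ennreal b * X) = ennreal a * X"
  by (simp add: mult.assoc[symmetric] ennreal_mult[symmetric])

lemma sum_const_ennreal: "(\<Sum>k<(n::nat). ennreal b) = ennreal (real n * b)"
  by (simp add: ennreal_mult' ennreal_of_nat_eq_real_of_nat)

context
  fixes U :: "real ^ 'n::finite \<Rightarrow> real" and \<gamma> \<delta> :: real and \<nu> :: "'n phase measure"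
  assumes grad_meas[measurable]: "grad U \<in> borel_measurable borel"
    and U_meas[measurable]: "U \<in> borel_measurable borel"
    and \<nu>: "prob_space \<nu>" "sets \<nu> = sets borel"
begin

lemma sets_law[measurable_cong]: "sets (law_after (obabo_kernel U \<gamma> \<delta>) k \<nu>) = sets borel"
  and prob_law: "prob_space (law_after (obabo_kernel U \<gamma> \<delta>) k \<nu>)"
  using law_after_prob[OF measurable_obabo_kernel prob_space_obabo_kernel \<nu>] grad_meas U_meas by blast+

lemma mean_at_mono: "(\<And>z. f z \<le> g z) \<Longrightarrow> mean_at U \<gamma> \<delta> \<nu> k f \<le> mean_at U \<gamma> \<delta> \<nu> k g"
  unfolding mean_at_def by (intro nn_integral_mono refresh_mono)

lemma mean_at_const: "mean_at U \<gamma> \<delta> \<nu> k (\<lambda>_. c) = c"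
  using prob_space.emeasure_space_1[OF prob_law] by (simp add: mean_at_def refresh_const)

lemma mean_at_add:
  assumes [measurable]: "f \<in> borel_measurable borel" "g \<in> borel_measurable borel"
  shows "mean_at U \<gamma> \<delta> \<nu> k (\<lambda>z. f z + g z) = mean_at U \<gamma> \<delta> \<nu> k f + mean_at U \<gamma> \<delta> \<nu> k g"
proof -
  have "refresh \<gamma> \<delta> (\<lambda>z. f z + g z) = (\<lambda>z. refresh \<gamma> \<delta> f z + refresh \<gamma> \<delta> g z)"
    by (intro ext refresh_add) measurable
  then show ?thesis unfolding mean_at_def by (simp add: nn_integral_add)
qed

lemma mean_at_cmult:
  assumes [measurable]: "f \<in> borel_measurable borel"
  shows "mean_at U \<gamma> \<delta> \<nu> k (\<lambda>z. c * f z) = c * mean_at U \<gamma> \<delta> \<nu> k f"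
proof -
  have "refresh \<gamma> \<delta> (\<lambda>z. c * f z) = (\<lambda>z. c * refresh \<gamma> \<delta> f z)"
    by (intro ext refresh_cmult) measurable
  then show ?thesis unfolding mean_at_def by (simp add: nn_integral_cmult)
qed

lemma mean_at_lin:
  assumes [measurable]: "f \<in> borel_measurable borel" "g \<in> borel_measurable borel"
  shows "mean_at U \<gamma> \<delta> \<nu> k (\<lambda>z. a * f z + b * g z) = a * mean_at U \<gamma> \<delta> \<nu> k f + b * mean_at U \<gamma> \<delta> \<nu> k g"
  by (subst mean_at_add) (auto simp: mean_at_cmult)

lemma mean_at_sum:
  assumes "finite I" "\<And>i. i \<in> I \<Longrightarrow> f i \<in> borel_measurable borel"
  shows "mean_at U \<gamma> \<delta> \<nu> k (\<lambda>z. \<Sum>i\<in>I. f i z) = (\<Sum>i\<in>I. mean_at U \<gamma> \<delta> \<nu> k (f i))"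
  using assms
proof (induction I rule: finite_induct)
  case empty
  then show ?case by (simp add: mean_at_const)
next
  case (insert i I)
  have "(\<lambda>z. \<Sum>i\<in>I. f i z) \<in> borel_measurable borel" using insert by (intro borel_measurable_sum) auto
  then show ?case using insert by (simp add: mean_at_add)
qed

lemma mean_at_Suc:
  assumes [measurable]: "f \<in> borel_measurable borel"
  shows "mean_at U \<gamma> \<delta> \<nu> (Suc k) f = mean_at U \<gamma> \<delta> \<nu> k (\<lambda>y. refresh \<gamma> \<delta> (refresh \<gamma> \<delta> f) (verlet U \<delta> y))"
  unfolding mean_at_def
  by (subst nn_integral_law_after_Suc[OF measurable_obabo_kernel prob_space_obabo_kernel \<nu>])
    (use grad_meas U_meas in \<open>auto simp: nn_integral_obabo_kernel\<close>)

end

context obabo_projection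
begin

definition zsq :: "'n phase \<Rightarrow> real" where "zsq z = (norm (pos z))\<^sup>2 + (norm (vel z))\<^sup>2"

lemma measurable_zsq[measurable]: "zsq \<in> borel_measurable borel"
  unfolding zsq_def[abs_def] by measurable

lemma zsq_nonneg: "0 \<le> zsq z" by (simp add: zsq_def)

text \<open>The q-th powers of \<open>\<alpha>1\<close>, \<open>\<beta>1\<close> and
  \<open>R1\<close> bound the summed q-th powers of the twisted norm, of |v|^2 and of the squared
  distance to the minimiser. \<open>\<alpha>0\<close> comes from \<open>lyap_initial\<close>, 121 /
  (5 m) from \<open>noise_le\<close>, and the 2 in \<open>\<beta>1\<close> from the noise of two
  refreshments.\<close>

definition \<alpha>0 :: real where "\<alpha>0 = 401 / 100 + 77 / (50 * L)"
definition \<alpha>1 :: real where "\<alpha>1 = \<alpha>0 + 121 / (5 * m)"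

lemma \<alpha>0_pos: "0 < \<alpha>0" and \<alpha>1_pos: "0 < \<alpha>1" and \<alpha>_le: "\<alpha>0 \<le> \<alpha>1" "121 / (5 * m) \<le> \<alpha>1"
  using L_pos m_pos by (auto simp: \<alpha>0_def \<alpha>1_def intro!: add_pos_pos)

definition \<beta>1 :: real where "\<beta>1 = 13 / 50 * L * \<alpha>1 + 2"

lemma \<beta>1_ge: "2 \<le> \<beta>1" using L_pos \<alpha>1_pos by (simp add: \<beta>1_def)

definition R1 :: real where "R1 = 12 / 11 * (\<alpha>1 + \<beta>1)"

context
  fixes \<nu> :: "'n phase measure" and q :: real
  assumes \<nu>: "prob_space \<nu>" "sets \<nu> = sets borel" and q: "1 \<le> q"
begin

interpretation prob_space \<nu> by (rule \<nu>)

lemmas [measurable_cong] = \<nu>(2)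

abbreviation mean where "mean \<equiv> mean_at U \<gamma> \<delta> \<nu>"
abbreviation Dq where "Dq \<equiv> dimq q powr q"
abbreviation M0 where "M0 \<equiv> (\<integral>\<^sup>+z. ennreal (zsq z powr q) \<partial>\<nu>)"

lemmas mean_rules = mean_at_const[OF measurable_U \<nu>] mean_at_mono[OF measurable_U \<nu>]
  mean_at_lin[OF measurable_U \<nu>] mean_at_cmult[OF measurable_U \<nu>] mean_at_add[OF measurable_U \<nu>] mean_at_Suc[OF measurable_U \<nu>]

lemma nu_lin_const:
  assumes [measurable]: "f \<in> borel_measurable borel"
  shows "(\<integral>\<^sup>+z. a * f z + b \<partial>\<nu>) = a * (\<integral>\<^sup>+z. f z \<partial>\<nu>) + (b :: ennreal)"
  by (subst nn_integral_add) (auto simp: nn_integral_cmult emeasure_space_1)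

lemma sum_lyap:
  "(\<Sum>k<n. mean k (\<lambda>z. ennreal (lyap_z z powr q)))
    \<le> ennreal (\<alpha>1 powr q) * (ennreal (1 / (\<kappa> * \<delta>)) * M0 + ennreal (real n * Dq))"
proof -
  let ?C = "ennreal ((121 / (5 * m) * dimq q) powr q)"
  have "(\<Sum>k<n. mean k (\<lambda>z. ennreal (lyap_z z powr q)))
     \<le> ennreal (1 / (\<kappa> * \<delta>)) * (ennreal (\<alpha>0 powr q) * M0) + (\<Sum>k<n. ?C)"
  proof (rule sum_le_of_contraction)
    show "0 < \<kappa> * \<delta>" "\<kappa> * \<delta> < 1" using \<kappa>_bounds \<delta>_pos by auto
    have "mean 0 (\<lambda>z. ennreal (lyap_z z powr q)) \<le> (\<integral>\<^sup>+z. (ennreal (1 - \<kappa> * \<delta>) * ennreal (\<alpha>0 powr q)) * ennreal (zsq z powr q) + ennreal (\<kappa> * \<delta>) * ?C \<partial>\<nu>)"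
      unfolding mean_at_0
      using init_lyap[OF q] by (intro nn_integral_mono) (simp add: \<alpha>0_def zsq_def mult.assoc)
    also have "\<dots> = (ennreal (1 - \<kappa> * \<delta>) * ennreal (\<alpha>0 powr q)) * M0 + ennreal (\<kappa> * \<delta>) * ?C"
      by (rule nu_lin_const) measurable
    finally show "mean 0 (\<lambda>z. ennreal (lyap_z z powr q)) \<le> ennreal (1 - \<kappa> * \<delta>) * (ennreal (\<alpha>0 powr q) * M0) + ennreal (\<kappa> * \<delta>) * ?C"
      by (simp only: mult.assoc)
    fix k
    have "mean (Suc k) (\<lambda>z. ennreal (lyap_z z powr q))
      \<le> mean k (\<lambda>z. ennreal (1 - \<kappa> * \<delta>) * ennreal (lyap_z z powr q) + ennreal (\<kappa> * \<delta>) * ?C)"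
      by (subst mean_rules(6), measurable) (intro mean_rules(2) drift_lyap q)
    also have "\<dots> = ennreal (1 - \<kappa> * \<delta>) * mean k (\<lambda>z. ennreal (lyap_z z powr q)) + ennreal (\<kappa> * \<delta>) * ?C"
      by (simp add: mean_rules)
    finally show "mean (Suc k) (\<lambda>z. ennreal (lyap_z z powr q))
      \<le> ennreal (1 - \<kappa> * \<delta>) * mean k (\<lambda>z. ennreal (lyap_z z powr q)) + ennreal (\<kappa> * \<delta>) * ?C" .
  qed
  also have "\<dots> \<le> ennreal (1 / (\<kappa> * \<delta>)) * (ennreal (\<alpha>1 powr q) * M0) + ennreal (\<alpha>1 powr q) * ennreal (real n * Dq)"
  proof (intro add_mono mult_left_mono mult_right_mono ennreal_leI powr_mono2)
    have "?C \<le> ennreal (\<alpha>1 powr q * Dq)"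
      using \<alpha>_le m_pos q dimq_ge[OF q] by (subst powr_mult) (auto intro!: ennreal_leI mult_right_mono powr_mono2)
    then have "(\<Sum>k<n. ?C) \<le> (\<Sum>k<n. ennreal (\<alpha>1 powr q * Dq))" by (intro sum_mono)
    also have "\<dots> = ennreal (real n * (\<alpha>1 powr q * Dq))"
      by (simp add: ennreal_mult ennreal_of_nat_eq_real_of_nat)
    also have "\<dots> = ennreal (\<alpha>1 powr q) * ennreal (real n * Dq)"
      by (simp add: ennreal_mult[symmetric] mult_ac)
    finally show "(\<Sum>k<n. ?C) \<le> ennreal (\<alpha>1 powr q) * ennreal (real n * Dq)" .
  qed (use \<alpha>_le \<alpha>0_pos q in auto)
  also have "\<dots> = ennreal (\<alpha>1 powr q) * (ennreal (1 / (\<kappa> * \<delta>)) * M0 + ennreal (real n * Dq))"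
    by (simp add: distrib_left mult_ac)
  finally show ?thesis .
qed

text \<open>The weights in \<open>powr_weighted_sum_le\<close> are the constants that the two
  summands carry relative to the common bound \<open>?T\<close>, namely 13/50 L \<alpha>1 and 2;
  they add up to \<open>\<beta>1\<close>.\<close>

lemma sum_speed_source:
  "(\<Sum>k<n. mean k (\<lambda>z. ennreal ((13 / 50 * L * lyap_z z + 2 * dimq q) powr q)))
    \<le> ennreal (\<beta>1 powr q) * (ennreal (1 / (\<kappa> * \<delta>)) * M0 + ennreal (real n * Dq))"
proof -
  let ?b = "13 / 50 * L * \<alpha>1" and ?T = "ennreal (1 / (\<kappa> * \<delta>)) * M0 + ennreal (real n * Dq)"
  have b: "0 < ?b" "?b + 2 = \<beta>1" using L_pos \<alpha>1_pos by (auto simp: \<beta>1_def)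
  let ?p = "\<beta>1 powr q * (?b / \<beta>1)" and ?r = "\<beta>1 powr q * (2 / \<beta>1)"
  have pr: "0 \<le> ?p" "0 \<le> ?r" "?p + ?r = \<beta>1 powr q"
  proof -
    show "0 \<le> ?p" "0 \<le> ?r" using b \<beta>1_ge by auto
    have "?p + ?r = \<beta>1 powr q * ((?b + 2) / \<beta>1)" by (simp only: distrib_left add_divide_distrib)
    then show "?p + ?r = \<beta>1 powr q" using b \<beta>1_ge by simp
  qed
  have pt: "ennreal ((13 / 50 * L * lyap_z z + 2 * dimq q) powr q)
     \<le> ennreal (?p / \<alpha>1 powr q) * ennreal (lyap_z z powr q) + ennreal ?r * ennreal Dq" for z
  proof -
    let ?w = "lyap_z z"
    have w: "0 \<le> ?w" using lyap_nonneg by (simp add: lyap_z_def)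
    have "(13 / 50 * L * ?w + 2 * dimq q) powr q \<le> (?b + 2) powr q *
      (?b / (?b + 2) * ((13 / 50 * L * ?w) powr q / ?b powr q) + 2 / (?b + 2) * ((2 * dimq q) powr q / 2 powr q))"
      using w L_pos dimq_ge[OF q] b q by (intro powr_weighted_sum_le) auto
    also have "(13 / 50 * L * ?w) powr q / ?b powr q = ?w powr q / \<alpha>1 powr q"
    proof -
      have "(13 / 50 * L * y) powr q = (13 / 50 * L) powr q * y powr q" if "0 \<le> y" for y
        using that L_pos powr_mult[of "13 / 50 * L" y q] by simp
      moreover have "0 < (13 / 50 * L) powr q" using L_pos by simp
      ultimately show ?thesis using w \<alpha>1_pos by simp
    qed
    also have "(2 * dimq q) powr q / 2 powr q = Dq" using dimq_ge[OF q] by (simp add: powr_mult)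
    finally have "(13 / 50 * L * ?w + 2 * dimq q) powr q \<le> (?p / \<alpha>1 powr q) * ?w powr q + ?r * Dq"
      unfolding b(2) by (simp add: distrib_left mult_ac)
    then have "ennreal ((13 / 50 * L * ?w + 2 * dimq q) powr q) \<le> ennreal ((?p / \<alpha>1 powr q) * ?w powr q + ?r * Dq)"
      by (rule ennreal_leI)
    also have "\<dots> = ennreal (?p / \<alpha>1 powr q) * ennreal (?w powr q) + ennreal ?r * ennreal Dq"
      using pr \<alpha>1_pos \<beta>1_ge w by (intro ennreal_lin divide_nonneg_nonneg) auto
    finally show ?thesis .
  qed
  have "(\<Sum>k<n. mean k (\<lambda>z. ennreal ((13 / 50 * L * lyap_z z + 2 * dimq q) powr q)))
    \<le> (\<Sum>k<n. ennreal (?p / \<alpha>1 powr q) * mean k (\<lambda>z. ennreal (lyap_z z powr q)) + ennreal ?r * ennreal Dq)"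
  proof (rule sum_mono)
    fix k
    have "mean k (\<lambda>z. ennreal ((13 / 50 * L * lyap_z z + 2 * dimq q) powr q))
      \<le> mean k (\<lambda>z. ennreal (?p / \<alpha>1 powr q) * ennreal (lyap_z z powr q) + ennreal ?r * ennreal Dq)"
      by (intro mean_rules(2) pt)
    also have "\<dots> = ennreal (?p / \<alpha>1 powr q) * mean k (\<lambda>z. ennreal (lyap_z z powr q)) + ennreal ?r * ennreal Dq"
      by (simp add: mean_rules)
    finally show "mean k (\<lambda>z. ennreal ((13 / 50 * L * lyap_z z + 2 * dimq q) powr q))
      \<le> ennreal (?p / \<alpha>1 powr q) * mean k (\<lambda>z. ennreal (lyap_z z powr q)) + ennreal ?r * ennreal Dq" .
  qed
  also have "\<dots> = ennreal (?p / \<alpha>1 powr q) * (\<Sum>k<n. mean k (\<lambda>z. ennreal (lyap_z z powr q))) + ennreal ?r * ennreal (real n * Dq)"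
    by (simp only: sum.distrib sum_distrib_left[symmetric] sum_const_ennreal)
  also have "\<dots> \<le> ennreal (?p / \<alpha>1 powr q) * (ennreal (\<alpha>1 powr q) * ?T) + ennreal ?r * ?T"
    by (intro add_mono mult_left_mono sum_lyap) auto
  also have "\<dots> = (ennreal ?p + ennreal ?r) * ?T"
    using \<alpha>1_pos ennreal_divide_mult_cancel[OF pr(1), of "\<alpha>1 powr q" ?T] by (simp only: distrib_right) simp
  also have "ennreal ?p + ennreal ?r = ennreal (\<beta>1 powr q)" using pr by (simp add: ennreal_plus[symmetric] del: ennreal_plus)
  finally show ?thesis .
qed

lemma sum_speed:
  "(\<Sum>k<n. mean k (\<lambda>z. ennreal (((norm (vel z))\<^sup>2) powr q)))
    \<le> ennreal (\<beta>1 powr q) * (ennreal (1 / \<theta>) * M0 + (ennreal (1 / (\<kappa> * \<delta>)) * M0 + ennreal (real n * Dq)))"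
proof -
  \<comment> \<open>The source of step k + 1 is an average at time k, hence the shift; entry 0 is
    the noise of the initial refreshment.\<close>
  define C where "C k = (case k of 0 \<Rightarrow> ennreal Dq | Suc j \<Rightarrow> mean j (\<lambda>z. ennreal ((13 / 50 * L * lyap_z z + 2 * dimq q) powr q)))" for k
  have "(\<Sum>k<n. mean k (\<lambda>z. ennreal (((norm (vel z))\<^sup>2) powr q))) \<le> ennreal (1 / \<theta>) * M0 + (\<Sum>k<n. C k)"
  proof (rule sum_le_of_contraction)
    show "0 < \<theta>" "\<theta> < 1" using \<theta>_bounds by auto
    have "mean 0 (\<lambda>z. ennreal (((norm (vel z))\<^sup>2) powr q)) \<le> (\<integral>\<^sup>+z. ennreal (1 - \<theta>) * ennreal (zsq z powr q) + ennreal \<theta> * ennreal Dq \<partial>\<nu>)"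
      unfolding mean_at_0
      using init_speed[OF q] by (intro nn_integral_mono) (simp add: zsq_def)
    then show "mean 0 (\<lambda>z. ennreal (((norm (vel z))\<^sup>2) powr q)) \<le> ennreal (1 - \<theta>) * M0 + ennreal \<theta> * C 0"
      by (simp add: nu_lin_const C_def)
    fix k
    have "mean (Suc k) (\<lambda>z. ennreal (((norm (vel z))\<^sup>2) powr q))
      \<le> mean k (\<lambda>z. ennreal (1 - \<theta>) * ennreal (((norm (vel z))\<^sup>2) powr q) + ennreal \<theta> * ennreal ((13 / 50 * L * lyap_z z + 2 * dimq q) powr q))"
      by (subst mean_rules(6), measurable) (intro mean_rules(2) drift_speed q)
    also have "\<dots> = ennreal (1 - \<theta>) * mean k (\<lambda>z. ennreal (((norm (vel z))\<^sup>2) powr q)) + ennreal \<theta> * C (Suc k)"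
      by (simp add: mean_rules C_def)
    finally show "mean (Suc k) (\<lambda>z. ennreal (((norm (vel z))\<^sup>2) powr q))
      \<le> ennreal (1 - \<theta>) * mean k (\<lambda>z. ennreal (((norm (vel z))\<^sup>2) powr q)) + ennreal \<theta> * C (Suc k)" .
  qed
  also have "(\<Sum>k<n. C k) \<le> ennreal (\<beta>1 powr q) * (ennreal (1 / (\<kappa> * \<delta>)) * M0 + ennreal (real n * Dq))"
  proof (cases n)
    case (Suc j)
    \<comment> \<open>Only n - 1 averages occur among n entries, so the noise of entry 0 completes
      the count to n.\<close>
    have "(\<Sum>k<n. C k) = ennreal Dq + (\<Sum>k<j. mean k (\<lambda>z. ennreal ((13 / 50 * L * lyap_z z + 2 * dimq q) powr q)))"
      unfolding Suc sum.lessThan_Suc_shift by (simp add: C_def)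
    also have "\<dots> \<le> ennreal (\<beta>1 powr q) * ennreal Dq + ennreal (\<beta>1 powr q) * (ennreal (1 / (\<kappa> * \<delta>)) * M0 + ennreal (real j * Dq))"
    proof (intro add_mono sum_speed_source)
      have "1 \<le> \<beta>1 powr q" using \<beta>1_ge q by (intro ge_one_powr_ge_zero) auto
      then have "1 * ennreal Dq \<le> ennreal (\<beta>1 powr q) * ennreal Dq" by (intro mult_right_mono) auto
      then show "ennreal Dq \<le> ennreal (\<beta>1 powr q) * ennreal Dq" by simp
    qed
    also have "\<dots> = ennreal (\<beta>1 powr q) * (ennreal (1 / (\<kappa> * \<delta>)) * M0 + (ennreal Dq + ennreal (real j * Dq)))"
      by (simp add: distrib_left ac_simps)
    also have "ennreal Dq + ennreal (real j * Dq) = ennreal (real n * Dq)"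
      using dimq_ge[OF q] by (simp add: Suc ennreal_plus[symmetric] algebra_simps del: ennreal_plus)
    finally show ?thesis .
  qed simp
  also have "ennreal (1 / \<theta>) * M0 \<le> ennreal (\<beta>1 powr q) * (ennreal (1 / \<theta>) * M0)"
  proof -
    have "1 \<le> \<beta>1 powr q" using \<beta>1_ge q by (intro ge_one_powr_ge_zero) auto
    then have "1 * (ennreal (1 / \<theta>) * M0) \<le> ennreal (\<beta>1 powr q) * (ennreal (1 / \<theta>) * M0)" by (intro mult_right_mono) auto
    then show ?thesis by simp
  qed
  finally show ?thesis by (simp add: distrib_left)
qed

text \<open>|x|^2 is a part of the twisted norm and |v|^2 has been summed by its own recursion;
  Jensen with weights \<alpha>1 and \<beta>1 puts them together.\<close>

lemma moment_sum:
  "(\<Sum>k<n. mean k (\<lambda>z. ennreal (zsq z powr q)))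
    \<le> ennreal (R1 powr q) * (ennreal (1 + 1 / \<kappa>) * (ennreal (1 / \<delta>) * M0 + ennreal (real n * Dq)))"
proof -
  let ?T1 = "ennreal (1 / (\<kappa> * \<delta>)) * M0 + ennreal (real n * Dq)"
  let ?T = "ennreal (1 / \<theta>) * M0 + ?T1"
  let ?s = "\<alpha>1 + \<beta>1"
  have s: "0 < ?s" using \<alpha>1_pos \<beta>1_ge by linarith
  let ?p = "?s powr q * (\<alpha>1 / ?s)" and ?r = "?s powr q * (\<beta>1 / ?s)"
  have pr: "0 \<le> ?p" "0 \<le> ?r" "?p + ?r = ?s powr q"
  proof -
    show "0 \<le> ?p" "0 \<le> ?r" using s \<alpha>1_pos \<beta>1_ge by auto
    have "?p + ?r = ?s powr q * (?s / ?s)" by (simp only: distrib_left add_divide_distrib)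
    then show "?p + ?r = ?s powr q" using s by simp
  qed
  have pt: "ennreal (zsq z powr q)
     \<le> ennreal (?p / \<alpha>1 powr q) * ennreal (lyap_z z powr q) + ennreal (?r / \<beta>1 powr q) * ennreal (((norm (vel z))\<^sup>2) powr q)" for z
  proof -
    have w: "0 \<le> lyap_z z" using lyap_nonneg by (simp add: lyap_z_def)
    have "zsq z powr q \<le> (lyap_z z + (norm (vel z))\<^sup>2) powr q"
      using norm_sq_le_lyap[of "pos z" "vel z"] q by (intro powr_mono2) (auto simp: zsq_def lyap_z_def)
    also have "\<dots> \<le> ?s powr q * (\<alpha>1 / ?s * (lyap_z z powr q / \<alpha>1 powr q) + \<beta>1 / ?s * (((norm (vel z))\<^sup>2) powr q / \<beta>1 powr q))"
      using lyap_nonneg \<alpha>1_pos \<beta>1_ge q by (intro powr_weighted_sum_le) (auto simp: lyap_z_def)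
    also have "\<dots> = (?p / \<alpha>1 powr q) * lyap_z z powr q + (?r / \<beta>1 powr q) * ((norm (vel z))\<^sup>2) powr q"
      by (simp add: distrib_left)
    finally have "ennreal (zsq z powr q) \<le> ennreal ((?p / \<alpha>1 powr q) * lyap_z z powr q + (?r / \<beta>1 powr q) * ((norm (vel z))\<^sup>2) powr q)"
      by (rule ennreal_leI)
    also have "\<dots> = ennreal (?p / \<alpha>1 powr q) * ennreal (lyap_z z powr q) + ennreal (?r / \<beta>1 powr q) * ennreal (((norm (vel z))\<^sup>2) powr q)"
      using pr \<alpha>1_pos \<beta>1_ge w by (intro ennreal_lin divide_nonneg_nonneg) auto
    finally show ?thesis .
  qed
  have "(\<Sum>k<n. mean k (\<lambda>z. ennreal (zsq z powr q)))
    \<le> (\<Sum>k<n. ennreal (?p / \<alpha>1 powr q) * mean k (\<lambda>z. ennreal (lyap_z z powr q)) + ennreal (?r / \<beta>1 powr q) * mean k (\<lambda>z. ennreal (((norm (vel z))\<^sup>2) powr q)))"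
  proof (rule sum_mono)
    fix k
    have "mean k (\<lambda>z. ennreal (zsq z powr q))
      \<le> mean k (\<lambda>z. ennreal (?p / \<alpha>1 powr q) * ennreal (lyap_z z powr q) + ennreal (?r / \<beta>1 powr q) * ennreal (((norm (vel z))\<^sup>2) powr q))"
      by (intro mean_rules(2) pt)
    also have "\<dots> = ennreal (?p / \<alpha>1 powr q) * mean k (\<lambda>z. ennreal (lyap_z z powr q)) + ennreal (?r / \<beta>1 powr q) * mean k (\<lambda>z. ennreal (((norm (vel z))\<^sup>2) powr q))"
      by (rule mean_rules(3)) measurable
    finally show "mean k (\<lambda>z. ennreal (zsq z powr q))
      \<le> ennreal (?p / \<alpha>1 powr q) * mean k (\<lambda>z. ennreal (lyap_z z powr q)) + ennreal (?r / \<beta>1 powr q) * mean k (\<lambda>z. ennreal (((norm (vel z))\<^sup>2) powr q))" .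
  qed
  also have "\<dots> = ennreal (?p / \<alpha>1 powr q) * (\<Sum>k<n. mean k (\<lambda>z. ennreal (lyap_z z powr q)))
      + ennreal (?r / \<beta>1 powr q) * (\<Sum>k<n. mean k (\<lambda>z. ennreal (((norm (vel z))\<^sup>2) powr q)))"
    by (simp add: sum.distrib sum_distrib_left)
  also have "\<dots> \<le> ennreal (?p / \<alpha>1 powr q) * (ennreal (\<alpha>1 powr q) * ?T1) + ennreal (?r / \<beta>1 powr q) * (ennreal (\<beta>1 powr q) * ?T)"
    by (intro add_mono mult_left_mono sum_lyap sum_speed) auto
  also have "\<dots> \<le> ennreal (?p / \<alpha>1 powr q) * (ennreal (\<alpha>1 powr q) * ?T) + ennreal (?r / \<beta>1 powr q) * (ennreal (\<beta>1 powr q) * ?T)"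
    by (intro add_right_mono mult_left_mono add_increasing zero_le order_refl)
  also have "\<dots> = (ennreal ?p + ennreal ?r) * ?T"
    using \<alpha>1_pos \<beta>1_ge ennreal_divide_mult_cancel[OF pr(1), of "\<alpha>1 powr q" ?T] ennreal_divide_mult_cancel[OF pr(2), of "\<beta>1 powr q" ?T]
    by (simp only: distrib_right) simp
  also have "ennreal ?p + ennreal ?r = ennreal (?s powr q)" using pr by (simp add: ennreal_plus[symmetric] del: ennreal_plus)
  \<comment> \<open>The speed adds 1/\<theta> to 1/(\<kappa> \<delta>). As 11 \<kappa> \<le> \<tau>,
    this costs a factor 12/11, which \<open>R1 powr q\<close> absorbs because q \<ge> 1.\<close>
  also have "?T \<le> ennreal (12 / 11) * (ennreal (1 + 1 / \<kappa>) * (ennreal (1 / \<delta>) * M0 + ennreal (real n * Dq)))"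
  proof -
    have "1 / \<tau> \<le> 1 / (11 * \<kappa>)" using \<kappa>_bounds by (intro divide_left_mono) auto
    then have k: "1 / \<tau> + 1 / \<kappa> \<le> 12 / 11 * (1 + 1 / \<kappa>)" by simp
    have "1 / \<theta> + 1 / (\<kappa> * \<delta>) = (1 / \<tau> + 1 / \<kappa>) * (1 / \<delta>)"
      using \<delta>_pos \<tau>_bounds(1) \<kappa>_bounds(1) by (simp add: \<tau>_bounds(2) field_simps)
    also have "\<dots> \<le> 12 / 11 * (1 + 1 / \<kappa>) * (1 / \<delta>)" using k \<delta>_pos by (intro mult_right_mono) auto
    finally have 1: "1 / \<theta> + 1 / (\<kappa> * \<delta>) \<le> 12 / 11 * (1 + 1 / \<kappa>) * (1 / \<delta>)" .
    have "?T = ennreal (1 / \<theta> + 1 / (\<kappa> * \<delta>)) * M0 + ennreal (real n * Dq)"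
      using \<theta>_bounds \<kappa>_bounds \<delta>_pos by (simp add: ennreal_plus distrib_right add.assoc)
    also have "\<dots> \<le> ennreal (12 / 11 * (1 + 1 / \<kappa>) * (1 / \<delta>)) * M0 + ennreal (12 / 11 * (1 + 1 / \<kappa>) * (real n * Dq))"
    proof (intro add_mono mult_right_mono ennreal_leI 1)
      have "1 * (real n * Dq) \<le> 12 / 11 * (1 + 1 / \<kappa>) * (real n * Dq)" using \<kappa>_bounds(1) by (intro mult_right_mono) auto
      then show "real n * Dq \<le> 12 / 11 * (1 + 1 / \<kappa>) * (real n * Dq)" by simp
    qed simp
    also have "\<dots> = ennreal (12 / 11) * (ennreal (1 + 1 / \<kappa>) * (ennreal (1 / \<delta>) * M0 + ennreal (real n * Dq)))"
    proof -
      have *: "ennreal (a * b * c) = ennreal a * (ennreal b * ennreal c)" if "0 \<le> a" "0 \<le> b" "0 \<le> c" for a b c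
        using that by (simp add: ennreal_mult mult.assoc)
      have "0 \<le> 1 + 1 / \<kappa>" "0 \<le> 1 / \<delta>" using \<kappa>_bounds(1) \<delta>_pos by simp_all
      then show ?thesis
        using *[of "12 / 11" "1 + 1 / \<kappa>" "1 / \<delta>"] *[of "12 / 11" "1 + 1 / \<kappa>" "real n * Dq"]
        by (simp only: distrib_left mult.assoc) simp
    qed
    finally show ?thesis .
  qed
  also have "ennreal (?s powr q) * (ennreal (12 / 11) * (ennreal (1 + 1 / \<kappa>) * (ennreal (1 / \<delta>) * M0 + ennreal (real n * Dq))))
    \<le> ennreal (R1 powr q) * (ennreal (1 + 1 / \<kappa>) * (ennreal (1 / \<delta>) * M0 + ennreal (real n * Dq)))"
  proof -
    have "(12 / 11 :: real) powr 1 \<le> (12 / 11) powr q" using q by (intro powr_mono) auto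
    then have "?s powr q * (12 / 11) \<le> ?s powr q * (12 / 11) powr q" by (intro mult_left_mono) auto
    also have "\<dots> = R1 powr q"
      unfolding R1_def using s powr_mult[of "12 / 11" ?s q] by (simp only: mult.commute)
    finally have "ennreal (?s powr q * (12 / 11)) \<le> ennreal (R1 powr q)" by (rule ennreal_leI)
    moreover have "ennreal (?s powr q * (12 / 11)) = ennreal (?s powr q) * ennreal (12 / 11)" by (rule ennreal_mult) auto
    ultimately have "ennreal (?s powr q) * ennreal (12 / 11) \<le> ennreal (R1 powr q)" by (simp only:)
    then show ?thesis unfolding mult.assoc[symmetric] by (intro mult_right_mono) auto
  qed
  finally show ?thesis by (simp add: mult_left_mono)
qed

end
end

section \<open>Energy error of the Verlet map\<close>

text \<open>The trapezoid rule for f', with a Lipschitz bound on f'' standing in for a third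
  derivative. Comparison with the cubic C t^3 / 6 gives twice the optimal constant C / 12, which is
  enough.\<close>

lemma trapezoid_le:
  fixes f f' f'' :: "real \<Rightarrow> real"
  assumes f: "\<And>t. (f has_real_derivative f' t) (at t)" and f': "\<And>t. (f' has_real_derivative f'' t) (at t)"
    and lip: "\<And>s t. 0 \<le> s \<Longrightarrow> s \<le> t \<Longrightarrow> t \<le> 1 \<Longrightarrow> \<bar>f'' t - f'' s\<bar> \<le> C * (t - s)" and C: "0 \<le> C"
  shows "f 1 - f 0 - (f' 0 + f' 1) / 2 \<le> C / 6"
proof -
  define e where "e t = f t - f 0 - t * (f' 0 + f' t) / 2 - C / 6 * t ^ 3" for t
  \<comment> \<open>Integrability of \<open>f''\<close> plays no role: the mean value theorem replaces the integral remainder.\<close>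
  have "e 1 \<le> e 0"
  proof (rule DERIV_nonpos_imp_nonincreasing[where f = e])
    fix t :: real assume t: "0 \<le> t" "t \<le> 1"
    have d: "(e has_real_derivative (f' t - f' 0 - t * f'' t) / 2 - C / 2 * t\<^sup>2) (at t)"
      unfolding e_def[abs_def]
      by (auto intro!: derivative_eq_intros f f' simp: field_simps power2_eq_square)
    have "f' t - f' 0 - t * f'' t \<le> C * t\<^sup>2"
    proof (cases "t = 0")
      case False
      then obtain s where s: "0 < s" "s < t" "f' t - f' 0 = (t - 0) * f'' s"
        using MVT2[of 0 t f' f''] f' t by auto
      have "f' t - f' 0 - t * f'' t = t * (f'' s - f'' t)" using s by (simp add: algebra_simps)
      also have "\<dots> \<le> t * (C * (t - s))" using lip[of s t] s t by (intro mult_left_mono) auto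
      also have "\<dots> \<le> t * (C * t)" using s t C by (intro mult_left_mono) auto
      finally show ?thesis by (simp add: power2_eq_square mult.left_commute)
    qed simp
    then show "\<exists>y. (e has_real_derivative y) (at t) \<and> y \<le> 0" using d by (intro exI conjI) auto
  qed simp
  then show ?thesis by (simp add: e_def)
qed

context obabo_projection
begin

section \<open>Splitting and bounding the energy increment\<close>

definition energy_error :: "'n phase \<Rightarrow> real" where
  "energy_error z = u (T (fst (verlet U \<delta> z))) - u (T (fst z)) + ((norm (vel (verlet U \<delta> z)))\<^sup>2 - (norm (vel z))\<^sup>2) / 2"

definition disp :: "'n phase \<Rightarrow> 'e" where "disp z = \<delta> *\<^sub>R vel z - (\<delta>\<^sup>2 / 2) *\<^sub>R gr (T (fst z))"

lemma T_fst_verlet: "T (fst (verlet U \<delta> z)) = T (fst z) + disp z"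
  using pos_verlet[of z] by (simp add: pos_def disp_def algebra_simps)

definition speed :: "'n phase \<Rightarrow> real" where "speed z = norm (vel z) + (\<delta> * L / 2) * norm (pos z)"

lemma speed_nonneg: "0 \<le> speed z" using \<delta>_pos L_pos by (simp add: speed_def)

lemma norm_disp: "norm (disp z) \<le> \<delta> * speed z"
proof -
  have "norm (disp z) \<le> norm (\<delta> *\<^sub>R vel z) + norm ((\<delta>\<^sup>2 / 2) *\<^sub>R gr (T (fst z)))"
    unfolding disp_def by (rule norm_triangle_ineq4)
  also have "\<dots> = \<delta> * norm (vel z) + \<delta>\<^sup>2 / 2 * norm (gr (T (fst z)))" using \<delta>_pos by simp
  also have "\<dots> \<le> \<delta> * norm (vel z) + \<delta>\<^sup>2 / 2 * (L * norm (pos z))"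
    using gr_norm_le[of "T (fst z)"] by (intro add_left_mono mult_left_mono) (auto simp: pos_def)
  also have "\<dots> = \<delta> * speed z" by (simp add: speed_def power2_eq_square algebra_simps)
  finally show ?thesis .
qed

text \<open>The change of kinetic energy pairs the mean force with the velocity. Expressed through
  the displacement, this pairing is the trapezoid rule for u along \<open>disp z\<close>; what
  remains is a difference of squared forces, of order \<delta>^3.\<close>

lemma energy_error_eq:
  "energy_error z = (u (T (fst z) + disp z) - u (T (fst z)) - (gr (T (fst z)) \<bullet> disp z + gr (T (fst z) + disp z) \<bullet> disp z) / 2)
    + \<delta>\<^sup>2 / 8 * ((norm (gr (T (fst z) + disp z)))\<^sup>2 - (norm (gr (T (fst z))))\<^sup>2)"
proof -
  let ?g = "gr (T (fst z))" and ?g1 = "gr (T (fst z) + disp z)"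
  have "(norm (vel (verlet U \<delta> z)))\<^sup>2 = (norm (vel z))\<^sup>2 - \<delta> * (vel z \<bullet> ?g + vel z \<bullet> ?g1) + \<delta>\<^sup>2 / 4 * (?g \<bullet> ?g + 2 * (?g \<bullet> ?g1) + ?g1 \<bullet> ?g1)"
    unfolding vel_verlet T_fst_verlet power2_norm_eq_inner
    by (simp add: inner_simps inner_commute algebra_simps power2_eq_square)
  moreover have "?g \<bullet> disp z + ?g1 \<bullet> disp z = \<delta> * (vel z \<bullet> ?g + vel z \<bullet> ?g1) - \<delta>\<^sup>2 / 2 * (?g \<bullet> ?g + ?g \<bullet> ?g1)"
    unfolding disp_def by (simp add: inner_simps inner_commute algebra_simps)
  ultimately have "(norm (vel (verlet U \<delta> z)))\<^sup>2 = (norm (vel z))\<^sup>2 - \<delta> * (vel z \<bullet> ?g + vel z \<bullet> ?g1)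
      + (\<delta>\<^sup>2 * (?g \<bullet> ?g) + 2 * (\<delta>\<^sup>2 * (?g \<bullet> ?g1)) + \<delta>\<^sup>2 * (?g1 \<bullet> ?g1)) / 4"
    "?g \<bullet> disp z + ?g1 \<bullet> disp z = \<delta> * (vel z \<bullet> ?g + vel z \<bullet> ?g1) - (\<delta>\<^sup>2 * (?g \<bullet> ?g) + \<delta>\<^sup>2 * (?g \<bullet> ?g1)) / 2"
    by (simp_all add: distrib_left add_divide_distrib)
  moreover have "V1 = V - P + (G + 2 * H + I) / 4 \<Longrightarrow> s = P - (G + H) / 2 \<Longrightarrow> d + (V1 - V) / 2 = (d - s / 2) + (I - G) / 8"
    for V1 V P G H I s d :: real by (simp add: field_simps)
  ultimately have "energy_error z = (u (T (fst z) + disp z) - u (T (fst z)) - (?g \<bullet> disp z + ?g1 \<bullet> disp z) / 2)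
      + (\<delta>\<^sup>2 * (?g1 \<bullet> ?g1) - \<delta>\<^sup>2 * (?g \<bullet> ?g)) / 8"
    unfolding energy_error_def T_fst_verlet by blast
  then show ?thesis by (simp add: power2_norm_eq_inner right_diff_distrib diff_divide_distrib)
qed

lemma grad_sq_diff: "(norm (gr (x + d)))\<^sup>2 - (norm (gr x))\<^sup>2 \<le> L * norm d * (2 * L * norm (x - c) + L * norm d)"
proof -
  have 1: "norm (gr (x + d)) \<le> norm (gr x) + L * norm d"
    using lip[of "x + d" x] norm_triangle_ineq[of "gr x" "gr (x + d) - gr x"] by simp
  have "(norm (gr (x + d)))\<^sup>2 \<le> (norm (gr x) + L * norm d)\<^sup>2" using 1 by (intro power_mono) auto
  then have "(norm (gr (x + d)))\<^sup>2 - (norm (gr x))\<^sup>2 \<le> L * norm d * (2 * norm (gr x) + L * norm d)"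
    by (simp add: power2_eq_square algebra_simps)
  also have "\<dots> \<le> L * norm d * (2 * (L * norm (x - c)) + L * norm d)"
    using gr_norm_le[of x] L_pos by (intro mult_left_mono add_right_mono) auto
  finally show ?thesis by (simp add: mult.assoc)
qed

lemma kinetic_part:
  "\<delta>\<^sup>2 / 8 * ((norm (gr (T (fst z) + disp z)))\<^sup>2 - (norm (gr (T (fst z))))\<^sup>2)
    \<le> \<delta> ^ 3 * (L\<^sup>2 / 4 * (speed z * norm (pos z)) + \<delta> * L\<^sup>2 / 8 * (speed z)\<^sup>2)"
proof -
  have "(norm (gr (T (fst z) + disp z)))\<^sup>2 - (norm (gr (T (fst z))))\<^sup>2
     \<le> L * norm (disp z) * (2 * L * norm (pos z) + L * norm (disp z))"
    using grad_sq_diff[of "T (fst z)" "disp z"] by (simp add: pos_def)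
  also have "\<dots> \<le> L * (\<delta> * speed z) * (2 * L * norm (pos z) + L * (\<delta> * speed z))"
    using norm_disp[of z] L_pos \<delta>_pos speed_nonneg[of z] by (intro mult_mono add_left_mono mult_left_mono) auto
  finally have "\<delta>\<^sup>2 / 8 * ((norm (gr (T (fst z) + disp z)))\<^sup>2 - (norm (gr (T (fst z))))\<^sup>2)
    \<le> \<delta>\<^sup>2 / 8 * (L * (\<delta> * speed z) * (2 * L * norm (pos z) + L * (\<delta> * speed z)))"
    by (intro mult_left_mono) auto
  also have "\<dots> = \<delta> ^ 3 * (L\<^sup>2 / 4 * (speed z * norm (pos z)) + \<delta> * L\<^sup>2 / 8 * (speed z)\<^sup>2)"
    by (simp add: power2_eq_square power3_eq_cube algebra_simps)
  finally show ?thesis .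
qed

text \<open>The trapezoid error is the mean of two tangent errors: the descent lemma at the starting
  point costs L/2 |d|^2 and convexity at the end point costs nothing, which leaves L/4
  |d|^2.\<close>

lemma energy_error_le:
  "energy_error z \<le> \<delta>\<^sup>2 * (L / 4) * (1 + 1 / 100000) * (1 + \<delta>\<^sup>2 * L\<^sup>2) * zsq z"
proof -
  let ?x = "T (fst z)" and ?d = "disp z"
  let ?S = "speed z" and ?b = "\<delta> * L / 2 * norm (pos z)"
  have b: "0 \<le> ?b" using \<delta>_pos L_pos by simp
  have "u (?x + ?d) \<le> u ?x + gr ?x \<bullet> ?d + L / 2 * (norm ?d)\<^sup>2" by (rule u_descent)
  moreover have "u (?x + ?d) \<le> u ?x + gr (?x + ?d) \<bullet> ?d" using u_convex[of "?x + ?d" "- ?d"] by simp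
  moreover have "a \<le> b + g + L / 2 * K \<Longrightarrow> a \<le> b + h \<Longrightarrow> a - b - (g + h) / 2 \<le> L / 4 * K" for a b g h K :: real
    by (simp add: field_simps)
  ultimately have "u (?x + ?d) - u ?x - (gr ?x \<bullet> ?d + gr (?x + ?d) \<bullet> ?d) / 2 \<le> L / 4 * (norm ?d)\<^sup>2"
    by blast
  also have "\<dots> \<le> L / 4 * (\<delta> * ?S)\<^sup>2" using norm_disp[of z] L_pos by (intro mult_left_mono power_mono) auto
  finally have "energy_error z \<le> L / 4 * (\<delta> * ?S)\<^sup>2 + \<delta> ^ 3 * (L\<^sup>2 / 4 * (?S * norm (pos z)) + \<delta> * L\<^sup>2 / 8 * ?S\<^sup>2)"
    unfolding energy_error_eq by (intro add_mono kinetic_part)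
  \<comment> \<open>With b = \<delta> L |x| / 2 the mixed term is 2 S b and completes a square,
    where S + b = |v| + \<delta> L |x|; the factor 1 + 1/100000 covers the last term.\<close>
  also have "\<dots> = \<delta>\<^sup>2 * (L / 4) * (?S\<^sup>2 + 2 * ?S * ?b + (\<delta>\<^sup>2 * L / 2) * ?S\<^sup>2)"
    by (simp add: power2_eq_square power3_eq_cube algebra_simps)
  also have "\<dots> \<le> \<delta>\<^sup>2 * (L / 4) * ((1 + 1 / 100000) * (?S + ?b)\<^sup>2)"
  proof (rule mult_left_mono)
    have "\<delta>\<^sup>2 * L / 2 \<le> 1 / 100000" using \<delta>_sq_L(2) by linarith
    then have "(\<delta>\<^sup>2 * L / 2) * ?S\<^sup>2 \<le> (1 / 100000) * ?S\<^sup>2" by (rule mult_right_mono) simp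
    also have "\<dots> \<le> (1 / 100000) * (?S + ?b)\<^sup>2" using b speed_nonneg by (intro mult_left_mono power_mono) auto
    finally have 1: "(\<delta>\<^sup>2 * L / 2) * ?S\<^sup>2 \<le> (1 / 100000) * (?S + ?b)\<^sup>2" .
    have 2: "?S\<^sup>2 + 2 * ?S * ?b \<le> (?S + ?b)\<^sup>2" unfolding power2_sum using zero_le_power2[of ?b] by linarith
    show "?S\<^sup>2 + 2 * ?S * ?b + (\<delta>\<^sup>2 * L / 2) * ?S\<^sup>2 \<le> (1 + 1 / 100000) * (?S + ?b)\<^sup>2"
      unfolding distrib_right mult_1_left by (rule add_mono[OF 2 1])
  qed (use L_pos in auto)
  also have "\<dots> \<le> \<delta>\<^sup>2 * (L / 4) * ((1 + 1 / 100000) * ((1 + \<delta>\<^sup>2 * L\<^sup>2) * zsq z))"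
  proof (intro mult_left_mono)
    have "?S + ?b = norm (vel z) + (\<delta> * L) * norm (pos z)" by (simp add: speed_def)
    moreover have "(v + k * x)\<^sup>2 \<le> (1 + k\<^sup>2) * (x\<^sup>2 + v\<^sup>2)" for v k x :: real
    proof -
      have "(1 + k\<^sup>2) * (x\<^sup>2 + v\<^sup>2) - (v + k * x)\<^sup>2 = (x - k * v)\<^sup>2" by (simp add: power2_eq_square algebra_simps)
      then show ?thesis using zero_le_power2[of "x - k * v"] by linarith
    qed
    ultimately show "(?S + ?b)\<^sup>2 \<le> (1 + \<delta>\<^sup>2 * L\<^sup>2) * zsq z"
      by (simp add: zsq_def power_mult_distrib[symmetric])
  qed (use L_pos in auto)
  finally show ?thesis by (simp only: mult.assoc)
qed

text \<open>The Hessian hypothesis concerns quadratic forms, which suits both an operator norm bound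
  in the full space and the second derivative of one coordinate. The trapezoid rule then gives
  \<delta>^3, and Young's inequality reduces the lower powers of the distance to 1 and the (l+1)-st
  power, so that a single moment is needed.\<close>

lemma energy_error_le_hessian:
  fixes A :: "'e \<Rightarrow> 'e \<Rightarrow> 'e" and l Ll :: real
  assumes A: "\<And>x. (gr has_derivative A x) (at x)"
    and hess: "\<And>x y h. \<bar>(A y h - A x h) \<bullet> h\<bar> \<le> Ll / 4 * norm (x - y) * (2 + rpow (norm (x - c)) (l - 2) + rpow (norm (y - c)) (l - 2)) * (norm h)\<^sup>2"
    and l: "2 \<le> l" and Ll: "0 < Ll"
  shows "2 * energy_error z \<le> \<delta> ^ 3 * (((L + 2 * L\<^sup>2) / 4 * (1 + \<delta>\<^sup>2 * (L\<^sup>2 / 4))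
        + 2 powr ((l - 3) / 2) * Ll * (1 + L * \<delta> / 2) ^ 3 * (1 + \<delta> + \<delta>\<^sup>2 * L / 2) powr (l - 2))
       * (1 + zsq z powr ((l + 1) / 2) / 2))"
proof -
  let ?x = "T (fst z)" and ?d = "disp z" and ?S = "speed z"
  let ?P = "1 + \<delta> + \<delta>\<^sup>2 * L / 2"
  define N where "N = sqrt (zsq z)"
  define k where "k = \<delta> * L / 2"
  define Q where "Q = zsq z powr ((l + 1) / 2)"
  have k0: "0 \<le> k" using \<delta>_pos L_pos by (simp add: k_def)
  have N0: "0 \<le> N" and N2: "N\<^sup>2 = zsq z" using zsq_nonneg by (auto simp: N_def)
  have xN: "norm (pos z) \<le> N" and vN: "norm (vel z) \<le> N"
    by (auto simp: N_def zsq_def real_le_rsqrt)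
  have SN: "?S \<le> (1 + k) * N"
    using vN mult_left_mono[OF xN k0] by (simp add: speed_def k_def algebra_simps)
  have Q0: "0 \<le> Q" by (simp add: Q_def)
  have QN: "Q = N powr (l + 1)"
  proof (cases "N = 0")
    case False
    then have "N\<^sup>2 = N powr 2" using N0 by simp
    then have "Q = N powr (2 * ((l + 1) / 2))" unfolding Q_def N2[symmetric] by (simp only: powr_powr)
    also have "2 * ((l + 1) / 2) = l + 1" by (simp add: field_simps)
    finally show ?thesis .
  next
    case True
    then show ?thesis using N2 by (simp add: Q_def)
  qed
  have P1: "1 \<le> ?P" using \<delta>_pos L_pos by simp
  define \<rho> where "\<rho> = rpow (?P * N) (l - 2)"
  have \<rho>0: "0 \<le> \<rho>" by (simp add: \<rho>_def rpow_def)
  have rpow_mono: "rpow a (l - 2) \<le> rpow b (l - 2)" if "0 \<le> a" "a \<le> b" for a b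
    using that l by (auto simp: rpow_def intro!: powr_mono2)
  have line: "norm (?x + t *\<^sub>R ?d - c) \<le> ?P * N" if "0 \<le> t" "t \<le> 1" for t
  proof -
    have "norm (?x + t *\<^sub>R ?d - c) = norm (pos z + t *\<^sub>R ?d)" by (simp add: pos_def algebra_simps)
    also have "\<dots> \<le> norm (pos z) + \<bar>t\<bar> * norm ?d" using norm_triangle_ineq[of "pos z" "t *\<^sub>R ?d"] by simp
    also have "\<bar>t\<bar> * norm ?d \<le> 1 * (\<delta> * ?S)" using that norm_disp[of z] by (intro mult_mono) auto
    also have "\<delta> * ?S = \<delta> * norm (vel z) + (\<delta>\<^sup>2 * L / 2) * norm (pos z)"
      by (simp add: speed_def power2_eq_square algebra_simps)
    also have "norm (pos z) + 1 * (\<delta> * norm (vel z) + (\<delta>\<^sup>2 * L / 2) * norm (pos z)) \<le> N + 1 * (\<delta> * N + (\<delta>\<^sup>2 * L / 2) * N)"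
      using xN vN \<delta>_pos L_pos by (intro add_mono mult_left_mono) auto
    also have "\<dots> = ?P * N" by (simp add: algebra_simps)
    finally show ?thesis by simp
  qed
  \<comment> \<open>The Lipschitz constant of the second derivative of u along the segment, on which
    both powers in the Hessian bound are at most \<rho>.\<close>
  define C where "C = Ll / 2 * (norm ?d) ^ 3 * (1 + \<rho>)"
  have C0: "0 \<le> C" using Ll \<rho>0 by (simp add: C_def)
  have "u (?x + 1 *\<^sub>R ?d) - u (?x + 0 *\<^sub>R ?d) - (gr (?x + 0 *\<^sub>R ?d) \<bullet> ?d + gr (?x + 1 *\<^sub>R ?d) \<bullet> ?d) / 2 \<le> C / 6"
  proof (rule trapezoid_le[where f'' = "\<lambda>t. A (?x + t *\<^sub>R ?d) ?d \<bullet> ?d"])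
    fix t
    show "((\<lambda>t. u (?x + t *\<^sub>R ?d)) has_real_derivative gr (?x + t *\<^sub>R ?d) \<bullet> ?d) (at t)" by (rule u_line)
    have "((\<lambda>t. ?x + t *\<^sub>R ?d) has_derivative (\<lambda>s. s *\<^sub>R ?d)) (at t)" by (auto intro!: derivative_eq_intros)
    from has_derivative_compose[OF this A]
    have "((\<lambda>t. gr (?x + t *\<^sub>R ?d)) has_derivative (\<lambda>s. A (?x + t *\<^sub>R ?d) (s *\<^sub>R ?d))) (at t)" .
    then have "((\<lambda>t. gr (?x + t *\<^sub>R ?d) \<bullet> ?d) has_derivative (\<lambda>s. A (?x + t *\<^sub>R ?d) (s *\<^sub>R ?d) \<bullet> ?d)) (at t)"
      by (rule has_derivative_inner_left)
    moreover have "linear (A y)" for y using has_derivative_linear[OF A] .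
    ultimately show "((\<lambda>t. gr (?x + t *\<^sub>R ?d) \<bullet> ?d) has_real_derivative A (?x + t *\<^sub>R ?d) ?d \<bullet> ?d) (at t)"
      by (simp add: has_field_derivative_def linear_scale mult_commute_abs)
  next
    fix s t :: real assume st: "0 \<le> s" "s \<le> t" "t \<le> 1"
    let ?y = "?x + t *\<^sub>R ?d" and ?w = "?x + s *\<^sub>R ?d"
    have "\<bar>A ?y ?d \<bullet> ?d - A ?w ?d \<bullet> ?d\<bar> = \<bar>(A ?y ?d - A ?w ?d) \<bullet> ?d\<bar>" by (simp add: inner_diff_left)
    also have "\<dots> \<le> Ll / 4 * norm (?w - ?y) * (2 + rpow (norm (?w - c)) (l - 2) + rpow (norm (?y - c)) (l - 2)) * (norm ?d)\<^sup>2"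
      by (rule hess)
    also have "\<dots> \<le> Ll / 4 * norm (?w - ?y) * (2 + \<rho> + \<rho>) * (norm ?d)\<^sup>2"
      using st Ll line unfolding \<rho>_def by (intro mult_right_mono mult_left_mono add_mono rpow_mono) auto
    also have "norm (?w - ?y) = (t - s) * norm ?d"
    proof -
      have "?w - ?y = (s - t) *\<^sub>R ?d" by (simp add: scaleR_diff_left)
      then show ?thesis using st by simp
    qed
    also have "Ll / 4 * ((t - s) * norm ?d) * (2 + \<rho> + \<rho>) * (norm ?d)\<^sup>2 = C * (t - s)"
    proof -
      have "Ll / 4 * (r * N) * (2 + \<rho> + \<rho>) * N\<^sup>2 = Ll / 2 * N ^ 3 * (1 + \<rho>) * r" for r N
        by (simp add: power2_eq_square power3_eq_cube field_simps)
      then show ?thesis by (simp only: C_def)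
    qed
    finally show "\<bar>A ?y ?d \<bullet> ?d - A ?w ?d \<bullet> ?d\<bar> \<le> C * (t - s)" .
  qed (rule C0)
  then have trap: "u (?x + ?d) - u ?x - (gr ?x \<bullet> ?d + gr (?x + ?d) \<bullet> ?d) / 2 \<le> C / 6" by simp
  have "2 * energy_error z \<le> 2 * (C / 6 + \<delta> ^ 3 * (L\<^sup>2 / 4 * (?S * norm (pos z)) + \<delta> * L\<^sup>2 / 8 * ?S\<^sup>2))"
    unfolding energy_error_eq by (intro mult_left_mono add_mono kinetic_part trap) simp
  also have "\<dots> = C / 3 + \<delta> ^ 3 * (L\<^sup>2 / 2 * (?S * norm (pos z)) + \<delta> * L\<^sup>2 / 4 * ?S\<^sup>2)"
    by (simp add: algebra_simps)
  finally have E: "2 * energy_error z \<le> C / 3 + \<delta> ^ 3 * (L\<^sup>2 / 2 * (?S * norm (pos z)) + \<delta> * L\<^sup>2 / 4 * ?S\<^sup>2)" .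
  \<comment> \<open>Young's inequality against the constant 1 trades N^j for a multiple of
    \<open>Q\<close> = N^(l+1) plus a constant, with coefficients adding up to 1.\<close>
  have young_p: "N ^ j \<le> real j / (l + 1) * Q + (1 - real j / (l + 1))" if "1 \<le> j" "real j \<le> l + 1" for j
  proof (cases "N = 0")
    case True
    then show ?thesis using that Q0 by (simp add: power_0_left)
  next
    case False
    then have Npos: "0 < N" using N0 by simp
    have "N ^ j = 1 powr (1 - real j / (l + 1)) * Q powr (real j / (l + 1))"
      using Npos l by (simp add: QN powr_powr powr_realpow)
    also have "\<dots> \<le> (1 - real j / (l + 1)) * 1 + real j / (l + 1) * Q"
      using Npos that l QN by (intro Youngs_inequality_0) auto
    finally show ?thesis by simp
  qed
  have young_le: "N ^ j \<le> r * Q + 1" if j: "1 \<le> j" "real j \<le> l + 1" "real j / (l + 1) \<le> r" for j r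
  proof -
    have "real j / (l + 1) * Q \<le> r * Q" using j(3) Q0 by (rule mult_right_mono)
    moreover have "0 \<le> real j / (l + 1)" using l by simp
    ultimately show ?thesis using young_p[OF j(1,2)] by linarith
  qed
  have n2: "zsq z \<le> 2 / 3 * Q + 1"
    using young_le[of 2 "2 / 3"] l by (simp add: N2 divide_simps)
  have n3: "N ^ 3 * (1 + \<rho>) \<le> ?P powr (l - 2) * (1 + 2 * Q)"
  proof -
    have 1: "N ^ 3 \<le> 1 * Q + 1" using young_le[of 3 1] l by simp
    have 2: "N ^ 3 * \<rho> = ?P powr (l - 2) * Q"
    proof (cases "N = 0")
      case True
      then show ?thesis using QN by simp
    next
      case False
      then have Np: "0 < N" using N0 by simp
      have "\<rho> = ?P powr (l - 2) * N powr (l - 2)"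
        using Np P1 by (auto simp: \<rho>_def rpow_def powr_mult)
      moreover have "N ^ 3 * N powr (l - 2) = N powr (3 + (l - 2))"
        using Np powr_add[of N 3 "l - 2"] by simp
      ultimately show ?thesis by (simp add: QN add.commute)
    qed
    have "1 \<le> ?P powr (l - 2)" using P1 l by (intro ge_one_powr_ge_zero) auto
    then have "1 * (1 + Q) \<le> ?P powr (l - 2) * (1 + Q)" using Q0 by (intro mult_right_mono) auto
    then have "1 + Q \<le> ?P powr (l - 2) + ?P powr (l - 2) * Q" by (simp only: distrib_left mult_1_left mult_1_right)
    moreover have "N ^ 3 * (1 + \<rho>) = N ^ 3 + N ^ 3 * \<rho>" by (simp only: distrib_left mult_1_right)
    moreover have "?P powr (l - 2) * (1 + 2 * Q) = ?P powr (l - 2) + ?P powr (l - 2) * Q + ?P powr (l - 2) * Q"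
      by (simp add: distrib_left)
    ultimately show ?thesis using 1 2 by linarith
  qed
  have K1: "L\<^sup>2 / 2 * (?S * norm (pos z)) + \<delta> * L\<^sup>2 / 4 * ?S\<^sup>2 \<le> (L + 2 * L\<^sup>2) / 4 * (1 + \<delta>\<^sup>2 * (L\<^sup>2 / 4)) * (1 + Q / 2)"
  proof -
    let ?K = "1 + k\<^sup>2"
    \<comment> \<open>A constant below 3/4 is required: with \<open>n2\<close> it contributes (1/2)
      (2/3) (18/25) L^2 to the coefficient of Q, where L^2 / 4 is available.\<close>
    have S1: "(v + k * x) * x \<le> 18 / 25 * ((1 + k\<^sup>2) * (x\<^sup>2 + v\<^sup>2))" for v x :: real
    proof -
      have "18 / 25 * ((1 + k\<^sup>2) * (x\<^sup>2 + v\<^sup>2)) - (v + k * x) * x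
        = 18 / 25 * (v - 25 / 36 * x)\<^sup>2 + 18 / 25 * ((k - 25 / 36) * x)\<^sup>2 + 18 / 25 * (k * v)\<^sup>2 + 23 / 900 * x\<^sup>2"
        by algebra
      also have "\<dots> \<ge> 0" by simp
      finally show ?thesis by simp
    qed
    have S2: "(v + k * x)\<^sup>2 \<le> (1 + k\<^sup>2) * (x\<^sup>2 + v\<^sup>2)" for v x :: real
    proof -
      have "(1 + k\<^sup>2) * (x\<^sup>2 + v\<^sup>2) - (v + k * x)\<^sup>2 = (x - k * v)\<^sup>2" by (simp add: power2_eq_square algebra_simps)
      then show ?thesis using zero_le_power2[of "x - k * v"] by linarith
    qed
    \<comment> \<open>For small L the step \<delta> may be large, so \<delta> L^2 is compared with
      the geometric mean of L and L^2; hence the summand L in L + 2 L^2.\<close>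
    have dL: "\<delta> * L\<^sup>2 \<le> (L + L\<^sup>2) / 400"
    proof (rule power2_le_imp_le)
      have "0 \<le> (L - L\<^sup>2)\<^sup>2" by simp
      then have "4 * L ^ 3 \<le> (L + L\<^sup>2)\<^sup>2" by (simp add: power2_eq_square power3_eq_cube algebra_simps)
      moreover have "(\<delta>\<^sup>2 * L) * L ^ 3 \<le> (1 / 60000) * L ^ 3" using \<delta>_sq_L(2) L_pos by (intro mult_right_mono) auto
      moreover have "(\<delta> * L\<^sup>2)\<^sup>2 = (\<delta>\<^sup>2 * L) * L ^ 3" by (simp add: power2_eq_square power3_eq_cube algebra_simps)
      moreover have "0 \<le> L ^ 3" using L_pos by simp
      moreover have "((L + L\<^sup>2) / 400)\<^sup>2 = (L + L\<^sup>2)\<^sup>2 / 160000" by (simp add: power_divide)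
      ultimately show "(\<delta> * L\<^sup>2)\<^sup>2 \<le> ((L + L\<^sup>2) / 400)\<^sup>2" by linarith
    qed (use L_pos in simp)
    have z0: "0 \<le> ?K * zsq z" using zsq_nonneg by simp
    have "L\<^sup>2 / 2 * (?S * norm (pos z)) + \<delta> * L\<^sup>2 / 4 * ?S\<^sup>2
       \<le> L\<^sup>2 / 2 * (18 / 25 * (?K * zsq z)) + (L + L\<^sup>2) / 1600 * (?K * zsq z)"
    proof (rule add_mono)
      have "?S * norm (pos z) \<le> 18 / 25 * (?K * zsq z)" using S1[of "norm (vel z)" "norm (pos z)"] by (simp add: speed_def k_def zsq_def)
      then show "L\<^sup>2 / 2 * (?S * norm (pos z)) \<le> L\<^sup>2 / 2 * (18 / 25 * (?K * zsq z))" by (rule mult_left_mono) simp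
      have "?S\<^sup>2 \<le> ?K * zsq z" using S2[of "norm (vel z)" "norm (pos z)"] by (simp add: speed_def k_def zsq_def)
      then show "\<delta> * L\<^sup>2 / 4 * ?S\<^sup>2 \<le> (L + L\<^sup>2) / 1600 * (?K * zsq z)"
        using dL L_pos by (intro mult_mono) auto
    qed
    also have "\<dots> = (9 / 25 * L\<^sup>2 + (L + L\<^sup>2) / 1600) * (?K * zsq z)" by (simp add: algebra_simps)
    also have "\<dots> \<le> (9 / 25 * L\<^sup>2 + (L + L\<^sup>2) / 1600) * (?K * (2 / 3 * Q + 1))"
      using n2 L_pos by (intro mult_left_mono) auto
    also have "\<dots> = ?K * ((9 / 25 * L\<^sup>2 + (L + L\<^sup>2) / 1600) * (2 / 3 * Q) + (9 / 25 * L\<^sup>2 + (L + L\<^sup>2) / 1600))"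
    proof -
      have "w * (K * (a + 1)) = K * (w * a + w)" for w K a :: real by algebra
      then show ?thesis .
    qed
    also have "\<dots> \<le> ?K * ((L + 2 * L\<^sup>2) / 4 * (Q / 2) + (L + 2 * L\<^sup>2) / 4)"
    proof (intro mult_left_mono add_mono)
      have *: "(9 / 25 * X + (Y + X) / 1600) * (2 / 3) \<le> (Y + 2 * X) / 4 / 2" "9 / 25 * X + (Y + X) / 1600 \<le> (Y + 2 * X) / 4"
        if "0 < Y" "0 \<le> X" for X Y :: real using that by (simp_all add: field_simps)
      have "(9 / 25 * L\<^sup>2 + (L + L\<^sup>2) / 1600) * (2 / 3) * Q \<le> (L + 2 * L\<^sup>2) / 4 / 2 * Q"
        using *(1)[of L "L\<^sup>2"] L_pos Q0 by (intro mult_right_mono) simp_all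
      then show "(9 / 25 * L\<^sup>2 + (L + L\<^sup>2) / 1600) * (2 / 3 * Q) \<le> (L + 2 * L\<^sup>2) / 4 * (Q / 2)"
      proof -
        have "w * (2 / 3 * Q) = w * (2 / 3) * Q" "v * (Q / 2) = v / 2 * Q" for w v :: real by simp_all
        then show ?thesis
          using \<open>(9 / 25 * L\<^sup>2 + (L + L\<^sup>2) / 1600) * (2 / 3) * Q \<le> (L + 2 * L\<^sup>2) / 4 / 2 * Q\<close> by (simp only:)
      qed
      show "9 / 25 * L\<^sup>2 + (L + L\<^sup>2) / 1600 \<le> (L + 2 * L\<^sup>2) / 4" using *(2)[of L "L\<^sup>2"] L_pos by simp
    qed simp
    also have "?K = 1 + \<delta>\<^sup>2 * (L\<^sup>2 / 4)" by (simp add: k_def power_mult_distrib power_divide)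
    also have "(1 + \<delta>\<^sup>2 * (L\<^sup>2 / 4)) * ((L + 2 * L\<^sup>2) / 4 * (Q / 2) + (L + 2 * L\<^sup>2) / 4)
      = (L + 2 * L\<^sup>2) / 4 * (1 + \<delta>\<^sup>2 * (L\<^sup>2 / 4)) * (1 + Q / 2)"
    proof -
      have "X * (Y * (Q / 2) + Y) = Y * X * (1 + Q / 2)" for X Y :: real by (simp add: distrib_left)
      then show ?thesis .
    qed
    finally show ?thesis .
  qed
  have K2: "C / 3 \<le> \<delta> ^ 3 * (2 powr ((l - 3) / 2) * Ll * (1 + L * \<delta> / 2) ^ 3 * ?P powr (l - 2) * (1 + Q / 2))"
  proof -
    have "C / 3 = Ll / 6 * ((norm ?d) ^ 3 * (1 + \<rho>))" by (simp add: C_def)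
    also have "\<dots> \<le> Ll / 6 * ((\<delta> * ((1 + k) * N)) ^ 3 * (1 + \<rho>))"
      using Ll \<rho>0 order_trans[OF norm_disp[of z] mult_left_mono[OF SN, of \<delta>]] \<delta>_pos
      by (intro mult_left_mono mult_right_mono power_mono) auto
    also have "\<dots> = Ll / 6 * (\<delta> ^ 3 * (1 + k) ^ 3 * (N ^ 3 * (1 + \<rho>)))" by (simp add: power_mult_distrib)
    also have "\<dots> \<le> Ll / 6 * (\<delta> ^ 3 * (1 + k) ^ 3 * (?P powr (l - 2) * (1 + 2 * Q)))"
      using Ll n3 \<delta>_pos k0 by (intro mult_left_mono) auto
    also have "\<dots> = (\<delta> ^ 3 * (Ll * (1 + k) ^ 3 * ?P powr (l - 2))) * ((1 + 2 * Q) / 6)" by simp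
    also have "\<dots> \<le> (\<delta> ^ 3 * (Ll * (1 + k) ^ 3 * ?P powr (l - 2))) * (2 powr ((l - 3) / 2) * (1 + Q / 2))"
    proof (intro mult_left_mono)
      \<comment> \<open>As l \<ge> 2, the factor 2 powr ((l - 3) / 2) is at least 7/10, and (1 + 2
        Q) / 6 \<le> (7/10) (1 + Q / 2).\<close>
      have "(7 / 10 :: real) \<le> 2 powr (- 1 / 2)"
      proof (rule power2_le_imp_le)
        have "(2 powr (- 1 / 2))\<^sup>2 = (2::real) powr (- 1)" by (simp add: power2_eq_square powr_add[symmetric])
        then show "(7 / 10 :: real)\<^sup>2 \<le> (2 powr (- 1 / 2))\<^sup>2" by (simp add: powr_minus power2_eq_square)
      qed simp
      also have "(2::real) powr (- 1 / 2) \<le> 2 powr ((l - 3) / 2)" using l by (intro powr_mono) auto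
      finally have "7 / 10 * (1 + Q / 2) \<le> 2 powr ((l - 3) / 2) * (1 + Q / 2)" using Q0 by (intro mult_right_mono) auto
      then show "(1 + 2 * Q) / 6 \<le> 2 powr ((l - 3) / 2) * (1 + Q / 2)" using Q0 by simp
    qed (use Ll \<delta>_pos k0 in auto)
    also have "\<dots> = \<delta> ^ 3 * (2 powr ((l - 3) / 2) * Ll * (1 + L * \<delta> / 2) ^ 3 * ?P powr (l - 2) * (1 + Q / 2))"
      unfolding k_def by (simp only: mult_ac)
    finally show ?thesis .
  qed
  have "2 * energy_error z \<le> \<delta> ^ 3 * (2 powr ((l - 3) / 2) * Ll * (1 + L * \<delta> / 2) ^ 3 * ?P powr (l - 2) * (1 + Q / 2))
      + \<delta> ^ 3 * ((L + 2 * L\<^sup>2) / 4 * (1 + \<delta>\<^sup>2 * (L\<^sup>2 / 4)) * (1 + Q / 2))"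
    by (rule order_trans[OF E], rule add_mono[OF K2], rule mult_left_mono[OF K1]) (use \<delta>_pos in simp)
  then show ?thesis
    unfolding Q_def[symmetric] distrib_right[of _ _ "1 + Q / 2"] distrib_left[of "\<delta> ^ 3"] by (simp only: add.commute)
qed

end

section \<open>Summation of the energy errors\<close>

text \<open>For comparing constants of the form p + s / m. Slack \<open>h\<close> given up in the
  comparison of the constant parts counts as \<open>h * m\<close> in that of the 1/m parts.\<close>

lemma mult_add_mono_ratio:
  fixes p s b m f g h :: real
  assumes "0 < m" "p * f \<le> (b - h) * g" "s * f \<le> (b + h * m) * g"
  shows "(p + s / m) * f \<le> b * (1 + 1 / m) * g"
proof -
  have "s * f / m \<le> (b + h * m) * g / m" using assms by (intro divide_right_mono) auto
  also have "\<dots> = (b / m + h) * g" using assms(1) by (simp add: field_simps)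
  finally have "(p + s / m) * f \<le> (b - h) * g + (b / m + h) * g" using assms(2) by (simp add: distrib_right)
  then show ?thesis by (simp add: algebra_simps)
qed

section \<open>Comparison with the constants of the claim\<close>

context obabo_params
begin

text \<open>The bracket shared by \<open>K9\<close> and \<open>K10\<close>; its square is at least 1
  + 1 / m and so accounts for the 1/m contained in \<open>R1\<close>.\<close>

definition Yc :: real where "Yc = 1 + 1 / sqrt m + 2 * \<delta> * K1 L * K3 m L \<delta> / kappa m \<gamma>"

lemma K1_bounds: "17 / 10 \<le> K1 L" "3 * L \<le> (K1 L)\<^sup>2" "3 / L \<le> (K1 L)\<^sup>2"
proof -
  let ?s = "max (L powr (1/2)) (L powr (-1/2))"
  have inv: "L powr (-1/2) = 1 / L powr (1/2)" using powr_minus_divide[of L "1/2"] by simp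
  have p: "0 < L powr (1/2)" using L_pos by simp
  have s1: "1 \<le> ?s"
  proof (cases "1 \<le> L powr (1/2)")
    case False
    then have "1 \<le> L powr (-1/2)" using p unfolding inv by simp
    then show ?thesis by simp
  qed simp
  have "(17 / 10 :: real) \<le> sqrt 3" by (rule real_le_rsqrt) (simp add: power2_eq_square)
  then have "17 / 10 * 1 \<le> sqrt 3 * ?s" using s1 by (intro mult_mono) auto
  then show "17 / 10 \<le> K1 L" by (simp add: K1_def)
  have e: "(K1 L)\<^sup>2 = 3 * ?s\<^sup>2" by (simp add: K1_def power_mult_distrib)
  have "(L powr (1/2))\<^sup>2 \<le> ?s\<^sup>2" using p by (intro power_mono) auto
  moreover have "(L powr (1/2))\<^sup>2 = L" using L_pos by (simp add: powr_half_sqrt)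
  ultimately show "3 * L \<le> (K1 L)\<^sup>2" by (simp add: e)
  have "(L powr (-1/2))\<^sup>2 \<le> ?s\<^sup>2" by (intro power_mono) auto
  moreover have "(L powr (-1/2))\<^sup>2 = 1 / L" using L_pos unfolding inv by (simp add: powr_half_sqrt power_divide)
  ultimately show "3 / L \<le> (K1 L)\<^sup>2" by (simp add: e)
qed

lemma K3_nonneg: "0 \<le> K3 m L \<delta>"
  unfolding K3_def using L_pos \<delta>_pos m_pos by (intro mult_nonneg_nonneg add_nonneg_nonneg) auto

lemma Yc_bounds: "1 \<le> Yc" "1 + 1 / m \<le> Yc\<^sup>2"
proof -
  have k: "0 < kappa m \<gamma>" using \<kappa>_bounds(1) by (simp add: \<kappa>_def)
  have "0 \<le> 2 * \<delta> * K1 L * K3 m L \<delta> / kappa m \<gamma>"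
    using \<delta>_pos K1_bounds(1) K3_nonneg k by (intro divide_nonneg_pos mult_nonneg_nonneg) auto
  then have 1: "1 + 1 / sqrt m \<le> Yc" by (simp add: Yc_def)
  have "0 < 1 / sqrt m" using m_pos by simp
  then show "1 \<le> Yc" using 1 by linarith
  have "1 + 1 / m \<le> (1 + 1 / sqrt m)\<^sup>2" using m_pos by (simp add: power2_sum power_divide)
  also have "\<dots> \<le> Yc\<^sup>2" using 1 m_pos by (intro power_mono) auto
  finally show "1 + 1 / m \<le> Yc\<^sup>2" .
qed

text \<open>Chosen so that bc Yc^2 is the square of 2 (K1 + 3) Yc, whose (l+1)-st power is behind
  \<open>K10\<close>.\<close>

definition bc :: real where "bc = 4 * (K1 L + 3)\<^sup>2"

lemma bc_ge: "75 + 12 * L \<le> bc" "75 + 12 / L \<le> bc"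
proof -
  have bc: "bc = 4 * (K1 L)\<^sup>2 + 24 * K1 L + 36" by (simp add: bc_def power2_eq_square algebra_simps)
  have "12 * L \<le> 4 * (K1 L)\<^sup>2" "12 / L \<le> 4 * (K1 L)\<^sup>2" using K1_bounds(2,3) by simp_all
  then show "75 + 12 * L \<le> bc" "75 + 12 / L \<le> bc" using K1_bounds(1) unfolding bc by linarith+
qed

lemma bc_ge': "75 + 5 * L + 7 * (1 / L) \<le> bc"
  using bc_ge by simp

lemma \<delta>L_sq: "\<delta>\<^sup>2 * L\<^sup>2 \<le> m / 60000"
proof -
  have "\<delta> * L \<le> \<delta> * (\<gamma>\<^sup>2 / 4)" using four_L_le \<delta>_pos by (intro mult_left_mono) auto
  then have "(\<delta> * L)\<^sup>2 \<le> (\<delta> * (\<gamma>\<^sup>2 / 4))\<^sup>2" using \<delta>_pos L_pos by (intro power_mono) auto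
  also have "\<dots> = (\<delta> * \<gamma>) * ((\<delta> * \<gamma>) * \<gamma>\<^sup>2) / 16" by (simp add: power2_eq_square)
  also have "(\<delta> * \<gamma>) * ((\<delta> * \<gamma>) * \<gamma>\<^sup>2) \<le> (1 / 132) * (m / 33)"
    using \<delta>\<gamma> m_pos by (intro mult_mono) auto
  finally show ?thesis using m_pos by (simp add: power_mult_distrib)
qed

end

context obabo_projection
begin

lemma R1_eq: "R1 = 12 / 11 * ((1 + 13 / 50 * L) * (401 / 100 + 77 / (50 * L)) + 2) + (12 / 11 * (1 + 13 / 50 * L) * (121 / 5)) / m"
proof -
  have "12 / 11 * ((a + 121 / (5 * m)) + (13 / 50 * L * (a + 121 / (5 * m)) + 2))
    = 12 / 11 * ((1 + 13 / 50 * L) * a + 2) + (12 / 11 * (1 + 13 / 50 * L) * (121 / 5)) / m" for a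
    using m_pos by (simp add: field_simps)
  then show ?thesis by (simp only: R1_def \<beta>1_def \<alpha>1_def \<alpha>0_def)
qed

lemma R1_pos: "0 < R1" using \<alpha>1_pos \<beta>1_ge by (simp add: R1_def)

lemma R1_parts:
  "12 / 11 * ((1 + 13 / 50 * L) * (401 / 100 + 77 / (50 * L)) + 2) \<le> 7 + 6 / 5 * L + 17 / 10 * (1 / L)"
  "12 / 11 * (1 + 13 / 50 * L) * (121 / 5) \<le> 27 + 7 * L"
proof -
  have "(1 + 13 / 50 * L) * (401 / 100 + 77 / (50 * L)) = 401 / 100 + 77 / 50 / L + 13 / 50 * 401 / 100 * L + 13 / 50 * 77 / 50"
    using L_pos by (simp add: field_simps)
  then show "12 / 11 * ((1 + 13 / 50 * L) * (401 / 100 + 77 / (50 * L)) + 2) \<le> 7 + 6 / 5 * L + 17 / 10 * (1 / L)"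
    using L_pos by (simp add: field_simps)
  show "12 / 11 * (1 + 13 / 50 * L) * (121 / 5) \<le> 27 + 7 * L" using L_pos by (simp add: field_simps)
qed

lemma R1_le: "R1 \<le> bc * Yc\<^sup>2"
proof -
  have L0: "0 < 1 / L" using L_pos by simp
  have "(12 / 11 * ((1 + 13 / 50 * L) * (401 / 100 + 77 / (50 * L)) + 2) + (12 / 11 * (1 + 13 / 50 * L) * (121 / 5)) / m) * 1
     \<le> bc * (1 + 1 / m) * 1"
  proof (rule mult_add_mono_ratio[where h = 0])
    have "7 + 6 / 5 * L + 17 / 10 * (1 / L) \<le> bc" using bc_ge' L_pos L0 by linarith
    then show "12 / 11 * ((1 + 13 / 50 * L) * (401 / 100 + 77 / (50 * L)) + 2) * 1 \<le> (bc - 0) * 1"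
      unfolding mult_1_right diff_0_right by (rule order_trans[OF R1_parts(1)])
    have "27 + 7 * L \<le> bc" using bc_ge(1) L_pos by linarith
    then show "12 / 11 * (1 + 13 / 50 * L) * (121 / 5) * 1 \<le> (bc + 0 * m) * 1"
      unfolding mult_1_right mult_zero_left add_0_right by (rule order_trans[OF R1_parts(2)])
  qed (rule m_pos)
  also have "bc * (1 + 1 / m) * 1 \<le> bc * Yc\<^sup>2" using Yc_bounds(2) by (simp add: bc_def mult_left_mono)
  finally show ?thesis by (simp only: R1_eq mult_1_right)
qed

text \<open>The energy bound carries 1 + \<delta>^2 L^2 where \<open>K9\<close> has 1 + \<delta>^2
  L^2 / 4. On the constant part of \<open>R1\<close> the ratio is at most 401/100, which
  \<open>bc\<close> can afford. On the 1/m part the excess is at most m / 60000 by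
  \<open>\<delta>L_sq\<close>; its factor m cancels 1/m, so \<open>h\<close> charges it to the
  constant part.\<close>

lemma R1_le': "R1 * ((1 + 1 / 100000) * (1 + \<delta>\<^sup>2 * L\<^sup>2)) \<le> bc * Yc\<^sup>2 * (1 + \<delta>\<^sup>2 * (L\<^sup>2 / 4))"
proof -
  define d where "d = \<delta>\<^sup>2 * L\<^sup>2"
  let ?f = "(1 + 1 / 100000) * (1 + d)" and ?g = "1 + d / 4"
  let ?p = "12 / 11 * ((1 + 13 / 50 * L) * (401 / 100 + 77 / (50 * L)) + 2)" and ?s = "12 / 11 * (1 + 13 / 50 * L) * (121 / 5)"
  have d0: "0 \<le> d" and dm: "d \<le> m / 60000" using \<delta>L_sq by (auto simp: d_def)
  have L0: "0 < 1 / L" using L_pos by simp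
  have "(?p + ?s / m) * ?f \<le> bc * (1 + 1 / m) * ?g"
  proof (rule mult_add_mono_ratio[where h = "(27 + 7 * L) / 50000"])
    have f: "?f \<le> 401 / 100 * ?g" using d0 by (simp add: field_simps)
    have "?p * ?f \<le> (7 + 6 / 5 * L + 17 / 10 * (1 / L)) * (401 / 100 * ?g)"
      by (rule mult_mono[OF R1_parts(1) f]) (use L_pos d0 in auto)
    also have "\<dots> = ((7 + 6 / 5 * L + 17 / 10 * (1 / L)) * (401 / 100)) * ?g" by (simp only: mult.assoc)
    also have "\<dots> \<le> (bc - (27 + 7 * L) / 50000) * ?g"
    proof (rule mult_right_mono)
      have "(7 + 6 / 5 * L + 17 / 10 * t) * (401 / 100) + (27 + 7 * L) / 50000 \<le> 75 + 5 * L + 7 * t" if "0 < t" for t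
        using that L_pos by (simp add: field_simps)
      from this[OF L0] show "(7 + 6 / 5 * L + 17 / 10 * (1 / L)) * (401 / 100) \<le> bc - (27 + 7 * L) / 50000"
        using bc_ge' by linarith
    qed (use d0 in simp)
    finally show "?p * ?f \<le> (bc - (27 + 7 * L) / 50000) * ?g" .
    have "?s * ?f \<le> (27 + 7 * L) * ((1 + 1 / 100000) * (1 + m / 60000))"
      by (rule mult_mono[OF R1_parts(2)]) (use L_pos d0 dm in auto)
    also have "\<dots> \<le> (27 + 7 * L) * (101 / 100 + m / 50000)"
      using L_pos m_pos by (intro mult_left_mono) (auto simp: field_simps)
    also have "\<dots> = (27 + 7 * L) * (101 / 100) + (27 + 7 * L) / 50000 * m" by (simp add: field_simps)
    also have "\<dots> \<le> bc + (27 + 7 * L) / 50000 * m"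
    proof (rule add_right_mono)
      have "(27 + 7 * L) * (101 / 100) \<le> 75 + 12 * L" using L_pos by (simp add: field_simps)
      then show "(27 + 7 * L) * (101 / 100) \<le> bc" using bc_ge(1) by linarith
    qed
    also have "\<dots> = (bc + (27 + 7 * L) / 50000 * m) * 1" by simp
    also have "\<dots> \<le> (bc + (27 + 7 * L) / 50000 * m) * ?g"
      using d0 L_pos m_pos by (intro mult_left_mono add_nonneg_nonneg) (auto simp: bc_def)
    finally show "?s * ?f \<le> (bc + (27 + 7 * L) / 50000 * m) * ?g" .
  qed (rule m_pos)
  also have "bc * (1 + 1 / m) * ?g \<le> bc * Yc\<^sup>2 * ?g"
    using Yc_bounds(2) d0 by (intro mult_right_mono mult_left_mono) (auto simp: bc_def)
  finally have "R1 * ?f \<le> bc * Yc\<^sup>2 * ?g" by (simp only: R1_eq)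
  then show ?thesis by (simp add: d_def)
qed

text \<open>The factor 1/\<delta> produced by summing a recursion of rate \<kappa> \<delta> uses up
  one power of \<delta> from the energy error; the noise term keeps that power as a factor
  \<delta>.\<close>

lemma ennreal_rescale:
  "0 \<le> X \<Longrightarrow> 0 \<le> b \<Longrightarrow> ennreal (\<delta> ^ Suc j * X) * (ennreal (1 / \<delta>) * M + ennreal b) = ennreal (\<delta> ^ j * X) * (M + ennreal (\<delta> * b))"
proof -
  assume X: "0 \<le> X" "0 \<le> b"
  have "ennreal (\<delta> ^ Suc j * X) = ennreal (\<delta> ^ j * X) * ennreal \<delta>"
    using \<delta>_pos X by (simp add: ennreal_mult[symmetric] mult_ac)
  then have "ennreal (\<delta> ^ Suc j * X) * (ennreal (1 / \<delta>) * M + ennreal b)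
    = ennreal (\<delta> ^ j * X) * (ennreal \<delta> * ennreal (1 / \<delta>) * M + ennreal \<delta> * ennreal b)"
    by (simp only: distrib_left mult.assoc)
  also have "ennreal \<delta> * ennreal (1 / \<delta>) = 1" using \<delta>_pos by (simp add: ennreal_mult[symmetric])
  finally show ?thesis using \<delta>_pos X by (simp add: ennreal_mult)
qed

lemma u_cont[measurable]: "u \<in> borel_measurable borel"
  by (intro borel_measurable_continuous_onI continuous_at_imp_continuous_on ballI has_derivative_continuous[OF u_deriv])

lemma measurable_energy_error[measurable]: "energy_error \<in> borel_measurable borel"
  unfolding energy_error_def[abs_def] by measurable

lemma powr_one_dimq: "dimq 1 powr 1 = dE"
  using dimq_ge[of 1] by (simp add: dimq_def)

lemma rejection_bound:
  assumes \<nu>: "prob_space \<nu>" "sets \<nu> = sets borel"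
  shows "2 * (\<Sum>k<n. mean_at U \<gamma> \<delta> \<nu> k (\<lambda>z. ennreal (max 0 (energy_error z))))
    \<le> ennreal (\<delta> * K9 m L \<gamma> \<delta>) * ((\<integral>\<^sup>+z. ennreal (zsq z) \<partial>\<nu>) + ennreal (\<delta> * (real n * dE)))"
proof -
  let ?a = "\<delta>\<^sup>2 * (L / 4) * (1 + 1 / 100000) * (1 + \<delta>\<^sup>2 * L\<^sup>2)"
  let ?T = "ennreal (1 / \<delta>) * (\<integral>\<^sup>+z. ennreal (zsq z) \<partial>\<nu>) + ennreal (real n * dE)"
  have a0: "0 \<le> ?a" using L_pos by simp
  have d0: "0 \<le> dE" by (simp add: dE)
  have "mean_at U \<gamma> \<delta> \<nu> k (\<lambda>z. ennreal (max 0 (energy_error z))) \<le> ennreal ?a * mean_at U \<gamma> \<delta> \<nu> k (\<lambda>z. ennreal (zsq z powr 1))" for k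
  proof -
    have "mean_at U \<gamma> \<delta> \<nu> k (\<lambda>z. ennreal (max 0 (energy_error z))) \<le> mean_at U \<gamma> \<delta> \<nu> k (\<lambda>z. ennreal ?a * ennreal (zsq z powr 1))"
    proof (rule mean_at_mono[OF measurable_U \<nu>])
      fix z
      have "max 0 (energy_error z) \<le> ?a * zsq z powr 1"
        using energy_error_le[of z] mult_nonneg_nonneg[OF a0 zsq_nonneg[of z]] zsq_nonneg[of z]
        by (intro max.boundedI) (simp_all only: powr_one)
      then show "ennreal (max 0 (energy_error z)) \<le> ennreal ?a * ennreal (zsq z powr 1)"
        using a0 by (simp add: ennreal_mult[symmetric] ennreal_leI)
    qed
    moreover have "(\<lambda>z. ennreal (zsq z powr 1)) \<in> borel_measurable borel" by measurable
    ultimately show ?thesis by (simp only: mean_at_cmult[OF measurable_U \<nu>])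
  qed
  then have "2 * (\<Sum>k<n. mean_at U \<gamma> \<delta> \<nu> k (\<lambda>z. ennreal (max 0 (energy_error z))))
     \<le> 2 * (ennreal ?a * (\<Sum>k<n. mean_at U \<gamma> \<delta> \<nu> k (\<lambda>z. ennreal (zsq z powr 1))))"
    by (intro mult_left_mono) (auto simp: sum_distrib_left intro: sum_mono)
  also have "\<dots> \<le> 2 * (ennreal ?a * (ennreal (R1 powr 1) * (ennreal (1 + 1 / \<kappa>) * ?T)))"
  proof (intro mult_left_mono)
    have "(\<integral>\<^sup>+z. ennreal (zsq z powr 1) \<partial>\<nu>) = (\<integral>\<^sup>+z. ennreal (zsq z) \<partial>\<nu>)"
      by (intro nn_integral_cong) (simp only: powr_one[OF zsq_nonneg])
    then show "(\<Sum>k<n. mean_at U \<gamma> \<delta> \<nu> k (\<lambda>z. ennreal (zsq z powr 1))) \<le> ennreal (R1 powr 1) * (ennreal (1 + 1 / \<kappa>) * ?T)"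
      using moment_sum[OF \<nu> order_refl, of n] by (simp only: powr_one_dimq)
  qed simp_all
  also have "\<dots> = ennreal (2 * ?a * R1 * (1 + 1 / \<kappa>)) * ?T"
  proof -
    have *: "2 * (ennreal x * (ennreal y * (ennreal w * t))) = ennreal (2 * x * y * w) * t" if "0 \<le> x" "0 \<le> y" "0 \<le> w" for x y w t
      using that by (simp add: ennreal_mult mult.assoc)
    show ?thesis unfolding powr_one[OF less_imp_le[OF R1_pos]]
      by (rule *[OF a0]) (use R1_pos \<kappa>_bounds(1) in auto)
  qed
  also have "\<dots> \<le> ennreal (\<delta> ^ Suc 1 * K9 m L \<gamma> \<delta>) * ?T"
  proof (intro mult_right_mono ennreal_leI)
    let ?k = "1 + 1 / \<kappa>" and ?g = "1 + \<delta>\<^sup>2 * (L\<^sup>2 / 4)"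
    have k0: "0 \<le> ?k" using \<kappa>_bounds(1) by simp
    have "2 * ?a * R1 * ?k = (\<delta>\<^sup>2 * (L / 2) * ?k) * (R1 * ((1 + 1 / 100000) * (1 + \<delta>\<^sup>2 * L\<^sup>2)))" by simp
    also have "\<dots> \<le> (\<delta>\<^sup>2 * (L / 2) * ?k) * (bc * Yc\<^sup>2 * ?g)"
      using k0 L_pos by (intro mult_left_mono R1_le') auto
    also have "\<dots> = (\<delta>\<^sup>2 * (2 * L * (K1 L + 3)\<^sup>2 * Yc\<^sup>2 * ?k)) * ?g" by (simp add: bc_def)
    \<comment> \<open>The last bracket of \<open>K9\<close> dominates \<open>?g\<close>, since the
      terms added to it are nonnegative.\<close>
    also have "\<dots> \<le> (\<delta>\<^sup>2 * (2 * L * (K1 L + 3)\<^sup>2 * Yc\<^sup>2 * ?k)) * (\<delta> * L / 8 + (1 + \<delta> / 4 + \<delta>\<^sup>2 * L / 4) * ?g)"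
    proof (intro mult_left_mono)
      have "1 * ?g \<le> (1 + \<delta> / 4 + \<delta>\<^sup>2 * L / 4) * ?g" using \<delta>_pos L_pos by (intro mult_right_mono) auto
      moreover have "0 \<le> \<delta> * L / 8" using \<delta>_pos L_pos by simp
      moreover have "x \<le> b + y" if "1 * x \<le> y" "0 \<le> b" for x y b :: real using that by simp
      ultimately show "?g \<le> \<delta> * L / 8 + (1 + \<delta> / 4 + \<delta>\<^sup>2 * L / 4) * ?g" by blast
    qed (use L_pos k0 in auto)
    also have "\<dots> = \<delta> ^ Suc 1 * K9 m L \<gamma> \<delta>"
      by (simp add: K9_def Yc_def \<kappa>_def power2_eq_square)
    finally show "2 * ?a * R1 * ?k \<le> \<delta> ^ Suc 1 * K9 m L \<gamma> \<delta>" .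
  qed simp
  also have "\<dots> = ennreal (\<delta> ^ 1 * K9 m L \<gamma> \<delta>) * ((\<integral>\<^sup>+z. ennreal (zsq z) \<partial>\<nu>) + ennreal (\<delta> * (real n * dE)))"
  proof (rule ennreal_rescale)
    show "0 \<le> K9 m L \<gamma> \<delta>" unfolding K9_def using L_pos \<delta>_pos \<kappa>_bounds(1)
      by (intro mult_nonneg_nonneg add_nonneg_nonneg) (auto simp: \<kappa>_def)
  qed (use d0 in simp)
  finally show ?thesis by simp
qed

text \<open>A step costs \<delta>^3 B (1 + zsq^q / 2). The constant 1 sums to n, which is at most n
  times the q-th power of the effective dimension since the latter is at least 1; this is the
  leading 1 in the first bracket of \<open>K10\<close>. The moment part is
  \<open>moment_sum\<close>.\<close>

lemma rejection_bound_hessian: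
  fixes A :: "'e \<Rightarrow> 'e \<Rightarrow> 'e" and l Ll :: real
  assumes \<nu>: "prob_space \<nu>" "sets \<nu> = sets borel"
    and A: "\<And>x. (gr has_derivative A x) (at x)"
    and hess: "\<And>x y h. \<bar>(A y h - A x h) \<bullet> h\<bar> \<le> Ll / 4 * norm (x - y) * (2 + rpow (norm (x - c)) (l - 2) + rpow (norm (y - c)) (l - 2)) * (norm h)\<^sup>2"
    and l: "2 \<le> l" and Ll: "0 < Ll"
  defines "q \<equiv> (l + 1) / 2"
  shows "2 * (\<Sum>k<n. mean_at U \<gamma> \<delta> \<nu> k (\<lambda>z. ennreal (max 0 (energy_error z))))
    \<le> ennreal (\<delta>\<^sup>2 * K10 m L \<gamma> \<delta> l Ll) * ((\<integral>\<^sup>+z. ennreal (zsq z powr q) \<partial>\<nu>) + ennreal (\<delta> * (real n * (dE + l - 1) powr q)))"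
proof -
  define B where "B = (L + 2 * L\<^sup>2) / 4 * (1 + \<delta>\<^sup>2 * (L\<^sup>2 / 4))
        + 2 powr ((l - 3) / 2) * Ll * (1 + L * \<delta> / 2) ^ 3 * (1 + \<delta> + \<delta>\<^sup>2 * L / 2) powr (l - 2)"
  define A0 where "A0 = 2 powr l * (K1 L + 3) powr (l + 1) * Yc powr (l + 1) * (1 / kappa m \<gamma> + 1)"
  have q: "1 \<le> q" using l by (simp add: q_def)
  have Dq: "dimq q = dE + l - 1" by (simp add: dimq_def q_def)
  let ?Dq = "dimq q powr q"
  have D1: "1 \<le> ?Dq" using dimq_ge[OF q] q by (intro ge_one_powr_ge_zero) auto
  let ?T = "ennreal (1 / \<delta>) * (\<integral>\<^sup>+z. ennreal (zsq z powr q) \<partial>\<nu>) + ennreal (real n * ?Dq)"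
  have B0: "0 \<le> B" unfolding B_def using L_pos \<delta>_pos Ll by (intro add_nonneg_nonneg mult_nonneg_nonneg) auto
  have A00: "0 \<le> A0" unfolding A0_def using \<kappa>_bounds(1) by (intro mult_nonneg_nonneg) (auto simp: \<kappa>_def)
  let ?c = "\<delta> ^ 3 * B"
  have c0: "0 \<le> ?c" using B0 \<delta>_pos by simp
  have "2 * mean_at U \<gamma> \<delta> \<nu> k (\<lambda>z. ennreal (max 0 (energy_error z)))
     \<le> ennreal ?c + ennreal (?c / 2) * mean_at U \<gamma> \<delta> \<nu> k (\<lambda>z. ennreal (zsq z powr q))" for k
  proof -
    have m1: "(\<lambda>z. ennreal (max 0 (energy_error z))) \<in> borel_measurable borel" by measurable
    have m2: "(\<lambda>z. ennreal (zsq z powr q)) \<in> borel_measurable borel" by measurable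
    have "2 * mean_at U \<gamma> \<delta> \<nu> k (\<lambda>z. ennreal (max 0 (energy_error z))) = mean_at U \<gamma> \<delta> \<nu> k (\<lambda>z. 2 * ennreal (max 0 (energy_error z)))"
      by (rule mean_at_cmult[OF measurable_U \<nu> m1, symmetric])
    also have "\<dots> \<le> mean_at U \<gamma> \<delta> \<nu> k (\<lambda>z. ennreal ?c * 1 + ennreal (?c / 2) * ennreal (zsq z powr q))"
    proof (rule mean_at_mono[OF measurable_U \<nu>])
      fix z
      have "2 * energy_error z \<le> \<delta> ^ 3 * (B * (1 + zsq z powr q / 2))"
        unfolding B_def q_def by (rule energy_error_le_hessian[OF A hess l Ll])
      also have "\<dots> = ?c * 1 + ?c / 2 * zsq z powr q" by (simp add: distrib_left)
      finally have "2 * max 0 (energy_error z) \<le> ?c * 1 + ?c / 2 * zsq z powr q" using c0 by (simp add: max_def)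
      then have "ennreal (2 * max 0 (energy_error z)) \<le> ennreal (?c * 1 + ?c / 2 * zsq z powr q)" by (rule ennreal_leI)
      also have "ennreal (?c * 1 + ?c / 2 * zsq z powr q) = ennreal ?c * ennreal 1 + ennreal (?c / 2) * ennreal (zsq z powr q)"
        using c0 by (intro ennreal_lin) auto
      finally show "2 * ennreal (max 0 (energy_error z)) \<le> ennreal ?c * 1 + ennreal (?c / 2) * ennreal (zsq z powr q)"
        by (simp add: ennreal_mult)
    qed
    also have "\<dots> = ennreal ?c * mean_at U \<gamma> \<delta> \<nu> k (\<lambda>_. 1) + ennreal (?c / 2) * mean_at U \<gamma> \<delta> \<nu> k (\<lambda>z. ennreal (zsq z powr q))"
      by (rule mean_at_lin[OF measurable_U \<nu> _ m2]) simp
    finally show ?thesis by (simp add: mean_at_const[OF measurable_U \<nu>])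
  qed
  then have "2 * (\<Sum>k<n. mean_at U \<gamma> \<delta> \<nu> k (\<lambda>z. ennreal (max 0 (energy_error z))))
     \<le> (\<Sum>k<n. ennreal ?c + ennreal (?c / 2) * mean_at U \<gamma> \<delta> \<nu> k (\<lambda>z. ennreal (zsq z powr q)))"
    by (auto simp: sum_distrib_left intro: sum_mono)
  also have "\<dots> = ennreal (real n * ?c) + ennreal (?c / 2) * (\<Sum>k<n. mean_at U \<gamma> \<delta> \<nu> k (\<lambda>z. ennreal (zsq z powr q)))"
    by (simp only: sum.distrib sum_distrib_left[symmetric] sum_const_ennreal)
  also have "\<dots> \<le> ennreal ?c * ?T + ennreal (?c / 2) * (ennreal (R1 powr q) * (ennreal (1 + 1 / \<kappa>) * ?T))"
  proof (intro add_mono mult_left_mono moment_sum[OF \<nu> q])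
    have "(real n * ?c) * 1 \<le> (real n * ?c) * ?Dq" by (rule mult_left_mono[OF D1]) (use c0 in simp)
    then have "real n * ?c \<le> ?c * (real n * ?Dq)" by (simp add: mult_ac)
    then have "ennreal (real n * ?c) \<le> ennreal (?c * (real n * ?Dq))" by (rule ennreal_leI)
    also have "\<dots> = ennreal ?c * ennreal (real n * ?Dq)" using c0 by (intro ennreal_mult) auto
    also have "\<dots> \<le> ennreal ?c * ?T" by (intro mult_left_mono) auto
    finally show "ennreal (real n * ?c) \<le> ennreal ?c * ?T" .
  qed simp
  also have "\<dots> = ennreal (?c * (1 + R1 powr q * (1 + 1 / \<kappa>) / 2)) * ?T"
  proof -
    have *: "ennreal x * t + ennreal (x / 2) * (ennreal y * (ennreal w * t)) = ennreal (x * (1 + y * w / 2)) * t" if "0 \<le> x" "0 \<le> y" "0 \<le> w" for x y w t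
    proof -
      have "ennreal (x / 2) * (ennreal y * (ennreal w * t)) = ennreal (x / 2 * y * w) * t"
        using that by (simp add: ennreal_mult[symmetric] mult.assoc[symmetric] del: times_divide_eq_left)
      then have "ennreal x * t + ennreal (x / 2) * (ennreal y * (ennreal w * t)) = (ennreal x + ennreal (x / 2 * y * w)) * t"
        by (simp only: distrib_right)
      also have "ennreal x + ennreal (x / 2 * y * w) = ennreal (x + x / 2 * y * w)"
        using that by (intro ennreal_plus[symmetric]) auto
      finally show ?thesis by (simp add: distrib_left mult.assoc)
    qed
    show ?thesis by (rule *) (use c0 \<kappa>_bounds(1) in auto)
  qed
  also have "\<dots> \<le> ennreal (\<delta> ^ Suc 2 * ((1 + A0) * B)) * ?T"
  proof (intro mult_right_mono ennreal_leI)
    let ?k = "1 + 1 / \<kappa>"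
    have k0: "0 \<le> ?k" using \<kappa>_bounds(1) by simp
    have K: "0 \<le> K1 L + 3" "0 \<le> Yc" using K1_bounds(1) Yc_bounds(1) by linarith+
    have "R1 powr q \<le> (bc * Yc\<^sup>2) powr q" using R1_le R1_pos q by (intro powr_mono2) auto
    also have "bc * Yc\<^sup>2 = (2 * ((K1 L + 3) * Yc))\<^sup>2" by (simp add: bc_def power_mult_distrib)
    also have "((2 * ((K1 L + 3) * Yc))\<^sup>2) powr q = (2 * ((K1 L + 3) * Yc)) powr (l + 1)"
    proof -
      have p: "0 < 2 * ((K1 L + 3) * Yc)" using K1_bounds(1) Yc_bounds(1) by simp
      have "((2 * ((K1 L + 3) * Yc))\<^sup>2) powr q = ((2 * ((K1 L + 3) * Yc)) powr 2) powr q" using p by simp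
      also have "\<dots> = (2 * ((K1 L + 3) * Yc)) powr (2 * q)" by (rule powr_powr)
      also have "2 * q = l + 1" by (simp add: q_def field_simps)
      finally show ?thesis .
    qed
    \<comment> \<open>One factor 2 is split off to cancel the 1/2 in front of the moment, so that
      2^l as in \<open>K10\<close> remains.\<close>
    also have "(2 * ((K1 L + 3) * Yc)) powr (l + 1) = 2 * (2 powr l * (K1 L + 3) powr (l + 1) * Yc powr (l + 1))"
      using K powr_mult[of 2 "(K1 L + 3) * Yc" "l + 1"] powr_mult[of "K1 L + 3" Yc "l + 1"] powr_add[of 2 l 1] by simp
    finally have "R1 powr q * ?k \<le> 2 * (2 powr l * (K1 L + 3) powr (l + 1) * Yc powr (l + 1)) * ?k"
      using k0 by (rule mult_right_mono)
    also have "\<dots> = 2 * A0" by (simp add: A0_def \<kappa>_def add.commute)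
    finally have "1 + R1 powr q * ?k / 2 \<le> 1 + A0" by simp
    then have "?c * (1 + R1 powr q * ?k / 2) \<le> ?c * (1 + A0)" using c0 by (rule mult_left_mono)
    also have "\<dots> = \<delta> ^ Suc 2 * ((1 + A0) * B)" by (simp add: power3_eq_cube power2_eq_square)
    finally show "?c * (1 + R1 powr q * ?k / 2) \<le> \<delta> ^ Suc 2 * ((1 + A0) * B)" .
  qed simp
  also have "\<dots> = ennreal (\<delta> ^ 2 * ((1 + A0) * B)) * ((\<integral>\<^sup>+z. ennreal (zsq z powr q) \<partial>\<nu>) + ennreal (\<delta> * (real n * ?Dq)))"
    using A00 B0 by (intro ennreal_rescale) auto
  also have "(1 + A0) * B = K10 m L \<gamma> \<delta> l Ll" by (simp add: A0_def B_def K10_def Yc_def)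
  finally show ?thesis by (simp add: Dq)
qed

end

section \<open>The acceptance-rejection error\<close>

lemma gderiv_grad:
  fixes f :: "'a::euclidean_space \<Rightarrow> real"
  assumes "f differentiable at x"
  shows "GDERIV f x :> grad f x"
proof -
  obtain f' where f': "(f has_derivative f') (at x)" using assms by (auto simp: differentiable_def)
  have "f' = (\<lambda>h. h \<bullet> adjoint f' 1)" using adjoint_works[OF has_derivative_linear[OF f'], of _ 1] by auto
  then have "GDERIV f x :> adjoint f' 1" using f' by (simp add: gderiv_def)
  moreover have "D = D'" if "GDERIV f x :> D" "GDERIV f x :> D'" for D D'
  proof -
    have "(\<lambda>h. h \<bullet> D) = (\<lambda>h. h \<bullet> D')"
      using that unfolding gderiv_def by (rule has_derivative_unique)
    then show ?thesis by (metis vector_eq_ldot)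
  qed
  ultimately show ?thesis unfolding grad_def by (metis theI)
qed

lemma derivative_arg_min:
  fixes f :: "'a::euclidean_space \<Rightarrow> real"
  assumes "is_arg_min f (\<lambda>_. True) x" "(f has_derivative f') (at x)"
  shows "f' h = 0"
proof -
  have "f' = (\<lambda>v. 0)"
    using assms(1) by (intro differential_zero_maxmin[OF UNIV_I open_UNIV assms(2)]) (auto simp: is_arg_min_def not_less)
  then show ?thesis by simp
qed

lemma sqrt_powr: "0 \<le> s \<Longrightarrow> sqrt s powr p = s powr (p / 2)"
  by (simp add: powr_half_sqrt[symmetric] powr_powr)

lemma rpow_nat: "0 \<le> x \<Longrightarrow> 2 \<le> l \<Longrightarrow> rpow x (real l - 2) = x ^ (l - 2)"
  by (cases "x = 0") (auto simp: rpow_def powr_realpow[symmetric] of_nat_diff zero_power)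

text \<open>The expected number of rejections if every step of the OBABO chain were put to the
  Metropolis test, doubled because total variation is normalised to 2. The constants m, L, l and the
  minimiser do not occur, so one function serves all parts of the claim.\<close>

definition rejection_error :: "(real ^ 'n::finite \<Rightarrow> real) \<Rightarrow> real \<Rightarrow> real \<Rightarrow> nat \<Rightarrow> 'n phase measure \<Rightarrow> ennreal" where
  "rejection_error U \<gamma> \<delta> n \<nu> = 2 * (\<Sum>k<n. mean_at U \<gamma> \<delta> \<nu> k (\<lambda>z. ennreal (1 - accept_prob U \<delta> z)))"

lemma rejection_le_energy:
  "1 - accept_prob U \<delta> z \<le> max 0 (hamiltonian U (verlet U \<delta> z) - hamiltonian U z)"
  using exp_ge_add_one_self[of "- max 0 (hamiltonian U (verlet U \<delta> z) - hamiltonian U z)"]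
  unfolding accept_prob_def by linarith

text \<open>The triangle inequality is carried out on each set A: from the adjusted to the
  unadjusted chain for \<nu>, from \<nu> to \<mu> through the couplings of the unadjusted laws, and
  back to the adjusted chain for \<mu>. \<open>tv_dist_le\<close> then returns to couplings.\<close>

lemma tv_dist_ombabo_le:
  fixes U :: "real ^ 'n::finite \<Rightarrow> real"
  assumes meas: "grad U \<in> borel_measurable borel" "U \<in> borel_measurable borel"
    and \<nu>: "prob_space \<nu>" "sets \<nu> = sets borel" and \<mu>: "prob_space \<mu>" "sets \<mu> = sets borel"
  shows "tv_dist (law_after (ombabo_kernel U \<gamma> \<delta>) n \<nu>) (law_after (ombabo_kernel U \<gamma> \<delta>) n \<mu>)
    \<le> tv_dist (law_after (obabo_kernel U \<gamma> \<delta>) n \<nu>) (law_after (obabo_kernel U \<gamma> \<delta>) n \<mu>)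
      + rejection_error U \<gamma> \<delta> n \<nu> + rejection_error U \<gamma> \<delta> n \<mu>" (is "_ \<le> ?tv + ?e \<nu> + ?e \<mu>")
proof -
  let ?P = "\<lambda>\<rho>. law_after (obabo_kernel U \<gamma> \<delta>) n \<rho>" and ?M = "\<lambda>\<rho>. law_after (ombabo_kernel U \<gamma> \<delta>) n \<rho>"
  note K = measurable_obabo_kernel[OF meas] prob_space_obabo_kernel[OF meas]
  note K' = measurable_ombabo_kernel[OF meas] prob_space_ombabo_kernel[OF meas]
  have close: "2 * emeasure (?M \<rho>) A \<le> 2 * emeasure (?P \<rho>) A + ?e \<rho>"
    "2 * emeasure (?P \<rho>) A \<le> 2 * emeasure (?M \<rho>) A + ?e \<rho>"
    if \<rho>: "prob_space \<rho>" "sets \<rho> = sets borel" and A: "A \<in> sets borel" for \<rho> A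
  proof -
    let ?S = "\<Sum>k<n. \<integral>\<^sup>+z. rejection U \<gamma> \<delta> z \<partial>law_after (obabo_kernel U \<gamma> \<delta>) k \<rho>"
    have s: "sets (?P \<rho>) = sets borel" "sets (?M \<rho>) = sets borel"
      using law_after_prob[OF K \<rho>] law_after_prob[OF K' \<rho>] by auto
    have f: "indicator A \<in> borel_measurable borel" "indicator A z \<le> (1 :: ennreal)" for z :: "'n phase"
      using A by (auto simp: indicator_def)
    have e: "?e \<rho> = 2 * ?S" by (simp add: rejection_error_def mean_at_def rejection_def[OF meas])
    have c1: "(\<integral>\<^sup>+y. f y \<partial>ombabo_kernel U \<gamma> \<delta> z) \<le> (\<integral>\<^sup>+y. f y \<partial>obabo_kernel U \<gamma> \<delta> z) + rejection U \<gamma> \<delta> z"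
      and c2: "(\<integral>\<^sup>+y. f y \<partial>obabo_kernel U \<gamma> \<delta> z) \<le> (\<integral>\<^sup>+y. f y \<partial>ombabo_kernel U \<gamma> \<delta> z) + rejection U \<gamma> \<delta> z"
      if "f \<in> borel_measurable borel" "\<And>z. f z \<le> 1" for f z
      by (rule kernels_close[OF meas that])+
    have "(\<integral>\<^sup>+z. indicator A z \<partial>?M \<rho>) \<le> (\<integral>\<^sup>+z. indicator A z \<partial>?P \<rho>) + ?S"
      by (rule law_after_close(1)[OF K K' \<rho> borel_measurable_rejection[OF meas] c1 c2 f])
    then have 1: "emeasure (?M \<rho>) A \<le> emeasure (?P \<rho>) A + ?S" using A s by (simp only: nn_integral_indicator)
    have "(\<integral>\<^sup>+z. indicator A z \<partial>?P \<rho>) \<le> (\<integral>\<^sup>+z. indicator A z \<partial>?M \<rho>) + ?S"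
      by (rule law_after_close(2)[OF K K' \<rho> borel_measurable_rejection[OF meas] c1 c2 f])
    then have 2: "emeasure (?P \<rho>) A \<le> emeasure (?M \<rho>) A + ?S" using A s by (simp only: nn_integral_indicator)
    show "2 * emeasure (?M \<rho>) A \<le> 2 * emeasure (?P \<rho>) A + ?e \<rho>"
      "2 * emeasure (?P \<rho>) A \<le> 2 * emeasure (?M \<rho>) A + ?e \<rho>"
      unfolding e distrib_left[symmetric] by (rule mult_left_mono[OF 1], simp) (rule mult_left_mono[OF 2], simp)
  qed
  \<comment> \<open>Half of the target, because \<open>tv_dist_le\<close> doubles its
    defect.\<close>
  define e where "e = ennreal (1 / 2) * (?tv + ?e \<nu> + ?e \<mu>)"
  have e2: "2 * e = ?tv + ?e \<nu> + ?e \<mu>"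
  proof -
    have "2 * ennreal (1 / 2) = ennreal (2 * (1 / 2))" by (subst ennreal_mult) simp_all
    then have "2 * ennreal (1 / 2) = 1" by simp
    then show ?thesis by (simp only: e_def mult.assoc[symmetric]) simp
  qed
  have "tv_dist (?M \<nu>) (?M \<mu>) \<le> 2 * e"
  proof (rule tv_dist_le)
    fix A :: "'n phase set" assume A: "A \<in> sets borel"
    have fin: "emeasure (?P \<rho>) A \<noteq> \<infinity>" if "prob_space \<rho>" "sets \<rho> = sets borel" for \<rho>
    proof -
      interpret prob_space "?P \<rho>" using law_after_prob[OF K that] by blast
      show ?thesis using emeasure_finite by simp
    qed
    have "2 * emeasure (?M \<nu>) A \<le> 2 * emeasure (?P \<nu>) A + ?e \<nu>" by (rule close[OF \<nu> A])
    also have "\<dots> \<le> (2 * emeasure (?P \<mu>) A + ?tv) + ?e \<nu>"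
      using law_after_prob[OF K \<nu>] law_after_prob[OF K \<mu>]
      by (intro add_right_mono emeasure_le_tv_dist A fin \<nu> \<mu>) auto
    also have "\<dots> \<le> ((2 * emeasure (?M \<mu>) A + ?e \<mu>) + ?tv) + ?e \<nu>"
      by (intro add_right_mono close[OF \<mu> A])
    also have "\<dots> = 2 * (emeasure (?M \<mu>) A + e)" unfolding distrib_left e2 by (simp only: ac_simps)
    finally show "emeasure (?M \<nu>) A \<le> emeasure (?M \<mu>) A + e"
      by (subst (asm) ennreal_mult_le_mult_iff) auto
  qed (use law_after_prob[OF K' \<nu>] law_after_prob[OF K' \<mu>] in auto)
  then show ?thesis by (simp only: e2)
qed

section \<open>Error bounds for a strongly convex potential\<close>

locale obabo_potential = obabo_params m L \<gamma> \<delta> for m L \<gamma> \<delta> :: real +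
  fixes U :: "real ^ 'n::finite \<Rightarrow> real" and x\<^sub>s :: "real ^ 'n"
  assumes C2: "C2 U" and grad_lip: "\<And>x y. norm (grad U x - grad U y) \<le> L * norm (x - y)"
    and grad_mono: "\<And>x y. m * (norm (x - y))\<^sup>2 \<le> (x - y) \<bullet> (grad U x - grad U y)"
    and arg_min: "is_arg_min U (\<lambda>_. True) x\<^sub>s"
begin

lemma U_deriv: "(U has_derivative (\<lambda>h. grad U x \<bullet> h)) (at x)"
  using gderiv_grad[of U x] C2 by (simp add: C2_def gderiv_def inner_commute)

lemma U_cont: "continuous_on UNIV U"
  by (intro continuous_at_imp_continuous_on ballI has_derivative_continuous[OF U_deriv])

lemma grad_cont: "continuous_on UNIV (grad U)"
  using C2 by (intro continuous_at_imp_continuous_on ballI differentiable_imp_continuous_within) (simp add: C2_def)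

lemma meas: "grad U \<in> borel_measurable borel" "U \<in> borel_measurable borel"
  using grad_cont U_cont by (auto intro: borel_measurable_continuous_onI)

lemma grad_zero: "grad U x\<^sub>s = 0"
  using derivative_arg_min[OF arg_min U_deriv, of "grad U x\<^sub>s"] by simp

lemma adjoint_id: "adjoint (\<lambda>x :: real ^ 'n. x) = (\<lambda>x. x)"
  by (rule adjoint_unique) simp

sublocale full: obabo_projection m L \<gamma> \<delta> U "\<lambda>x. x" U "grad U" x\<^sub>s "real CARD('n)"
  by unfold_locales
    (auto simp: adjoint_id grad_cont U_cont U_deriv grad_lip grad_mono grad_zero intro: linear_ident)

lemma energy_error_full: "full.energy_error z = hamiltonian U (verlet U \<delta> z) - hamiltonian U z"
  by (simp add: full.energy_error_def full.vel_def hamiltonian_def case_prod_beta diff_divide_distrib)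

lemma moment_full: "moment \<nu> (x\<^sub>s, 0) p = (\<integral>\<^sup>+z. ennreal (full.zsq z powr (p / 2)) \<partial>\<nu>)"
proof -
  have "norm (z - (x\<^sub>s, 0)) powr p = full.zsq z powr (p / 2)" for z :: "'n phase"
    using sqrt_powr[OF full.zsq_nonneg, of z p]
    by (cases z) (simp add: full.zsq_def full.pos_def full.vel_def norm_Pair)
  then show ?thesis by (simp add: moment_def)
qed

lemma rejection_error_le_full:
  assumes \<nu>: "prob_space \<nu>" "sets \<nu> = sets borel"
  shows "rejection_error U \<gamma> \<delta> n \<nu> \<le> 2 * (\<Sum>k<n. mean_at U \<gamma> \<delta> \<nu> k (\<lambda>z. ennreal (max 0 (full.energy_error z))))"
  unfolding rejection_error_def energy_error_full
  by (intro mult_left_mono sum_mono mean_at_mono[OF meas \<nu>] ennreal_leI rejection_le_energy) auto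

lemma rejection_error_bound:
  assumes \<nu>: "prob_space \<nu>" "sets \<nu> = sets borel"
  shows "rejection_error U \<gamma> \<delta> n \<nu> \<le> ennreal (\<delta> * K9 m L \<gamma> \<delta>)
    * (moment \<nu> (x\<^sub>s, 0) 2 + ennreal (\<delta> * real n * real CARD('n)))"
proof -
  have "full.zsq z powr (2 / 2) = full.zsq z" for z
    using full.zsq_nonneg[of z] by simp
  then have "moment \<nu> (x\<^sub>s, 0) 2 = (\<integral>\<^sup>+z. ennreal (full.zsq z) \<partial>\<nu>)" by (simp only: moment_full)
  then show ?thesis
    using order_trans[OF rejection_error_le_full[OF \<nu>] full.rejection_bound[OF \<nu>]] by (simp add: mult.assoc)
qed

text \<open>Cauchy-Schwarz turns the operator norm bound into the bound on quadratic forms that the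
  energy estimate asks for.\<close>

lemma rejection_error_bound_hessian:
  fixes l Ll :: real
  assumes \<nu>: "prob_space \<nu>" "sets \<nu> = sets borel" and l: "2 \<le> l" "0 < Ll"
    and H: "\<And>x y. op_norm (hessian U y - hessian U x)
      \<le> Ll / 4 * norm (x - y) * (2 + rpow (norm (x - x\<^sub>s)) (l - 2) + rpow (norm (y - x\<^sub>s)) (l - 2))"
  shows "rejection_error U \<gamma> \<delta> n \<nu> \<le> ennreal (\<delta>\<^sup>2 * K10 m L \<gamma> \<delta> l Ll)
    * (moment \<nu> (x\<^sub>s, 0) (l + 1) + ennreal (\<delta> * real n * (real CARD('n) + l - 1) powr ((l + 1) / 2)))"
proof -
  have A: "(grad U has_derivative (\<lambda>h. hessian U x *v h)) (at x)" for x
    using C2 unfolding C2_def hessian_def by (simp add: jacobian_works)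
  have "\<bar>(hessian U y *v h - hessian U x *v h) \<bullet> h\<bar>
      \<le> Ll / 4 * norm (x - y) * (2 + rpow (norm (x - x\<^sub>s)) (l - 2) + rpow (norm (y - x\<^sub>s)) (l - 2)) * (norm h)\<^sup>2" for x y h
  proof -
    have "\<bar>(hessian U y *v h - hessian U x *v h) \<bullet> h\<bar> \<le> norm ((hessian U y - hessian U x) *v h) * norm h"
      unfolding matrix_vector_mult_diff_rdistrib[symmetric] by (rule Cauchy_Schwarz_ineq2)
    also have "\<dots> \<le> (op_norm (hessian U y - hessian U x) * norm h) * norm h"
      unfolding op_norm_def by (intro mult_right_mono onorm matrix_vector_mul_bounded_linear) simp
    also have "\<dots> = op_norm (hessian U y - hessian U x) * (norm h)\<^sup>2" by (simp add: power2_eq_square)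
    also have "\<dots> \<le> Ll / 4 * norm (x - y) * (2 + rpow (norm (x - x\<^sub>s)) (l - 2) + rpow (norm (y - x\<^sub>s)) (l - 2)) * (norm h)\<^sup>2"
      by (intro mult_right_mono H) simp
    finally show ?thesis .
  qed
  from order_trans[OF rejection_error_le_full[OF \<nu>] full.rejection_bound_hessian[OF \<nu> A this l]]
  show ?thesis by (simp add: mult.assoc moment_full)
qed

text \<open>Each coordinate in the rotated basis is a one-dimensional image of the chain, to which
  the Hessian bound applies with dE = 1. There dE + l - 1 = l, and d enters only as the number of
  coordinates. The increment of the Hamiltonian is the sum of the coordinate increments, as the
  rotation preserves |v|^2.\<close>

lemma rejection_error_bound_separable:
  fixes Q :: "real ^ 'n ^ 'n" and V :: "'n \<Rightarrow> real \<Rightarrow> real" and y\<^sub>s :: "'n \<Rightarrow> real" and l :: nat and Ll :: real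
  assumes \<nu>: "prob_space \<nu>" "sets \<nu> = sets borel" and l: "2 \<le> l" "0 < Ll"
    and Q: "orthogonal_matrix Q" and V: "\<And>i. C2_real (V i)"
    and UV: "\<And>x. U (Q *v x) = (\<Sum>i\<in>UNIV. V i (x $ i))"
    and y: "\<And>i. is_arg_min (V i) (\<lambda>_. True) (y\<^sub>s i)"
    and H: "\<And>i x y. \<bar>deriv (deriv (V i)) y - deriv (deriv (V i)) x\<bar>
      \<le> Ll / 4 * \<bar>x - y\<bar> * (2 + \<bar>x - y\<^sub>s i\<bar> ^ (l - 2) + \<bar>y - y\<^sub>s i\<bar> ^ (l - 2))"
  shows "rejection_error U \<gamma> \<delta> n \<nu> \<le> ennreal (\<delta>\<^sup>2 * K10 m L \<gamma> \<delta> (real l) Ll)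
    * ((\<Sum>i\<in>UNIV. moment (marginal Q \<nu> i) (y\<^sub>s i, 0) (real l + 1))
      + ennreal (\<delta> * real n * real CARD('n) * real l powr ((real l + 1) / 2)))"
proof -
  note transpose_matrix_vector[simp del]
  let ?R = "transpose Q" and ?q = "(real l + 1) / 2"
  \<comment> \<open>The columns of \<open>Q\<close>, an orthonormal basis in which \<open>U\<close>
    separates.\<close>
  define q where "q i = Q *v axis i 1" for i
  define T where "T i x = (?R *v x) $ i" for i x
  have QR: "Q *v (?R *v x) = x" "?R *v (Q *v x) = x" for x
    using Q by (simp_all add: orthogonal_matrix_def matrix_vector_mul_assoc)
  have inv: "matrix_inv Q = ?R"
  proof -
    have QQ: "Q ** ?R = mat 1" "?R ** Q = mat 1" using Q by (simp_all add: orthogonal_matrix_def)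
    then have "Q ** matrix_inv Q = mat 1 \<and> matrix_inv Q ** Q = mat 1"
      unfolding matrix_inv_def by (intro someI[of "\<lambda>B. Q ** B = mat 1 \<and> B ** Q = mat 1" ?R]) simp
    then have "(matrix_inv Q ** Q) ** ?R = ?R" by simp
    then show ?thesis by (simp only: matrix_mul_assoc[symmetric] QQ matrix_mul_rid)
  qed
  have RQ: "(?R *v x) \<bullet> y = x \<bullet> (Q *v y)" for x y
    by (simp add: transpose_matrix_vector dot_lmul_matrix)
  have T_q: "T i x = x \<bullet> q i" for i x
    using RQ[of x "axis i 1"] by (simp add: T_def q_def inner_axis)
  have Tq: "T j (q i) = (if j = i then 1 else 0)" for i j
    by (simp add: T_def q_def QR axis_def)
  have nq: "norm (q i) = 1" for i
    using T_q[of i "q i"] Tq[of i i] by (simp add: norm_eq_1)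
  have norm_T: "(norm v)\<^sup>2 = (\<Sum>i\<in>UNIV. (T i v)\<^sup>2)" for v
  proof -
    have "(norm v)\<^sup>2 = (?R *v v) \<bullet> (?R *v v)" unfolding RQ QR by (simp add: dot_square_norm)
    then show ?thesis by (simp add: inner_vec_def T_def power2_eq_square)
  qed
  have UT: "U x = (\<Sum>i\<in>UNIV. V i (T i x))" for x
    using UV[of "?R *v x"] by (simp add: QR T_def)
  have T_lin: "bounded_linear (T i)" for i
    unfolding T_q by (rule bounded_linear_inner_left)
  have dV: "(V i has_real_derivative deriv (V i) t) (at t)" "(deriv (V i) has_real_derivative deriv (deriv (V i)) t) (at t)" for i t
    using V[of i] by (auto simp: C2_real_def DERIV_deriv_iff_real_differentiable)
  \<comment> \<open>Uniqueness of the derivative of \<open>U\<close>, tested on the direction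
    \<open>q i\<close>.\<close>
  have grad_T: "T i (grad U x) = deriv (V i) (T i x)" for i x
  proof -
    have "((\<lambda>x. V j (T j x)) has_derivative (\<lambda>h. deriv (V j) (T j x) * T j h)) (at x)" for j
      using has_derivative_compose[OF bounded_linear_imp_has_derivative[OF T_lin[of j]] dV(1)[unfolded has_field_derivative_def]] .
    then have "(U has_derivative (\<lambda>h. \<Sum>j\<in>UNIV. deriv (V j) (T j x) * T j h)) (at x)"
      unfolding UT[abs_def] by (intro has_derivative_sum)
    then have "(\<lambda>h. grad U x \<bullet> h) = (\<lambda>h. \<Sum>j\<in>UNIV. deriv (V j) (T j x) * T j h)"
      by (rule has_derivative_unique[OF U_deriv])
    then have "grad U x \<bullet> q i = (\<Sum>j\<in>UNIV. deriv (V j) (T j x) * T j (q i))" by (rule fun_cong)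
    then show ?thesis by (simp add: T_q[of i "grad U x"] Tq if_distrib[of "\<lambda>s. _ * s"] cong: if_cong)
  qed
  have Tline: "T i (t *\<^sub>R q i) = t" for i t
    using Tq[of i i] by (simp add: T_q)
  \<comment> \<open>The Lipschitz and monotonicity bounds for \<open>deriv (V i)\<close> are those
    of \<open>grad U\<close> on the line spanned by \<open>q i\<close>.\<close>
  have grad_line: "deriv (V i) s - deriv (V i) t = (grad U (s *\<^sub>R q i) - grad U (t *\<^sub>R q i)) \<bullet> q i" for i s t
    using grad_T[of i "s *\<^sub>R q i"] grad_T[of i "t *\<^sub>R q i"] by (simp add: Tline T_q[of i "grad U _"] inner_diff_left)
  have line: "norm (s *\<^sub>R q i - t *\<^sub>R q i) = \<bar>s - t\<bar>" for i and s t :: real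
    by (simp add: scaleR_diff_left[symmetric] nq)
  have adj: "adjoint (T i) = (\<lambda>t. t *\<^sub>R q i)" for i
    by (rule adjoint_unique) (simp add: T_q)
  have proj: "obabo_projection m L \<gamma> \<delta> U (T i) (V i) (deriv (V i)) (y\<^sub>s i) 1" for i
  proof (intro obabo_projection.intro obabo_projection_axioms.intro obabo_params_axioms)
    show "linear (T i)" using T_lin by (rule bounded_linear.linear)
    show "T i (adjoint (T i) t) = t" for t by (simp add: adj Tline)
    show "(V i has_derivative (\<lambda>h. deriv (V i) t \<bullet> h)) (at t)" for t
      using dV(1) by (simp add: has_field_derivative_def)
    fix s t :: real
    show "norm (deriv (V i) s - deriv (V i) t) \<le> L * norm (s - t)"
    proof -
      have "norm (deriv (V i) s - deriv (V i) t) \<le> norm (grad U (s *\<^sub>R q i) - grad U (t *\<^sub>R q i)) * norm (q i)"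
        unfolding grad_line real_norm_def by (rule Cauchy_Schwarz_ineq2)
      also have "\<dots> \<le> L * norm (s *\<^sub>R q i - t *\<^sub>R q i)" by (simp add: nq grad_lip)
      finally show ?thesis by (simp add: line)
    qed
    show "m * (norm (s - t))\<^sup>2 \<le> (s - t) \<bullet> (deriv (V i) s - deriv (V i) t)"
      using grad_mono[of "s *\<^sub>R q i" "t *\<^sub>R q i"]
      unfolding real_norm_def grad_line[of i s t] scaleR_diff_left[symmetric] inner_scaleR_left inner_real_def
      by (simp only: norm_scaleR nq mult_1_right inner_commute[of "q i"])
    show "deriv (V i) (y\<^sub>s i) = 0"
      using derivative_arg_min[OF y dV(1)[unfolded has_field_derivative_def], of i 1] by simp
  qed (auto simp: grad_T grad_cont U_cont)
  define err where "err i z = V i (T i (fst (verlet U \<delta> z))) - V i (T i (fst z))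
    + ((T i (snd (verlet U \<delta> z)))\<^sup>2 - (T i (snd z))\<^sup>2) / 2" for i z
  have energy: "hamiltonian U (verlet U \<delta> z) - hamiltonian U z = (\<Sum>i\<in>UNIV. err i z)" for z
    by (simp add: hamiltonian_def case_prod_beta UT norm_T err_def sum.distrib sum_subtractf
        sum_divide_distrib[symmetric] diff_divide_distrib)
  have meas_err: "(\<lambda>z. ennreal (max 0 (err i z))) \<in> borel_measurable borel" for i
  proof -
    interpret p: obabo_projection m L \<gamma> \<delta> U "T i" "V i" "deriv (V i)" "y\<^sub>s i" 1 by (rule proj)
    have "err i = p.energy_error" by (auto simp: err_def p.energy_error_def p.vel_def)
    then show ?thesis using p.measurable_energy_error by simp
  qed
  have bound: "2 * (\<Sum>k<n. mean_at U \<gamma> \<delta> \<nu> k (\<lambda>z. ennreal (max 0 (err i z))))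
    \<le> ennreal (\<delta>\<^sup>2 * K10 m L \<gamma> \<delta> (real l) Ll)
      * (moment (marginal Q \<nu> i) (y\<^sub>s i, 0) (real l + 1) + ennreal (\<delta> * (real n * real l powr ?q)))" for i
  proof -
    interpret p: obabo_projection m L \<gamma> \<delta> U "T i" "V i" "deriv (V i)" "y\<^sub>s i" 1 by (rule proj)
    have e: "err i = p.energy_error" by (auto simp: err_def p.energy_error_def p.vel_def)
    have mo: "moment (marginal Q \<nu> i) (y\<^sub>s i, 0) (real l + 1) = (\<integral>\<^sup>+z. ennreal (p.zsq z powr ?q) \<partial>\<nu>)"
    proof -
      have Tm: "(\<lambda>z. (T i (fst z), T i (snd z))) \<in> borel_measurable borel"
        using p.measurable_T by measurable
      have "moment (marginal Q \<nu> i) (y\<^sub>s i, 0) (real l + 1)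
        = (\<integral>\<^sup>+z. ennreal (norm ((T i (fst z), T i (snd z)) - (y\<^sub>s i, 0)) powr (real l + 1)) \<partial>\<nu>)"
        unfolding moment_def marginal_def inv case_prod_beta T_def[symmetric]
        by (subst nn_integral_distr) (use Tm \<nu>(2) in \<open>auto cong: measurable_cong_sets\<close>)
      also have "\<dots> = (\<integral>\<^sup>+z. ennreal (p.zsq z powr ?q) \<partial>\<nu>)"
        using sqrt_powr[OF p.zsq_nonneg, of _ "real l + 1"]
        by (simp add: p.zsq_def p.pos_def p.vel_def norm_Pair)
      finally show ?thesis .
    qed
    have "\<bar>(deriv (deriv (V i)) t * h - deriv (deriv (V i)) s * h) \<bullet> h\<bar>
      \<le> Ll / 4 * norm (s - t) * (2 + rpow (norm (s - y\<^sub>s i)) (real l - 2) + rpow (norm (t - y\<^sub>s i)) (real l - 2)) * (norm h)\<^sup>2" for s t h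
    proof -
      have "(deriv (deriv (V i)) t * h - deriv (deriv (V i)) s * h) \<bullet> h = (deriv (deriv (V i)) t - deriv (deriv (V i)) s) * h\<^sup>2"
        by (simp add: power2_eq_square algebra_simps)
      then have "\<bar>(deriv (deriv (V i)) t * h - deriv (deriv (V i)) s * h) \<bullet> h\<bar> = \<bar>deriv (deriv (V i)) t - deriv (deriv (V i)) s\<bar> * h\<^sup>2"
        by (simp add: abs_mult)
      also have "\<dots> \<le> Ll / 4 * \<bar>s - t\<bar> * (2 + \<bar>s - y\<^sub>s i\<bar> ^ (l - 2) + \<bar>t - y\<^sub>s i\<bar> ^ (l - 2)) * h\<^sup>2"
        by (intro mult_right_mono H) simp
      finally show ?thesis using l by (simp add: rpow_nat)
    qed
    from p.rejection_bound_hessian[OF \<nu> dV(2)[unfolded has_field_derivative_def] this _ l(2), of n]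
    show ?thesis using l(1) by (simp add: e mo)
  qed
  have "rejection_error U \<gamma> \<delta> n \<nu> \<le> 2 * (\<Sum>k<n. mean_at U \<gamma> \<delta> \<nu> k (\<lambda>z. \<Sum>i\<in>UNIV. ennreal (max 0 (err i z))))"
    unfolding rejection_error_def
  proof (intro mult_left_mono sum_mono mean_at_mono[OF meas \<nu>])
    fix z
    have "1 - accept_prob U \<delta> z \<le> max 0 (\<Sum>i\<in>UNIV. err i z)"
      using rejection_le_energy[of U \<delta> z] by (simp only: energy)
    \<comment> \<open>Cancellation between the coordinates is given up here, which leaves d
      one-dimensional problems.\<close>
    also have "\<dots> \<le> (\<Sum>i\<in>UNIV. max 0 (err i z))"
      by (intro max.boundedI sum_nonneg sum_mono) auto
    finally have "ennreal (1 - accept_prob U \<delta> z) \<le> ennreal (\<Sum>i\<in>UNIV. max 0 (err i z))" by (rule ennreal_leI)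
    then show "ennreal (1 - accept_prob U \<delta> z) \<le> (\<Sum>i\<in>UNIV. ennreal (max 0 (err i z)))"
      by (subst sum_ennreal) simp_all
  qed simp
  also have "\<dots> = (\<Sum>i\<in>UNIV. 2 * (\<Sum>k<n. mean_at U \<gamma> \<delta> \<nu> k (\<lambda>z. ennreal (max 0 (err i z)))))"
  proof -
    have "mean_at U \<gamma> \<delta> \<nu> k (\<lambda>z. \<Sum>i\<in>UNIV. ennreal (max 0 (err i z)))
        = (\<Sum>i\<in>UNIV. mean_at U \<gamma> \<delta> \<nu> k (\<lambda>z. ennreal (max 0 (err i z))))" for k
      by (rule mean_at_sum[OF meas \<nu>]) (simp_all only: finite meas_err)
    then show ?thesis
      by (simp only: sum_distrib_left[symmetric]) (simp only: sum.swap[of _ UNIV "{..<n}"])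
  qed
  also have "\<dots> \<le> (\<Sum>i\<in>UNIV. ennreal (\<delta>\<^sup>2 * K10 m L \<gamma> \<delta> (real l) Ll)
      * (moment (marginal Q \<nu> i) (y\<^sub>s i, 0) (real l + 1) + ennreal (\<delta> * (real n * real l powr ?q))))"
    by (intro sum_mono bound)
  also have "\<dots> = ennreal (\<delta>\<^sup>2 * K10 m L \<gamma> \<delta> (real l) Ll)
    * ((\<Sum>i\<in>UNIV. moment (marginal Q \<nu> i) (y\<^sub>s i, 0) (real l + 1))
      + ennreal (\<delta> * real n * real CARD('n) * real l powr ?q))"
  proof -
    have "(\<Sum>i\<in>(UNIV :: 'n set). ennreal x) = ennreal (real CARD('n) * x)" for x
      by (simp add: ennreal_mult' ennreal_of_nat_eq_real_of_nat)
    then show ?thesis by (simp only: sum_distrib_left[symmetric] sum.distrib mult_ac)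
  qed
  finally show ?thesis .
qed

end

theorem proposition14:
  "\<exists>\<E> :: (real ^ 'n \<Rightarrow> real) \<Rightarrow> real \<Rightarrow> real \<Rightarrow> nat \<Rightarrow> 'n::finite phase measure \<Rightarrow> ennreal.
   \<forall>(U :: real ^ 'n \<Rightarrow> real) (m::real) (L::real) (\<gamma>::real) (\<delta>::real) (x\<^sub>s :: real ^ 'n).
     C2 U \<and> 0 < m \<and> m \<le> L \<and>
     (\<forall>x y. norm (grad U x - grad U y) \<le> L * norm (x - y)) \<and>
     (\<forall>x y. (x - y) \<bullet> (grad U x - grad U y) \<ge> m * (norm (x - y))\<^sup>2) \<and>
     \<gamma> \<ge> 2 * sqrt L \<and> 0 < \<delta> \<and> \<delta> \<le> m / (33 * \<gamma> ^ 3) \<and>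
     is_arg_min U (\<lambda>_. True) x\<^sub>s
     \<longrightarrow>
     (\<forall>n\<ge>1.
       (\<forall>\<nu>\<in>prob_moment 2. \<forall>\<mu>\<in>prob_moment 2.
          tv_dist (law_after (ombabo_kernel U \<gamma> \<delta>) n \<nu>) (law_after (ombabo_kernel U \<gamma> \<delta>) n \<mu>)
          \<le> tv_dist (law_after (obabo_kernel U \<gamma> \<delta>) n \<nu>) (law_after (obabo_kernel U \<gamma> \<delta>) n \<mu>)
             + \<E> U \<gamma> \<delta> n \<nu> + \<E> U \<gamma> \<delta> n \<mu>) \<and>
       (\<forall>\<nu>\<in>prob_moment 2.
          \<E> U \<gamma> \<delta> n \<nu> \<le> ennreal (\<delta> * K9 m L \<gamma> \<delta>)
            * (moment \<nu> (x\<^sub>s, 0) 2 + ennreal (\<delta> * real n * real CARD('n)))) \<and>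
       (\<forall>(l::real) (L\<^sub>l::real).
          l \<ge> 2 \<and> L\<^sub>l > 0 \<and>
          (\<forall>x y. op_norm (hessian U y - hessian U x)
             \<le> L\<^sub>l / 4 * norm (x - y)
                * (2 + rpow (norm (x - x\<^sub>s)) (l - 2) + rpow (norm (y - x\<^sub>s)) (l - 2)))
          \<longrightarrow>
          (\<forall>\<nu>\<in>prob_moment (l + 1).
             \<E> U \<gamma> \<delta> n \<nu> \<le> ennreal (\<delta>\<^sup>2 * K10 m L \<gamma> \<delta> l L\<^sub>l)
               * (moment \<nu> (x\<^sub>s, 0) (l + 1)
                  + ennreal (\<delta> * real n * (real CARD('n) + l - 1) powr ((l + 1) / 2))))) \<and>
       (\<forall>(l::nat) (L\<^sub>l::real) (Q :: real ^ 'n ^ 'n) (V :: 'n \<Rightarrow> real \<Rightarrow> real) (y\<^sub>s :: 'n \<Rightarrow> real).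
          l \<ge> 2 \<and> L\<^sub>l > 0 \<and> orthogonal_matrix Q \<and> (\<forall>i. C2_real (V i)) \<and>
          (\<forall>x. U (Q *v x) = (\<Sum>i\<in>UNIV. V i (x $ i))) \<and>
          (\<forall>i. is_arg_min (V i) (\<lambda>_. True) (y\<^sub>s i)) \<and>
          (\<forall>i x y. \<bar>deriv (deriv (V i)) y - deriv (deriv (V i)) x\<bar>
             \<le> L\<^sub>l / 4 * \<bar>x - y\<bar> * (2 + \<bar>x - y\<^sub>s i\<bar> ^ (l - 2) + \<bar>y - y\<^sub>s i\<bar> ^ (l - 2)))
          \<longrightarrow>
          (\<forall>\<nu>\<in>prob_moment (real l + 1).
             \<E> U \<gamma> \<delta> n \<nu> \<le> ennreal (\<delta>\<^sup>2 * K10 m L \<gamma> \<delta> (real l) L\<^sub>l)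
               * ((\<Sum>i\<in>UNIV. moment (marginal Q \<nu> i) (y\<^sub>s i, 0) (real l + 1))
                  + ennreal (\<delta> * real n * real CARD('n) * real l powr ((real l + 1) / 2))))))"
proof (intro exI[of _ rejection_error] allI impI, goal_cases)
  case (1 U m L \<gamma> \<delta> x\<^sub>s n)
  then interpret obabo_potential m L \<gamma> \<delta> U x\<^sub>s by unfold_locales auto
  have pm: "prob_space \<nu>" "sets \<nu> = sets borel" if "\<nu> \<in> prob_moment p" for p and \<nu> :: "'n phase measure"
    using that by (auto simp: prob_moment_def)
  show ?case
  proof (intro conjI ballI allI impI, goal_cases)
    case (1 \<nu> \<mu>)
    then show ?case by (intro tv_dist_ombabo_le meas pm)
  next
    case (2 \<nu>)
    then show ?case by (intro rejection_error_bound pm)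
  next
    case (3 l Ll \<nu>)
    then show ?case using rejection_error_bound_hessian[OF pm[OF 3(2)]] by blast
  next
    case (4 l Ll Q V y \<nu>)
    then show ?case using rejection_error_bound_separable[OF pm[OF 4(2)], of l Ll Q V y] by blast
  qed
qed

end
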